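(* Consider the plant $$\dot x=Ax+B_1w+B_2u,\qquad z=C_1(C_2x-r)+D_{12}u,\qquad y=C_2x+D_{21}w,$$ in closed loop with the tracking controller $\mathbf{K}_{CQ}^{T}$ (defined in the context) built from any stabilizing controllers $$\mathbf C:\ \dot x_c=A_cx_c+B_c(y-r),\ u_c=C_cx_c+D_c(y-r),\qquad \mathbf K:\ \dot x_k=A_kx_k+B_ky,\ u_k=C_kx_k+D_ky .$$ Let $w,r\in\mathcal P$ be bounded power signals that are orthogonal, i.e. $\mathbf S_{wr}=0$. Then the performance measure $\|z\|_{\mathcal P}^2$ of the closed-loop system is the sum of two separate terms: $$\|z\|_{\mathcal P}^2=\|z_1\|_{\mathcal P}^2+\|z_2\|_{\mathcal P}^2,$$ where $$\|z_1\|_{\mathcal P}^2=\frac1{2\pi}\int_{-\infty}^{\infty}\mathrm{Trace}\big[\mathbf T_{z_1w}(j\omega)\mathbf S_{ww}(j\omega)\mathbf T_{z_1w}^*(j\omega)\big]\,d\omega,$$ $$\|z_2\|_{\mathcal P}^2=\frac1{2\pi}\int_{-\infty}^{\infty}\mathrm{Trace}\big[\mathbf T_{z_2r}(j\omega)\mathbf S_{rr}(j\omega)\mathbf T_{z_2r}^*(j\omega)\big]\,d\omega,$$ with $\mathbf T_{z_1w}(s)$ and $\mathbf T_{z_2r}(s)$ dependent on $\mathbf K$ and $\mathbf C$ respectively, according to $$\mathbf T_{z_1w}(s)=\left[\begin{array}{cc|c} A+B_2D_kC_2 & B_2C_k & B_1+B_2D_kD_{21} \\ B_kC_2 & A_k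 & B_kD_{21} \\ \hline (C_1+D_{12}D_k)C_2 & D_{12}C_k & 0 \end{array}\right],$$ $$\mathbf T_{z_2r}(s)=\left[\begin{array}{cc|c} A+B_2D_cC_2 & B_2C_c & -B_2D_c \\ B_cC_2 & A_c & -B_c \\ \hline (C_1+D_{12}D_c)C_2 & D_{12}C_c & -(C_1+D_{12}D_c) \end{array}\right].$$
   Context: All matrices are real, constant, of compatible dimensions; a square matrix is stable if all its eigenvalues have negative real part. Notation: $\left[\begin{array}{c|c} A & B \\ \hline C & D \end{array}\right]:=C(sI-A)^{-1}B+D$; a prime denotes transpose; $\mathbf T^*(j\omega)$ is the conjugate transpose of $\mathbf T(j\omega)$. Standing assumptions: $(A,B_2)$ is stabilizable and $(C_2,A)$ is detectable; $\mathbf C$ and $\mathbf K$ are stabilizing, i.e. $\begin{bmatrix} A+B_2D_cC_2 & B_2C_c \\ B_cC_2 & A_c \end{bmatrix}$ and $\begin{bmatrix} A+B_2D_kC_2 & B_2C_k \\ B_kC_2 & A_k \end{bmatrix}$ are stable; $L$, $L_c$ are matrices such that $A+LC_2$ and $A_c+L_cC_c$ are stable. The tracking controller $\mathbf{K}_{CQ}^{T}$ (inputs $y,r$, output $u$) is $$\begin{aligned} \dot x_c&=(A_c+L_cC_c)x_c-L_cu+(B_c+L_cD_c)(y-r),\quad u_c=C_cx_c+D_c(y-r),\\ \dot{\hat x}&=A\hat x+B_2u+Lf,\quad f=C_2\hat x-y,\\ \dot x_q&=A_qx_q+B_qf,\quad u_q=C_qx_q+D_qf,\quad u=u_c+u_q,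 \end{aligned}$$ with $$A_q=\begin{bmatrix} A_c+L_cC_c & (B_c+L_cD_q)C_2 & -L_cC_k \\ 0 & A+B_2D_kC_2 & B_2C_k \\ 0 & B_kC_2 & A_k \end{bmatrix},\ B_q=\begin{bmatrix} -B_c-L_cD_q \\ L-B_2D_k \\ -B_k \end{bmatrix},\ C_q=\begin{bmatrix} -C_c & -D_qC_2 & C_k \end{bmatrix},\ D_q=D_c-D_k.$$ The closed-loop transfer matrix from $\begin{bmatrix} w\\ r\end{bmatrix}$ to $z$ is $\begin{bmatrix}\mathbf T_{z_1w}(s) & \mathbf T_{z_2r}(s)\end{bmatrix}$. $z_1$ is the performance output $z_1=C_1C_2x+D_{12}u$ of the plant with $r=0$ (controlled by $\mathbf K$), and $z_2$ is the performance output $z_2=C_1(C_2x-r)+D_{12}u$ of the plant with $w=0$ (controlled by $\mathbf C$). Bounded power signals: all signals are deterministic, real vector valued, and zero for $t<0$. For signals $u,v$, $R_{uv}(\tau)=\lim_{T\to\infty}\frac1T\int_0^Tu(t+\tau)v(t)'\,dt$ is the (cross-)correlation, and its Fourier transform $\mathbf S_{uv}(j\omega)=\int_{-\infty}^\infty R_{uv}(\tau)e^{-j\omega\tau}d\tau$ is the (cross) spectral density. A signal $u$ has bounded power ($u\in\mathcal P$) if (1) $\|u(t)\|$ is bounded for all $t\ge0$; (2) $R_{uu}(\tau)$ exists for all $\tau$ and $\mathbf S_{uu}(j\omega)$ exists; (3) $\lim_{T\to\infty}\frac1T\int_0^T\|u(t)\|^2dt<\infty$. On $\mathcal P$ the seminorm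 is $\|u\|_{\mathcal P}=\big(\lim_{T\to\infty}\frac1T\int_0^T\|u(t)\|^2dt\big)^{1/2}=\sqrt{\mathrm{Trace}[R_{uu}(0)]}=\Big(\frac1{2\pi}\int_{-\infty}^\infty\mathrm{Trace}[\mathbf S_{uu}(j\omega)]d\omega\Big)^{1/2}$.
   Formalization: The direct term of T_{z1w} is D12 Dk D21 instead of the printed 0, which is wrong unless D12 Dk D21 = 0; the formula expressing the power by the spectral density is taken as part of membership in P; all dimensions are at least 1. *)

theory Defs
  imports "HOL-Analysis.Analysis"
begin

section \<open>Matrices and transfer matrices\<close>

text \<open>Block matrices are indexed by sum types: \<open>M ||| N\<close> puts \<open>N\<close> to the right of \<open>M\<close>,
  \<open>M /// N\<close> puts \<open>N\<close> below \<open>M\<close>.\<close>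

definition hcat :: "'e^'a^'m \<Rightarrow> 'e^'b^'m \<Rightarrow> 'e^('a + 'b)^'m"  (infixr "|||" 63)
  where "M ||| N = (\<chi> i j. case j of Inl a \<Rightarrow> M $ i $ a | Inr b \<Rightarrow> N $ i $ b)"

definition vcat :: "'e^'n^'a \<Rightarrow> 'e^'n^'b \<Rightarrow> 'e^'n^('a + 'b)"  (infixr "'/'/'/" 62)
  where "M /// N = (\<chi> i. case i of Inl a \<Rightarrow> M $ a | Inr b \<Rightarrow> N $ b)"

definition cmat :: "real^'n^'m \<Rightarrow> complex^'n^'m"
  where "cmat M = (\<chi> i j. complex_of_real (M $ i $ j))"

definition conj_transpose :: "complex^'n^'m \<Rightarrow> complex^'m^'n"
  where "conj_transpose M = (\<chi> i j. cnj (M $ j $ i))"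

definition stable_matrix :: "real^'n^'n \<Rightarrow> bool"
  where "stable_matrix A \<longleftrightarrow> (\<forall>l v. v \<noteq> 0 \<and> cmat A *v v = l *s v \<longrightarrow> Re l < 0)"

definition stabilizable :: "real^'n^'n \<Rightarrow> real^'m^'n \<Rightarrow> bool"
  where "stabilizable A B \<longleftrightarrow> (\<exists>F. stable_matrix (A + B ** F))"

definition detectable :: "real^'n^'p \<Rightarrow> real^'n^'n \<Rightarrow> bool"
  where "detectable C A \<longleftrightarrow> (\<exists>L. stable_matrix (A + L ** C))"

definition transfer_matrix ::
  "real^'n^'n \<Rightarrow> real^'m^'n \<Rightarrow> real^'n^'p \<Rightarrow> real^'m^'p \<Rightarrow> complex \<Rightarrow> complex^'m^'p"
  where "transfer_matrix A B C D s =
    cmat C ** matrix_inv (mat s - cmat A) ** cmat B + cmat D"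


section \<open>State equations\<close>

text \<open>\<open>state_eq x v\<close> says that \<open>x\<close> solves the differential equation \<open>x' = v\<close> on \<open>t \<ge> 0\<close>, with
  arbitrary initial value. Inputs are only assumed to be measurable, hence the integrated
  (Caratheodory) form; by the fundamental theorem of calculus for the Henstock-Kurzweil integral
  every classical solution is a solution in this sense. As all signals, states vanish for \<open>t < 0\<close>.\<close>

definition state_eq :: "(real \<Rightarrow> real^'n) \<Rightarrow> (real \<Rightarrow> real^'n) \<Rightarrow> bool"
  where "state_eq x v \<longleftrightarrow>
    (\<forall>t<0. x t = 0) \<and> (\<forall>t\<ge>0. (v has_integral (x t - x 0)) {0..t})"


section \<open>Bounded power signals\<close>

definition avg_product ::
     "(real \<Rightarrow> real^'n) \<Rightarrow> (real \<Rightarrow> real^'m) \<Rightarrow> real \<Rightarrow> real \<Rightarrow> real^'m^'n"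
  where "avg_product u v \<tau> T =
    (1 / T) *\<^sub>R integral {0..T} (\<lambda>t. \<chi> i j. u (t + \<tau>) $ i * v t $ j)"

definition correlation_exists :: "(real \<Rightarrow> real^'n) \<Rightarrow> (real \<Rightarrow> real^'m) \<Rightarrow> bool"
  where "correlation_exists u v \<longleftrightarrow> (\<forall>\<tau>. \<exists>R. (avg_product u v \<tau> \<longlongrightarrow> R) at_top)"

definition correlation :: "(real \<Rightarrow> real^'n) \<Rightarrow> (real \<Rightarrow> real^'m) \<Rightarrow> real \<Rightarrow> real^'m^'n"
  where "correlation u v \<tau> = Lim at_top (avg_product u v \<tau>)"

definition spectral_integrand ::
    "(real \<Rightarrow> real^'n) \<Rightarrow> (real \<Rightarrow> real^'m) \<Rightarrow> real \<Rightarrow> real \<Rightarrow> complex^'m^'n"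
  where "spectral_integrand u v \<omega> \<tau> =
    (\<chi> i j. complex_of_real (correlation u v \<tau> $ i $ j) * exp (- \<i> * of_real \<omega> * of_real \<tau>))"

definition spectral_density_exists :: "(real \<Rightarrow> real^'n) \<Rightarrow> (real \<Rightarrow> real^'m) \<Rightarrow> bool"
  where "spectral_density_exists u v \<longleftrightarrow>
    correlation_exists u v \<and> (\<forall>\<omega>. integrable lborel (spectral_integrand u v \<omega>))"

definition spectral_density ::
    "(real \<Rightarrow> real^'n) \<Rightarrow> (real \<Rightarrow> real^'m) \<Rightarrow> real \<Rightarrow> complex^'m^'n"
  where "spectral_density u v \<omega> = (LINT \<tau>|lborel. spectral_integrand u v \<omega> \<tau>)"

definition avg_power :: "(real \<Rightarrow> real^'n) \<Rightarrow> real \<Rightarrow> real"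
  where "avg_power u T = (1 / T) * integral {0..T} (\<lambda>t. (norm (u t))\<^sup>2)"

definition power_norm :: "(real \<Rightarrow> real^'n) \<Rightarrow> real"
  where "power_norm u = sqrt (Lim at_top (avg_power u))"

text \<open>The last conjunct is the identity expressing the seminorm through the spectral density. It is
  part of what it means that the spectral density exists: the pointwise Fourier integral of the
  correlation can exist without representing the signal. For the chirp \<open>cos (t\<^sup>2)\<close> the
  autocorrelation is \<open>1/2\<close> at \<open>0\<close> and \<open>0\<close> elsewhere, so its Fourier integral vanishes although
  the power is \<open>1/2\<close>.\<close>

definition bounded_power :: "(real \<Rightarrow> real^'n) \<Rightarrow> bool"
  where "bounded_power u \<longleftrightarrow>
    u \<in> borel_measurable borel \<and> (\<forall>t<0. u t = 0) \<and>
    bounded (u ` {0..}) \<and>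
    spectral_density_exists u u \<and>
    (\<exists>P. (avg_power u \<longlongrightarrow> P) at_top) \<and>
    has_bochner_integral lborel (\<lambda>\<omega>. 1 / (2 * of_real pi) * trace (spectral_density u u \<omega>))
      (complex_of_real ((power_norm u)\<^sup>2))"

definition orthogonal_signals :: "(real \<Rightarrow> real^'n) \<Rightarrow> (real \<Rightarrow> real^'m) \<Rightarrow> bool"
  where "orthogonal_signals u v \<longleftrightarrow>
    spectral_density_exists u v \<and> (\<forall>\<omega>. spectral_density u v \<omega> = 0)"

end

theory Submission
  imports Defs "HOL-Probability.Characteristic_Functions"
    "HOL-Computational_Algebra.Fundamental_Theorem_Algebra"
begin

text \<open>In the coordinates \<open>(q2 - (xh - x), q3)\<close> and \<open>(xh - q2, xc - q1)\<close>, where \<open>xq = (q1, q2, q3)\<close>,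
  the closed loop contains the loop of the plant with \<open>K\<close> driven by \<open>w\<close> alone and the loop of the
  plant with \<open>C\<close> driven by \<open>r\<close> alone, and \<open>z\<close> is the sum of their outputs.

  The output of a stable system is a static gain plus a convolution with an integrable kernel plus an
  integrable transient. Correlations pass through such filters by dominated convergence, so spectra are
  multiplied by transfer functions, and the cross spectrum of the two outputs vanishes because that
  of \<open>w\<close> and \<open>r\<close> does. To interchange integrals one needs that the spectral density is integrable
  entrywise and represents the correlation at every point: the first holds as it is positive
  semidefinite with integrable trace; the second by Gaussian summability, since the power identity makes
  the signal continuous in mean square.\<close>


section \<open>Time averages of bounded signals\<close>

text \<open>Fourier inversion is proved only for \<open>w\<close> and \<open>r\<close>. The
  predicate \<open>cspec\<close> stores it together with the correlation and is preserved by sums,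
  filters and exchange of the arguments, so that outputs inherit it, and with it the whole
  definition of bounded power. There is an apparent circle: inverting an entry of the spectral
  matrix requires that entry to be integrable, while only the trace is known to be so. Gaussian
  filters break it, as they give positivity from the correlation alone.

  The splitting of the loop is one of signals: \<open>u\<close> is the sum of the controls that
  \<open>K\<close> and \<open>C\<close> apply in the two small loops. The initial states of these
  loops may differ from those of the reference loops for \<open>z1\<close> and \<open>z2\<close>,
  but the difference has no power.

  Stability is a statement on eigenvalues. Decay is derived from an annihilating polynomial of least
  degree, whose roots are eigenvalues, so that an induction over linear factors takes the place of a
  normal form.\<close>

definition sig :: "(real \<Rightarrow> complex) \<Rightarrow> bool"
  where "sig u \<longleftrightarrow> u \<in> borel_measurable borel \<and> (\<exists>B. \<forall>t. norm (u t) \<le> B)"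

definition avg :: "(real \<Rightarrow> complex) \<Rightarrow> (real \<Rightarrow> complex) \<Rightarrow> real \<Rightarrow> complex"
  where "avg u v T = (LINT t|lborel. indicator {0..T} t *\<^sub>R (u t * cnj (v t))) / of_real T"

text \<open>A relation instead of a value of \<open>Lim\<close>, so that existence of the limit
  travels with every rule. As \<open>avg\<close> conjugates its second argument, the pairing is
  sesquilinear and \<open>mean u u\<close> is a power.\<close>

definition mean :: "(real \<Rightarrow> complex) \<Rightarrow> (real \<Rightarrow> complex) \<Rightarrow> complex \<Rightarrow> bool"
  where "mean u v c \<longleftrightarrow> (avg u v \<longlongrightarrow> c) at_top"

definition corr :: "(real \<Rightarrow> complex) \<Rightarrow> (real \<Rightarrow> complex) \<Rightarrow> (real \<Rightarrow> complex) \<Rightarrow> bool"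
  where "corr u v R \<longleftrightarrow> (\<forall>\<tau>. mean (\<lambda>t. u (t + \<tau>)) v (R \<tau>))"

lemma norm_integral_le:
  fixes f :: "'a \<Rightarrow> 'b::{banach, second_countable_topology}"
  assumes "integrable M f" "integrable M g" "\<And>x. norm (f x) \<le> g x"
  shows "norm (integral\<^sup>L M f) \<le> integral\<^sup>L M g"
  by (rule order_trans[OF integral_norm_bound integral_mono]) (use assms in auto)

lemma borel_measurable_cnj [measurable (raw)]:
  "f \<in> borel_measurable M \<Longrightarrow> (\<lambda>x. cnj (f x)) \<in> borel_measurable M"
  by (rule measurable_compose[OF _ borel_measurable_continuous_onI]) (auto intro!: continuous_intros)

lemma sigD [measurable_dest]: "sig u \<Longrightarrow> u \<in> borel_measurable borel"
  by (simp add: sig_def)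

lemma sig_bound:
  assumes "sig u" obtains B where "B > 0" "\<And>t. norm (u t) \<le> B"
proof -
  from assms obtain B where "\<And>t. norm (u t) \<le> B" by (auto simp: sig_def)
  then have "\<And>t. norm (u t) \<le> max B 1" by (simp add: le_max_iff_disj)
  with that[of "max B 1"] show ?thesis by simp
qed

lemma sig_zero [simp]: "sig (\<lambda>t. 0)"
  by (auto simp: sig_def)

lemma sig_add:
  assumes "sig u" "sig v" shows "sig (\<lambda>t. u t + v t)"
proof -
  note [measurable] = sigD[OF assms(1)] sigD[OF assms(2)]
  obtain B C where "\<And>t. norm (u t) \<le> B" "\<And>t. norm (v t) \<le> C"
    using sig_bound assms by metis
  then have "norm (u t + v t) \<le> B + C" for t by (meson norm_triangle_mono)
  then show ?thesis unfolding sig_def by (auto intro!: borel_measurable_add sigD assms)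
qed

lemma sig_cmult:
  assumes "sig u" shows "sig (\<lambda>t. c * u t)"
proof -
  note [measurable] = sigD[OF assms]
  obtain B where "\<And>t. norm (u t) \<le> B" using sig_bound assms by metis
  then have "norm (c * u t) \<le> norm c * B" for t by (simp add: norm_mult mult_left_mono)
  then show ?thesis unfolding sig_def by auto
qed

lemma sig_diff: "sig u \<Longrightarrow> sig v \<Longrightarrow> sig (\<lambda>t. u t - v t)"
  using sig_add[of u "\<lambda>t. (-1) * v t"] sig_cmult[of v "-1"] by simp

lemma sig_sum: "(\<And>k. k \<in> F \<Longrightarrow> sig (u k)) \<Longrightarrow> sig (\<lambda>t. \<Sum>k\<in>F. u k t)"
  by (induction F rule: infinite_finite_induct) (auto intro: sig_add)

lemma sig_shift: "sig u \<Longrightarrow> sig (\<lambda>t. u (t + \<tau>))"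
  by (auto simp: sig_def)

lemma sig_mult_integrable:
  assumes "sig u" "integrable lborel f"
  shows "integrable lborel (\<lambda>t. f t * u t)"
proof -
  note [measurable] = sigD[OF assms(1)] borel_measurable_integrable[OF assms(2)]
  obtain B where B: "B > 0" "\<And>t. norm (u t) \<le> B" using sig_bound assms by metis
  have m: "integrable lborel (\<lambda>t. B * norm (f t))" using assms(2) by simp
  show ?thesis
  proof (rule Bochner_Integration.integrable_bound[OF m])
    show "AE t in lborel. norm (f t * u t) \<le> norm (B * norm (f t))"
      using B by (auto simp: norm_mult mult.commute[of B] intro!: mult_left_mono)
  qed measurable
qed

lemma sig_prod_integrable:
  assumes "sig u" "sig v"
  shows "integrable lborel (\<lambda>t. indicator {a..b} t *\<^sub>R (u t * cnj (v t)))"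
proof -
  note [measurable] = sigD[OF assms(1)] sigD[OF assms(2)]
  obtain B C where B: "B > 0" "\<And>t. norm (u t) \<le> B" and C: "C > 0" "\<And>t. norm (v t) \<le> C"
    using sig_bound assms by metis
  show ?thesis
  proof (rule integrableI_bounded_set_indicator[where B="B * C"])
    show "AE x in lborel. x \<in> {a..b} \<longrightarrow> norm (u x * cnj (v x)) \<le> B * C"
      using B C by (auto simp: norm_mult intro!: mult_mono less_imp_le[OF B(1)])
  qed (auto simp: emeasure_lborel_Icc_eq)
qed

lemma norm_segment_le:
  assumes "sig u" "sig v" "\<And>t. norm (u t) \<le> B" "\<And>t. norm (v t) \<le> C" "a \<le> b"
  shows "norm (LINT t|lborel. indicator {a..b} t *\<^sub>R (u t * cnj (v t))) \<le> (b - a) * (B * C)"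
proof -
  have "B \<ge> 0" using assms(3)[of 0] norm_ge_zero order_trans by blast
  have "norm (LINT t|lborel. indicator {a..b} t *\<^sub>R (u t * cnj (v t)))
      \<le> (LINT t|lborel. indicator {a..b} t * (B * C))"
  proof (rule norm_integral_le)
    show "integrable lborel (\<lambda>t. indicator {a..b} t * (B * C))"
      by (intro integrable_mult_left) (simp add: integrable_indicator_iff emeasure_lborel_Icc_eq)
  next
    fix t
    show "norm (indicator {a..b} t *\<^sub>R (u t * cnj (v t))) \<le> indicator {a..b} t * (B * C)"
      using assms(3,4) \<open>B \<ge> 0\<close> by (auto simp: norm_mult indicator_def intro!: mult_mono)
  qed (rule sig_prod_integrable[OF assms(1,2)])
  also have "\<dots> = (b - a) * (B * C)" using assms(5) by simp
  finally show ?thesis .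
qed

lemma norm_avg_le:
  assumes "sig u" "sig v" "\<And>t. norm (u t) \<le> B" "\<And>t. norm (v t) \<le> C" "T > 0"
  shows "norm (avg u v T) \<le> B * C"
  using norm_segment_le[OF assms(1-4), of 0 T] assms(5)
  by (simp add: avg_def norm_divide field_simps)

lemma mean_bound:
  assumes "sig u" "sig v" "\<And>t. norm (u t) \<le> B" "\<And>t. norm (v t) \<le> C" "mean u v c"
  shows "norm c \<le> B * C"
proof (rule tendsto_upperbound)
  show "((\<lambda>T. norm (avg u v T)) \<longlongrightarrow> norm c) at_top"
    using assms(5) unfolding mean_def by (rule tendsto_norm)
  show "\<forall>\<^sub>F T in at_top. norm (avg u v T) \<le> B * C"
    using eventually_gt_at_top[of 0] by eventually_elim (rule norm_avg_le[OF assms(1-4)])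
qed simp

lemma mean_unique: "mean u v c \<Longrightarrow> mean u v c' \<Longrightarrow> c = c'"
  unfolding mean_def by (rule tendsto_unique[rotated]) auto

lemma mean_add_left:
  assumes "sig u" "sig u'" "sig v" "mean u v c" "mean u' v c'"
  shows "mean (\<lambda>t. u t + u' t) v (c + c')"
proof -
  have "avg (\<lambda>t. u t + u' t) v = (\<lambda>T. avg u v T + avg u' v T)"
    using assms(1-3)
    by (auto simp: avg_def fun_eq_iff ring_distribs scaleR_add_right add_divide_distrib[symmetric] sig_prod_integrable
          intro!: arg_cong2[of _ _ _ _ "(/)"] Bochner_Integration.integral_add)
  then show ?thesis using assms(4,5) unfolding mean_def by (auto intro: tendsto_add)
qed

lemma mean_cmult_left:
  assumes "mean u v c"
  shows "mean (\<lambda>t. a * u t) v (a * c)"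
proof -
  have "avg (\<lambda>t. a * u t) v = (\<lambda>T. a * avg u v T)"
    unfolding avg_def by (simp flip: integral_mult_right_zero add: mult.assoc)
  then show ?thesis using assms unfolding mean_def by (auto intro: tendsto_mult_left)
qed

lemma mean_swap:
  assumes "mean u v c" shows "mean v u (cnj c)"
proof -
  have [simp]: "cnj (LINT t|lborel. indicator {0..T} t *\<^sub>R (u t * cnj (v t))) =
    (LINT t|lborel. indicator {0..T} t *\<^sub>R (v t * cnj (u t)))" for T
    by (subst Bochner_Integration.integral_cnj[symmetric]) (simp add: mult.commute)
  have "avg v u = (\<lambda>T. cnj (avg u v T))"
    unfolding avg_def by simp
  then show ?thesis using assms unfolding mean_def by (simp add: lim_cnj)
qed

lemma mean_add_right:
  assumes "sig u" "sig v" "sig v'" "mean u v c" "mean u v' c'"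
  shows "mean u (\<lambda>t. v t + v' t) (c + c')"
  using mean_swap[OF mean_add_left[OF assms(2,3,1) mean_swap mean_swap]] assms(4,5) by simp

lemma mean_cmult_right: "mean u v c \<Longrightarrow> mean u (\<lambda>t. a * v t) (cnj a * c)"
  using mean_swap[OF mean_cmult_left[OF mean_swap]] by fastforce

lemma mean_nonneg:
  assumes "mean u u c" shows "Im c = 0" "Re c \<ge> 0"
proof -
  have "avg u u T = of_real ((LINT t|lborel. indicator {0..T} t * (norm (u t))\<^sup>2) / T)" for T
  proof -
    have "avg u u T = (LINT t|lborel. of_real (indicator {0..T} t * (norm (u t))\<^sup>2)) / of_real T"
      unfolding avg_def by (simp add: complex_norm_square scaleR_conv_of_real del: of_real_power)
    then show ?thesis by (simp del: of_real_mult of_real_power)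
  qed
  then have *: "((\<lambda>T. complex_of_real ((LINT t|lborel. indicator {0..T} t * (norm (u t))\<^sup>2) / T)) \<longlongrightarrow> c) at_top"
    using assms by (simp only: mean_def flip: \<open>\<And>T. avg u u T = _\<close>)
  have "((\<lambda>T::real. 0::real) \<longlongrightarrow> Im c) at_top" using tendsto_Im[OF *] by simp
  then show "Im c = 0" by (simp add: tendsto_const_iff)
  show "Re c \<ge> 0"
  proof (rule tendsto_lowerbound[OF tendsto_Re[OF *]])
    show "\<forall>\<^sub>F T in at_top. 0 \<le> Re (complex_of_real ((LINT t|lborel. indicator {0..T} t * (norm (u t))\<^sup>2) / T))"
      using eventually_gt_at_top[of 0] by eventually_elim (auto intro!: divide_nonneg_pos integral_nonneg)
  qed simp
qed

text \<open>The integrals over all windows \<open>{0..T}\<close> share the bound \<open>K\<close>,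
  so division by \<open>T\<close> removes them.\<close>

lemma mean_transient:
  assumes "sig d" "integrable lborel d" "sig v"
  shows "mean d v 0"
proof -
  obtain B where B: "B > 0" "\<And>t. norm (v t) \<le> B" using sig_bound assms(3) by metis
  note [measurable] = sigD[OF assms(1)] sigD[OF assms(3)]
  define K where "K = (LINT t|lborel. norm (d t) * B)"
  have "norm (LINT t|lborel. indicator {0..T} t *\<^sub>R (d t * cnj (v t))) \<le> K" for T
    unfolding K_def
  proof (rule norm_integral_le)
    fix t show "norm (indicator {0..T} t *\<^sub>R (d t * cnj (v t))) \<le> norm (d t) * B"
      using B by (auto simp: indicator_def norm_mult intro!: mult_left_mono)
  qed (use assms sig_prod_integrable in auto)
  then have "\<forall>\<^sub>F T in at_top. norm (avg d v T) \<le> K / T"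
    by (intro eventually_at_top_linorderI[of 1]) (auto simp: avg_def norm_divide intro!: divide_right_mono)
  moreover have "((\<lambda>T. K / T) \<longlongrightarrow> 0) at_top"
    by (intro tendsto_divide_0[OF tendsto_const] filterlim_at_top_imp_at_infinity filterlim_ident)
  ultimately show ?thesis unfolding mean_def by (rule Lim_null_comparison)
qed

text \<open>A common shift moves the window of integration. The old and the new window differ by two
  segments of length \<open>\<bar>\<sigma>\<bar>\<close> at the ends, whose contribution is bounded
  and disappears after division by \<open>T\<close>.\<close>

lemma mean_shift:
  assumes "sig u" "sig v" "mean u v c"
  shows "mean (\<lambda>t. u (t + \<sigma>)) (\<lambda>t. v (t + \<sigma>)) c"
proof -
  obtain B C where B: "B > 0" "\<And>t. norm (u t) \<le> B" and C: "C > 0" "\<And>t. norm (v t) \<le> C"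
    using sig_bound assms(1,2) by metis
  define P where "P a b = (LINT t|lborel. indicator {a..b} t *\<^sub>R (u t * cnj (v t)))" for a b
  have Pb: "norm (P a b) \<le> \<bar>b - a\<bar> * (B * C)" for a b
    using norm_segment_le[OF assms(1,2) B(2) C(2), of a b] B C
    by (cases "a \<le> b") (auto simp: P_def)
  note [measurable] = sigD[OF assms(1)] sigD[OF assms(2)]
  have P_add: "P a b + P b c = P a c" if "a \<le> b" "b \<le> c" for a b c
  proof -
    have "P a b + P b c = (LINT t|lborel. indicator {a..b} t *\<^sub>R (u t * cnj (v t)) + indicator {b..c} t *\<^sub>R (u t * cnj (v t)))"
      unfolding P_def using sig_prod_integrable[OF assms(1,2)] by (simp add: Bochner_Integration.integral_add)
    also have "\<dots> = P a c"
      unfolding P_def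
    proof (rule Bochner_Integration.integral_cong_AE)
      show "AE t in lborel. indicator {a..b} t *\<^sub>R (u t * cnj (v t)) + indicator {b..c} t *\<^sub>R (u t * cnj (v t)) =
        indicator {a..c} t *\<^sub>R (u t * cnj (v t))"
        using AE_lborel_singleton[of b] that by (auto simp: indicator_def)
    qed measurable
    finally show ?thesis .
  qed
  have shift: "(LINT t|lborel. indicator {0..T} t *\<^sub>R (u (t + \<sigma>) * cnj (v (t + \<sigma>)))) = P \<sigma> (T + \<sigma>)" for T
    unfolding P_def
    by (subst lborel_integral_real_affine[where c=1 and t="\<sigma>"])
       (auto simp: indicator_def add.commute intro!: Bochner_Integration.integral_cong)
  \<comment> \<open>\<open>T > \<bar>\<sigma>\<bar>\<close> makes the two windows overlap, so that
    the common segment cancels; the sign of \<open>\<sigma>\<close> decides which end is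
    gained.\<close>
  have diff: "norm (P \<sigma> (T + \<sigma>) - P 0 T) \<le> 2 * \<bar>\<sigma>\<bar> * (B * C)" if T: "T > \<bar>\<sigma>\<bar>" for T
  proof -
    have "norm (P \<sigma> (T + \<sigma>) - P 0 T) \<le> norm (P (min 0 \<sigma>) (max 0 \<sigma>)) + norm (P (min T (T+\<sigma>)) (max T (T+\<sigma>)))"
    proof (cases "\<sigma> \<ge> 0")
      case True
      then have e: "P 0 \<sigma> + P \<sigma> T = P 0 T" "P \<sigma> T + P T (T + \<sigma>) = P \<sigma> (T + \<sigma>)"
        using T by (auto intro!: P_add)
      have eq: "P \<sigma> (T + \<sigma>) - P 0 T = P T (T + \<sigma>) - P 0 \<sigma>" unfolding e[symmetric] by simp
      show ?thesis unfolding eq using True norm_triangle_ineq4[of "P T (T + \<sigma>)" "P 0 \<sigma>"]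
        by (simp add: max_def min_def add.commute)
    next
      case False
      then have e: "P \<sigma> 0 + P 0 (T + \<sigma>) = P \<sigma> (T + \<sigma>)" "P 0 (T + \<sigma>) + P (T + \<sigma>) T = P 0 T"
        using T by (auto intro!: P_add)
      have eq: "P \<sigma> (T + \<sigma>) - P 0 T = P \<sigma> 0 - P (T + \<sigma>) T" unfolding e[symmetric] by simp
      show ?thesis unfolding eq using False norm_triangle_ineq4[of "P \<sigma> 0" "P (T + \<sigma>) T"]
        by (simp add: max_def min_def)
    qed
    also have "\<dots> \<le> \<bar>\<sigma>\<bar> * (B * C) + \<bar>\<sigma>\<bar> * (B * C)"
      using Pb[of "min 0 \<sigma>" "max 0 \<sigma>"] Pb[of "min T (T+\<sigma>)" "max T (T+\<sigma>)"]
      by (intro add_mono) (auto simp: max_def min_def split: if_splits)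
    finally show ?thesis by (simp add: mult_ac)
  qed
  have "((\<lambda>T. avg (\<lambda>t. u (t + \<sigma>)) (\<lambda>t. v (t + \<sigma>)) T - avg u v T) \<longlongrightarrow> 0) at_top"
  proof (rule Lim_null_comparison)
    show "\<forall>\<^sub>F T in at_top. norm (avg (\<lambda>t. u (t + \<sigma>)) (\<lambda>t. v (t + \<sigma>)) T - avg u v T) \<le> (2 * \<bar>\<sigma>\<bar> * (B * C)) / T"
      using eventually_gt_at_top[of "\<bar>\<sigma>\<bar>"]
    proof eventually_elim
      case (elim T)
      have "avg (\<lambda>t. u (t + \<sigma>)) (\<lambda>t. v (t + \<sigma>)) T - avg u v T = (P \<sigma> (T + \<sigma>) - P 0 T) / of_real T"
        unfolding avg_def shift by (simp add: P_def diff_divide_distrib)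
      then show ?case using diff[OF elim] elim by (auto simp: norm_divide intro!: divide_right_mono)
    qed
    show "((\<lambda>T. 2 * \<bar>\<sigma>\<bar> * (B * C) / T) \<longlongrightarrow> 0) at_top"
      by (intro tendsto_divide_0[OF tendsto_const] filterlim_at_top_imp_at_infinity filterlim_ident)
  qed
  from tendsto_add[OF this assms(3)[unfolded mean_def]] show ?thesis
    unfolding mean_def by simp
qed

text \<open>Cauchy-Schwarz, split by \<open>2 a b \<le> a\<^sup>2 / \<delta> + \<delta> b\<^sup>2\<close> so that the bound is linear in the power of \<open>p\<close>
  and can be averaged.\<close>

lemma mean_le:
  assumes "sig p" "sig v" "mean p p a" "mean p v b" "mean v v c" "\<delta> > 0"
  shows "norm b \<le> Re a / (2 * \<delta>) + \<delta> * Re c / 2"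
proof (cases "b = 0")
  case True
  then show ?thesis using assms mean_nonneg by simp
next
  case False
  \<comment> \<open>\<open>s\<close> has modulus \<open>\<delta>\<close> and the phase that makes
    each of the two cross terms in the power of \<open>p + s v\<close> equal to
    \<open>- \<delta> * norm b\<close>.\<close>
  define s where "s = - of_real \<delta> * b / of_real (norm b)"
  have "mean (\<lambda>t. p t + s * v t) (\<lambda>t. p t + s * v t)
    ((a + s * cnj b) + (cnj s * b + cnj s * (s * c)))"
    using assms
    by (intro mean_add_left mean_add_right mean_cmult_left mean_cmult_right sig_add sig_cmult)
       (auto intro: mean_swap mean_cmult_left mean_cmult_right)
  from mean_nonneg(2)[OF this]
  have "0 \<le> Re (a + s * cnj b + (cnj s * b + cnj s * (s * c)))" .
  also have "a + s * cnj b + (cnj s * b + cnj s * (s * c)) = a + 2 * Re (s * cnj b) + of_real ((norm s)\<^sup>2) * c"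
    by (simp add: complex_eq_iff cmod_power2[unfolded power2_eq_square] cmod_def power2_eq_square algebra_simps)
  also have "s * cnj b = - of_real (\<delta> * norm b)"
    using False complex_norm_square[of b] by (simp add: s_def mult.assoc power2_eq_square flip: complex_norm_square)
  also have "norm s = \<delta>" using False assms(6) by (simp add: s_def norm_mult norm_divide)
  finally have "2 * \<delta> * norm b \<le> Re a + \<delta>\<^sup>2 * Re c" by simp
  then show ?thesis using assms(6) by (simp add: field_simps power2_eq_square)
qed

section \<open>Cross spectra of scalar signals\<close>

definition conv :: "(real \<Rightarrow> complex) \<Rightarrow> (real \<Rightarrow> complex) \<Rightarrow> real \<Rightarrow> complex"
  where "conv g u t = (LINT a|lborel. g a * u (t - a))"

definition ft :: "(real \<Rightarrow> complex) \<Rightarrow> real \<Rightarrow> complex"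
  where "ft f \<omega> = (LINT t|lborel. f t * cis (- (\<omega> * t)))"

definition ift :: "(real \<Rightarrow> complex) \<Rightarrow> real \<Rightarrow> complex"
  where "ift S \<tau> = (LINT \<omega>|lborel. S \<omega> * cis (\<omega> * \<tau>)) / (2 * of_real pi)"

text \<open>The inverse transform of the density has to be the correlation at every point: a null set
  matters because the power is the value at \<open>0\<close>.\<close>

definition cspec :: "(real \<Rightarrow> complex) \<Rightarrow> (real \<Rightarrow> complex) \<Rightarrow> (real \<Rightarrow> complex) \<Rightarrow> bool"
  where "cspec u v S \<longleftrightarrow> sig u \<and> sig v \<and> integrable lborel S \<and> integrable lborel (ift S) \<and>
    ft (ift S) = S \<and> corr u v (ift S)"

section \<open>Absolute integrability and exchange of integrals\<close>

lemma borel_measurable_cis [measurable (raw)]: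
  "f \<in> borel_measurable M \<Longrightarrow> (\<lambda>x. cis (f x)) \<in> borel_measurable M"
  by (rule measurable_compose[OF _ borel_measurable_continuous_onI]) (auto intro!: continuous_intros)

lemma integrable_mult_bounded:
  fixes f k :: "'a \<Rightarrow> complex"
  assumes "integrable M f" "k \<in> borel_measurable M" "\<And>x. norm (k x) \<le> K"
  shows "integrable M (\<lambda>x. f x * k x)"
proof -
  note [measurable] = assms(2) borel_measurable_integrable[OF assms(1)]
  have m: "integrable M (\<lambda>x. K * norm (f x))" using assms(1) by simp
  show ?thesis
  proof (rule Bochner_Integration.integrable_bound[OF m])
    have "K \<ge> 0" using assms(3) norm_ge_zero order_trans by blast
    then show "AE x in M. norm (f x * k x) \<le> norm (K * norm (f x))"
      using assms(3) by (auto simp: norm_mult mult.commute[of K] intro!: mult_left_mono)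
  qed measurable
qed

lemma integrable_cis [simp]:
  assumes "integrable lborel f" shows "integrable lborel (\<lambda>x. f x * cis (c * x))"
    "integrable lborel (\<lambda>x. f x * cis (x * c))" "integrable lborel (\<lambda>x. f x * cis (- (c * x)))"
    "integrable lborel (\<lambda>x. f x * cis (- (x * c)))"
  by (intro integrable_mult_bounded[OF assms, where K=1]; simp)+

lemma integrable_pair_bounded:
  fixes g f :: "real \<Rightarrow> complex"
  assumes g: "integrable lborel g" and f: "integrable lborel f"
    and [measurable]: "(\<lambda>(a, b). k a b) \<in> borel_measurable (lborel \<Otimes>\<^sub>M lborel)"
    and K: "\<And>a b. norm (k a b) \<le> K"
  shows "integrable (lborel \<Otimes>\<^sub>M lborel) (\<lambda>(a, b). g a * (f b * k a b))"
proof -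
  note [measurable] = borel_measurable_integrable[OF g] borel_measurable_integrable[OF f]
  have [measurable]: "k a \<in> borel_measurable lborel" for a
    using measurable_Pair2[OF assms(3), of a] by simp
  have *: "integrable (lborel \<Otimes>\<^sub>M lborel) (\<lambda>(a, b). g a * f b)"
  proof (rule lborel_pair.Fubini_integrable)
    show "integrable lborel (\<lambda>a. LBINT b. norm (case (a, b) of (a, b) \<Rightarrow> g a * f b))"
      using g by (simp add: norm_mult)
  qed (use f in simp_all)
  have "integrable (lborel \<Otimes>\<^sub>M lborel) (\<lambda>x. (case x of (a, b) \<Rightarrow> g a * f b) * (case x of (a, b) \<Rightarrow> k a b))"
    by (rule integrable_mult_bounded[OF *, where K=K]) (use K in auto)
  then show ?thesis by (simp add: case_prod_unfold mult.assoc)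
qed

text \<open>Integrable factors in each variable times a bounded kernel: windowed averages, Fourier
  kernels and Gaussian correlations all have this shape, so one exchange serves them.\<close>

lemma integral_pair_swap:
  fixes g f :: "real \<Rightarrow> complex"
  assumes g: "integrable lborel g" and f: "integrable lborel f"
    and k: "(\<lambda>(a, b). k a b) \<in> borel_measurable (lborel \<Otimes>\<^sub>M lborel)"
    and K: "\<And>a b. norm (k a b) \<le> K"
  shows "(LINT a|lborel. g a * (LINT b|lborel. f b * k a b)) =
    (LINT b|lborel. f b * (LINT a|lborel. g a * k a b))"
proof -
  have "(LINT a|lborel. g a * (LINT b|lborel. f b * k a b)) =
    (LINT a|lborel. (LINT b|lborel. g a * (f b * k a b)))"
    by simp
  also have "\<dots> = (LINT b|lborel. (LINT a|lborel. g a * (f b * k a b)))"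
    by (rule lborel_pair.Fubini_integral[symmetric]) (use integrable_pair_bounded[OF assms] in simp)
  also have "\<dots> = (LINT b|lborel. f b * (LINT a|lborel. g a * k a b))"
    by (subst Bochner_Integration.integral_mult_right_zero[symmetric]) (simp add: mult.left_commute)
  finally show ?thesis .
qed

lemma conv_commute: "conv g u t = (LINT a|lborel. u a * g (t - a))"
  unfolding conv_def
  by (subst lborel_integral_real_affine[where c="-1" and t=t]) (auto simp: mult.commute)

lemma sig_conv:
  assumes "sig u" "integrable lborel g"
  shows "sig (conv g u)"
proof -
  note [measurable] = sigD[OF assms(1)] borel_measurable_integrable[OF assms(2)]
  obtain B where B: "B > 0" "\<And>t. norm (u t) \<le> B" using sig_bound assms(1) by metis
  have "norm (conv g u t) \<le> (LINT a|lborel. norm (g a) * B)" for t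
    unfolding conv_def
  proof (rule norm_integral_le)
    show "integrable lborel (\<lambda>a. g a * u (t - a))"
      by (rule integrable_mult_bounded[OF assms(2), where K=B]) (use B in auto)
  qed (use assms B in \<open>auto simp: norm_mult intro!: mult_left_mono\<close>)
  moreover have "conv g u \<in> borel_measurable borel"
    unfolding conv_def[abs_def] by measurable
  ultimately show ?thesis unfolding sig_def by blast
qed

text \<open>Fubini turns the average of the filtered signal into the integral of \<open>g\<close>
  against the averages \<open>A T a\<close> of shifted signals. These are bounded by
  \<open>B * C\<close> for all \<open>T > 0\<close>, which provides the domination.\<close>

lemma mean_conv:
  assumes u: "sig u" and v: "sig v" and g: "integrable lborel g"
    and R: "\<And>a. mean (\<lambda>t. u (t - a)) v (R a)"
  shows "mean (conv g u) v (LINT a|lborel. g a * R a)"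
proof -
  note [measurable] = sigD[OF u] sigD[OF v] borel_measurable_integrable[OF g]
  obtain B C where B: "B > 0" "\<And>t. norm (u t) \<le> B" and C: "C > 0" "\<And>t. norm (v t) \<le> C"
    using sig_bound u v by metis
  define A where "A T a = avg (\<lambda>t. u (t - a)) v T" for T a
  have sh: "sig (\<lambda>t. u (t - a))" for a using sig_shift[OF u, of "-a"] by simp
  have int: "integrable lborel (\<lambda>t. indicator {0..T} t *\<^sub>R cnj (v t))" for T
    using sig_prod_integrable[of "\<lambda>_. 1" v 0 T] v by (auto simp: sig_def)
  have eq: "avg (conv g u) v T = (LINT a|lborel. g a * A T a)" for T
  proof -
    have "avg (conv g u) v T = (LINT t|lborel. (indicator {0..T} t *\<^sub>R cnj (v t)) * (LINT a|lborel. g a * u (t - a))) / of_real T"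
      unfolding avg_def conv_def
      by (intro arg_cong2[of _ _ _ _ "(/)"] Bochner_Integration.integral_cong) (auto simp: mult.commute)
    also have "\<dots> = (LINT a|lborel. g a * (LINT t|lborel. (indicator {0..T} t *\<^sub>R cnj (v t)) * u (t - a))) / of_real T"
      by (subst integral_pair_swap[where K=B, OF g int]) (use B in auto)
    also have "\<dots> = (LINT a|lborel. g a * A T a)"
      by (subst Bochner_Integration.integral_divide_zero[symmetric]) (simp add: A_def avg_def mult.commute)
    finally show ?thesis .
  qed
  have [measurable]: "A T \<in> borel_measurable borel" for T
    unfolding A_def avg_def by measurable
  have lim: "((\<lambda>T. A T a) \<longlongrightarrow> R a) at_top" for a
    using R[of a] unfolding mean_def A_def by simp
  \<comment> \<open>\<open>R\<close> is a pointwise limit along integer times, which settles its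
    measurability.\<close>
  have [measurable]: "R \<in> borel_measurable borel"
    by (rule borel_measurable_LIMSEQ_metric[where f="\<lambda>n. A (real n)"])
       (auto intro: filterlim_compose[OF lim filterlim_real_sequentially])
  show ?thesis
    unfolding mean_def eq
  proof (rule integral_dominated_convergence_at_top)
    show "integrable lborel (\<lambda>a. norm (g a) * (B * C))" using g by simp
    show "\<forall>\<^sub>F T in at_top. AE a in lborel. norm (g a * A T a) \<le> norm (g a) * (B * C)"
      using eventually_gt_at_top[of 0]
    proof eventually_elim
      case (elim T)
      have "norm (A T a) \<le> B * C" for a
        unfolding A_def using norm_avg_le[OF sh v] B C elim by blast
      then show ?case by (auto simp: norm_mult intro!: mult_left_mono)
    qed
    show "AE a in lborel. ((\<lambda>T. g a * A T a) \<longlongrightarrow> g a * R a) at_top"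
      by (auto intro!: tendsto_mult_left lim)
  qed measurable
qed

lemma corr_conv:
  assumes "sig u" "sig v" "integrable lborel g" "corr u v R"
  shows "corr (conv g u) v (conv g R)"
  unfolding corr_def
proof
  fix \<tau>
  have "mean (conv g (\<lambda>t. u (t + \<tau>))) v (LINT a|lborel. g a * R (\<tau> - a))"
  proof (rule mean_conv)
    show "mean (\<lambda>t. u (t - a + \<tau>)) v (R (\<tau> - a))" for a
      using assms(4)[unfolded corr_def, rule_format, of "\<tau> - a"] by (simp add: algebra_simps)
  qed (use assms sig_shift in auto)
  then show "mean (\<lambda>t. conv g u (t + \<tau>)) v (conv g R \<tau>)"
    by (simp add: conv_def[abs_def] algebra_simps)
qed

text \<open>The lag sits on the first signal, so an exchange of the arguments leaves it on the wrong
  one. Invariance under a common shift moves it back and reverses its sign.\<close>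

lemma corr_swap:
  assumes "sig u" "sig v" "corr u v R"
  shows "corr v u (\<lambda>\<tau>. cnj (R (- \<tau>)))"
  unfolding corr_def
proof
  fix \<tau>
  have "mean (\<lambda>t. u (t - \<tau>)) v (R (- \<tau>))" using assms(3) by (auto simp: corr_def dest: spec[of _ "- \<tau>"])
  from mean_shift[OF _ _ mean_swap[OF this], of \<tau>] assms sig_shift[of u "- \<tau>"]
  show "mean (\<lambda>t. v (t + \<tau>)) u (cnj (R (- \<tau>)))" by simp
qed

lemma corr_add_left:
  assumes "sig u" "sig u'" "sig v" "corr u v R" "corr u' v R'"
  shows "corr (\<lambda>t. u t + u' t) v (\<lambda>\<tau>. R \<tau> + R' \<tau>)"
  using assms unfolding corr_def by (auto intro!: mean_add_left sig_shift)

lemma corr_cmult_left: "corr u v R \<Longrightarrow> corr (\<lambda>t. a * u t) v (\<lambda>\<tau>. a * R \<tau>)"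
  unfolding corr_def by (auto intro!: mean_cmult_left)

lemma corr_transient:
  assumes "sig d" "integrable lborel d" "sig v"
  shows "corr d v (\<lambda>_. 0)"
  unfolding corr_def
proof
  fix \<tau>
  have "integrable lborel (\<lambda>t. d (t + \<tau>))"
    using lborel_integrable_real_affine[OF assms(2), of 1 \<tau>] by (simp add: add.commute)
  then show "mean (\<lambda>t. d (t + \<tau>)) v 0" using assms by (auto intro!: mean_transient sig_shift)
qed

section \<open>Convolution theorem for the transform and its inverse\<close>

lemma ft_measurable_bounded:
  assumes "integrable lborel g"
  shows "ft g \<in> borel_measurable borel" "norm (ft g \<omega>) \<le> (LINT t|lborel. norm (g t))"
proof -
  note [measurable] = borel_measurable_integrable[OF assms]
  show "ft g \<in> borel_measurable borel" unfolding ft_def[abs_def] by measurable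
  show "norm (ft g \<omega>) \<le> (LINT t|lborel. norm (g t))"
    unfolding ft_def by (rule norm_integral_le) (use assms in \<open>auto simp: norm_mult\<close>)
qed

text \<open>\<open>R (\<tau> - a)\<close> is not a product of functions of one variable.
  Integrability on the plane comes from translation invariance instead: the inner integral of the
  norm of \<open>R\<close> is the same for every \<open>a\<close>.\<close>

lemma conv_integrable_ft:
  assumes g: "integrable lborel g" and R: "integrable lborel R"
  shows "integrable lborel (conv g R)" "ft (conv g R) = (\<lambda>\<omega>. ft g \<omega> * ft R \<omega>)"
proof -
  note [measurable] = borel_measurable_integrable[OF g] borel_measurable_integrable[OF R]
  have sub: "(LINT \<tau>|lborel. f (\<tau> - a)) = (LINT \<tau>|lborel. f \<tau>)" for f :: "real \<Rightarrow> 'x::{banach,second_countable_topology}" and a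
    by (subst lborel_integral_real_affine[where c="1" and t="a"]) auto
  have Ra: "integrable lborel (\<lambda>\<tau>. R (\<tau> - a))" for a
    using lborel_integrable_real_affine[OF R, of 1 "-a"] by simp
  have I: "integrable (lborel \<Otimes>\<^sub>M lborel) (\<lambda>(a, \<tau>). g a * R (\<tau> - a))"
  proof (rule lborel_pair.Fubini_integrable)
    show "integrable lborel (\<lambda>a. LBINT \<tau>. norm (case (a, \<tau>) of (a, \<tau>) \<Rightarrow> g a * R (\<tau> - a)))"
      using g sub[of "\<lambda>\<tau>. norm (R \<tau>)"] by (simp add: norm_mult)
  qed (use Ra in simp_all)
  show "integrable lborel (conv g R)"
    using lborel_pair.integrable_snd[OF I] by (simp add: conv_def[abs_def])
  show "ft (conv g R) = (\<lambda>\<omega>. ft g \<omega> * ft R \<omega>)"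
  proof
    fix \<omega>
    have I': "integrable (lborel \<Otimes>\<^sub>M lborel) (\<lambda>(a, \<tau>). g a * R (\<tau> - a) * cis (- (\<omega> * \<tau>)))"
      using integrable_mult_bounded[OF I, of "\<lambda>(a, \<tau>). cis (- (\<omega> * \<tau>))" 1] by (simp add: case_prod_unfold)
    have "ft (conv g R) \<omega> = (LINT \<tau>|lborel. LINT a|lborel. g a * R (\<tau> - a) * cis (- (\<omega> * \<tau>)))"
      by (simp add: ft_def conv_def)
    also have "\<dots> = (LINT a|lborel. LINT \<tau>|lborel. g a * R (\<tau> - a) * cis (- (\<omega> * \<tau>)))"
      by (rule lborel_pair.Fubini_integral) (rule I')
    also have "\<dots> = (LINT a|lborel. g a * cis (- (\<omega> * a)) * ft R \<omega>)"
    proof (intro Bochner_Integration.integral_cong refl)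
      fix a
      have "(LINT \<tau>|lborel. g a * R (\<tau> - a) * cis (- (\<omega> * \<tau>))) =
        (LINT \<tau>|lborel. (\<lambda>\<tau>. g a * cis (- (\<omega> * a)) * (R \<tau> * cis (- (\<omega> * \<tau>)))) (\<tau> - a))"
        by (intro Bochner_Integration.integral_cong refl) (simp add: cis_mult right_diff_distrib)
      also have "\<dots> = g a * cis (- (\<omega> * a)) * ft R \<omega>"
        using sub[of "\<lambda>\<tau>. R \<tau> * cis (- (\<omega> * \<tau>))" a] by (simp add: ft_def)
      finally show "(LINT \<tau>|lborel. g a * R (\<tau> - a) * cis (- (\<omega> * \<tau>))) = g a * cis (- (\<omega> * a)) * ft R \<omega>" .
    qed
    also have "\<dots> = ft g \<omega> * ft R \<omega>" by (simp add: ft_def)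
    finally show "ft (conv g R) \<omega> = ft g \<omega> * ft R \<omega>" .
  qed
qed

text \<open>Only \<open>ft g\<close> is expanded and its integral moved outside; nothing is
  inverted. This lets a filter act on a spectrum whose inverse transform is already known.\<close>

lemma ift_ft_mult:
  assumes g: "integrable lborel g" and S: "integrable lborel S"
  shows "ift (\<lambda>\<omega>. ft g \<omega> * S \<omega>) = conv g (ift S)"
proof
  fix \<tau>
  have "ift (\<lambda>\<omega>. ft g \<omega> * S \<omega>) \<tau> =
    (LINT \<omega>|lborel. S \<omega> * (LINT a|lborel. g a * cis (\<omega> * (\<tau> - a)))) / (2 * of_real pi)"
    unfolding ift_def ft_def
    by (intro arg_cong2[of _ _ _ _ "(/)"] refl Bochner_Integration.integral_cong)
       (auto simp flip: Bochner_Integration.integral_mult_right_zero Bochner_Integration.integral_mult_left_zero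
          intro!: Bochner_Integration.integral_cong simp: cis_mult algebra_simps right_diff_distrib')
  also have "\<dots> = (LINT a|lborel. g a * (LINT \<omega>|lborel. S \<omega> * cis (\<omega> * (\<tau> - a)))) / (2 * of_real pi)"
    by (subst integral_pair_swap[OF g S, where K=1]) auto
  also have "\<dots> = conv g (ift S) \<tau>"
    by (simp add: conv_def ift_def)
  finally show "ift (\<lambda>\<omega>. ft g \<omega> * S \<omega>) \<tau> = conv g (ift S) \<tau>" .
qed

lemma ift_zero [simp]: "ift (\<lambda>_. 0) = (\<lambda>_. 0)"
  by (simp add: ift_def[abs_def])

lemma ft_zero [simp]: "ft (\<lambda>_. 0) = (\<lambda>_. 0)"
  by (simp add: ft_def[abs_def])

lemma ift_add: "integrable lborel S \<Longrightarrow> integrable lborel S' \<Longrightarrow> ift (\<lambda>\<omega>. S \<omega> + S' \<omega>) = (\<lambda>\<tau>. ift S \<tau> + ift S' \<tau>)"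
  by (simp add: ift_def[abs_def] distrib_right Bochner_Integration.integral_add add_divide_distrib)

lemma ft_add: "integrable lborel S \<Longrightarrow> integrable lborel S' \<Longrightarrow> ft (\<lambda>\<omega>. S \<omega> + S' \<omega>) = (\<lambda>\<tau>. ft S \<tau> + ft S' \<tau>)"
  by (simp add: ft_def[abs_def] distrib_right Bochner_Integration.integral_add)

lemma ift_cmult: "ift (\<lambda>\<omega>. a * S \<omega>) = (\<lambda>\<tau>. a * ift S \<tau>)"
  by (simp add: ift_def[abs_def] mult.assoc)

lemma ft_cmult: "ft (\<lambda>\<omega>. a * S \<omega>) = (\<lambda>\<tau>. a * ft S \<tau>)"
  by (simp add: ft_def[abs_def] mult.assoc)

lemma ft_reflect_cnj: "ft (\<lambda>\<tau>. cnj (R (- \<tau>))) = (\<lambda>\<omega>. cnj (ft R \<omega>))"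
proof
  fix \<omega>
  have "ft (\<lambda>\<tau>. cnj (R (- \<tau>))) \<omega> = (LINT t|lborel. cnj (R t * cis (- (\<omega> * t))))"
    unfolding ft_def by (subst lborel_integral_real_affine[where c="-1" and t=0]) (auto simp: cis_cnj)
  then show "ft (\<lambda>\<tau>. cnj (R (- \<tau>))) \<omega> = cnj (ft R \<omega>)"
    unfolding ft_def by (simp only: Bochner_Integration.integral_cnj)
qed

lemma ift_cnj: "ift (\<lambda>\<omega>. cnj (S \<omega>)) = (\<lambda>\<tau>. cnj (ift S (- \<tau>)))"
proof
  fix \<tau>
  have "ift (\<lambda>\<omega>. cnj (S \<omega>)) \<tau> = (LINT \<omega>|lborel. cnj (S \<omega> * cis (\<omega> * (- \<tau>)))) / (2 * of_real pi)"
    unfolding ift_def by (simp add: cis_cnj)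
  then show "ift (\<lambda>\<omega>. cnj (S \<omega>)) \<tau> = cnj (ift S (- \<tau>))"
    unfolding ift_def by (simp only: Bochner_Integration.integral_cnj) simp
qed

section \<open>Closure properties of cross spectra\<close>

lemma cspec_add_left:
  assumes "cspec u v S" "cspec u' v S'"
  shows "cspec (\<lambda>t. u t + u' t) v (\<lambda>\<omega>. S \<omega> + S' \<omega>)"
  using assms unfolding cspec_def by (auto simp: ift_add ft_add intro!: sig_add corr_add_left)

lemma cspec_cmult_left:
  assumes "cspec u v S" shows "cspec (\<lambda>t. a * u t) v (\<lambda>\<omega>. a * S \<omega>)"
  using assms unfolding cspec_def by (auto simp: ift_cmult ft_cmult intro!: sig_cmult corr_cmult_left)

text \<open>\<open>ift\<close> turns the factor \<open>ft g\<close> into a convolution and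
  \<open>ft\<close> turns the convolution back into the factor, so the inversion identity for
  \<open>S\<close> carries over.\<close>

lemma cspec_conv_left:
  assumes "cspec u v S" "integrable lborel g"
  shows "cspec (conv g u) v (\<lambda>\<omega>. ft g \<omega> * S \<omega>)"
proof -
  note ft_measurable_bounded[OF assms(2)]
  then have "integrable lborel (\<lambda>\<omega>. ft g \<omega> * S \<omega>)"
    using integrable_mult_bounded[of lborel S "ft g" "LINT t|lborel. norm (g t)"] assms
    by (simp add: cspec_def mult.commute)
  then show ?thesis
    using assms conv_integrable_ft[OF assms(2), of "ift S"] unfolding cspec_def
    by (auto simp: ift_ft_mult sig_conv intro!: corr_conv)
qed

lemma cspec_transient:
  assumes "sig d" "integrable lborel d" "sig v"
  shows "cspec d v (\<lambda>_. 0)"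
  using assms corr_transient by (auto simp: cspec_def)

lemma cspec_zero_left: "sig v \<Longrightarrow> cspec (\<lambda>_. 0) v (\<lambda>_. 0)"
  by (intro cspec_transient) auto

lemma cspec_sum_left:
  assumes "\<And>k. k \<in> F \<Longrightarrow> cspec (u k) v (S k)" "sig v"
  shows "cspec (\<lambda>t. \<Sum>k\<in>F. u k t) v (\<lambda>\<omega>. \<Sum>k\<in>F. S k \<omega>)"
  using assms by (induction F rule: infinite_finite_induct) (auto intro: cspec_add_left cspec_zero_left)

lemma cspec_swap:
  assumes "cspec u v S" shows "cspec v u (\<lambda>\<omega>. cnj (S \<omega>))"
proof -
  have "integrable lborel (\<lambda>\<tau>. ift S (- \<tau>))"
    using assms lborel_integrable_real_affine[of "ift S" "-1" 0] by (simp add: cspec_def)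
  then show ?thesis
    using assms unfolding cspec_def by (auto simp: ift_cnj ft_reflect_cnj intro!: corr_swap)
qed

section \<open>Fourier inversion for correlation functions\<close>

lemma integrable_gauss:
  assumes "s > 0"
  shows "integrable lborel (\<lambda>x. complex_of_real (exp (- x\<^sup>2 / (2 * s\<^sup>2))))"
    "(LINT x|lborel. exp (- x\<^sup>2 / (2 * s\<^sup>2))) = sqrt (2 * pi * s\<^sup>2)"
proof -
  have *: "exp (- x\<^sup>2 / (2 * s\<^sup>2)) = sqrt (2 * pi * s\<^sup>2) * normal_density 0 s x" for x
    using assms by (simp add: normal_density_def)
  show "integrable lborel (\<lambda>x. complex_of_real (exp (- x\<^sup>2 / (2 * s\<^sup>2))))"
    unfolding * using integrable_normal_density[OF assms, of 0] by (intro integrable_of_real) simp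
  show "(LINT x|lborel. exp (- x\<^sup>2 / (2 * s\<^sup>2))) = sqrt (2 * pi * s\<^sup>2)"
    unfolding * using integral_normal_density[OF assms, of 0] by simp
qed

lemma integrable_normal_density_complex:
  "s > 0 \<Longrightarrow> integrable lborel (\<lambda>x. complex_of_real (normal_density 0 s x))"
  using integrable_normal_density[of s 0] by (intro integrable_of_real) simp

text \<open>The characteristic function of the standard normal distribution after the substitution
  \<open>x = e * \<omega>\<close>; the constants combine into a probability density of deviation
  \<open>e\<close>.\<close>

lemma ift_gauss:
  assumes e: "e > 0"
  shows "ift (\<lambda>\<omega>. of_real (exp (- (e * \<omega>)\<^sup>2 / 2))) s = of_real (normal_density 0 e s)"
proof -
  have c: "(LINT x|lborel. complex_of_real (exp (- x\<^sup>2 / 2)) * cis (t * x)) = of_real (sqrt (2 * pi) * exp (- t\<^sup>2 / 2))" for t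
  proof -
    have "(LINT x|lborel. complex_of_real (exp (- x\<^sup>2 / 2)) * cis (t * x)) =
        of_real (sqrt (2 * pi)) * (LINT x|lborel. std_normal_density x *\<^sub>R cis (t * x))"
      by (subst Bochner_Integration.integral_mult_right_zero[symmetric], intro Bochner_Integration.integral_cong)
         (auto simp: std_normal_density_def scaleR_conv_of_real simp flip: of_real_mult)
    also have "(LINT x|lborel. std_normal_density x *\<^sub>R cis (t * x)) = char std_normal_distribution t"
      unfolding char_def by (subst integral_density) (auto simp: cis_conv_exp)
    finally show ?thesis by (simp add: char_std_normal_distribution)
  qed
  have "(LINT \<omega>|lborel. of_real (exp (- (e * \<omega>)\<^sup>2 / 2)) * cis (\<omega> * s)) =
    (LINT x|lborel. complex_of_real (exp (- x\<^sup>2 / 2)) * cis (s / e * x)) /\<^sub>R e"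
    using lborel_integral_real_affine[of e "\<lambda>x. complex_of_real (exp (- x\<^sup>2 / 2)) * cis (s / e * x)" 0] e
    by (simp add: mult.commute[of s])
  also have "\<dots> = of_real (sqrt (2 * pi) * exp (- (s / e)\<^sup>2 / 2) / e)"
  proof -
    have "complex_of_real (inverse e) * of_real a = of_real (a / e)" for a
      by (simp add: divide_inverse)
    then show ?thesis unfolding c scaleR_conv_of_real .
  qed
  also have "sqrt (2 * pi) * exp (- (s / e)\<^sup>2 / 2) / e = 2 * pi * normal_density 0 e s"
  proof -
    have "sqrt (2 * pi * e\<^sup>2) = sqrt (2 * pi) * e" using e by (simp add: real_sqrt_mult)
    moreover have "2 * pi = sqrt (2 * pi) * sqrt (2 * pi)" by simp
    ultimately have "2 * pi / sqrt (2 * pi * e\<^sup>2) = sqrt (2 * pi) / e"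
      by (metis divide_divide_eq_left nonzero_mult_div_cancel_left pi_neq_zero mult_eq_0_iff zero_neq_numeral)
    moreover have "- (s / e)\<^sup>2 / 2 = - (s - 0)\<^sup>2 / (2 * e\<^sup>2)" by (simp add: power_divide)
    ultimately show ?thesis unfolding normal_density_def by (metis (no_types, opaque_lifting) times_divide_eq_left times_divide_eq_right mult.assoc mult_1)
  qed
  finally show ?thesis by (simp add: ift_def)
qed

text \<open>\<open>ift_ft_mult\<close> with exchanged roles: \<open>f\<close> is the kernel and the
  Gaussian is the spectrum. Damping the spectrum thus means averaging \<open>f\<close> around
  \<open>\<tau>\<close>, and the two sides can be sent to their limits by different
  arguments.\<close>

lemma gauss_summability:
  assumes f: "integrable lborel f" and e: "e > 0"
  shows "ift (\<lambda>\<omega>. ft f \<omega> * of_real (exp (- (e * \<omega>)\<^sup>2 / 2))) \<tau> = conv (\<lambda>h. of_real (normal_density 0 e h)) f \<tau>"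
proof -
  let ?g = "\<lambda>\<omega>. complex_of_real (exp (- (e * \<omega>)\<^sup>2 / 2))"
  have "- (e * \<omega>)\<^sup>2 / 2 = - \<omega>\<^sup>2 / (2 * (1/e)\<^sup>2)" for \<omega>
    using e by (simp add: power_mult_distrib power_divide)
  then have g: "integrable lborel ?g"
    using integrable_gauss(1)[of "1/e"] e by (simp only:) simp
  have "ift (\<lambda>\<omega>. ft f \<omega> * ?g \<omega>) \<tau> = conv f (ift ?g) \<tau>"
    by (subst ift_ft_mult[OF f g]) (rule refl)
  then show ?thesis unfolding ift_gauss[OF e] conv_commute[of f] unfolding conv_def .
qed

lemma gauss_regularized_limit:
  assumes S: "integrable lborel S"
  shows "(\<lambda>n. ift (\<lambda>\<omega>. S \<omega> * of_real (exp (- (inverse (real (Suc n)) * \<omega>)\<^sup>2 / 2))) \<tau>) \<longlonglongrightarrow> ift S \<tau>"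
  unfolding ift_def
proof (intro tendsto_divide integral_dominated_convergence)
  have [measurable]: "S \<in> borel_measurable borel" using borel_measurable_integrable[OF S] by simp
  show "(\<lambda>\<omega>. S \<omega> * cis (\<omega> * \<tau>)) \<in> borel_measurable lborel" by measurable
  show "(\<lambda>\<omega>. S \<omega> * of_real (exp (- (inverse (real (Suc n)) * \<omega>)\<^sup>2 / 2)) * cis (\<omega> * \<tau>)) \<in> borel_measurable lborel" for n by measurable
  show "integrable lborel (\<lambda>\<omega>. norm (S \<omega>))" using S by simp
  show "AE \<omega> in lborel. norm (S \<omega> * of_real (exp (- (inverse (real (Suc n)) * \<omega>)\<^sup>2 / 2)) * cis (\<omega> * \<tau>)) \<le> norm (S \<omega>)" for n
    by (auto simp: norm_mult intro!: mult_right_le_one_le)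
  show "AE \<omega> in lborel. (\<lambda>n. S \<omega> * of_real (exp (- (inverse (real (Suc n)) * \<omega>)\<^sup>2 / 2)) * cis (\<omega> * \<tau>)) \<longlonglongrightarrow> S \<omega> * cis (\<omega> * \<tau>)"
  proof (intro AE_I2)
    fix \<omega>
    \<comment> \<open>The limit is first written with width 0 in the exponent, where the Gaussian
      factor is 1.\<close>
    have "(\<lambda>n. S \<omega> * of_real (exp (- (inverse (real (Suc n)) * \<omega>)\<^sup>2 / 2)) * cis (\<omega> * \<tau>)) \<longlonglongrightarrow>
      S \<omega> * of_real (exp (- (0 * \<omega>)\<^sup>2 / 2)) * cis (\<omega> * \<tau>)"
      by (intro tendsto_intros LIMSEQ_inverse_real_of_nat) auto
    then show "(\<lambda>n. S \<omega> * of_real (exp (- (inverse (real (Suc n)) * \<omega>)\<^sup>2 / 2)) * cis (\<omega> * \<tau>)) \<longlonglongrightarrow> S \<omega> * cis (\<omega> * \<tau>)" by simp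
  qed
qed auto

section \<open>Increments of a signal in mean square\<close>

lemma corr_sig:
  assumes u: "sig u" and v: "sig v" and R: "corr u v R" shows "sig R"
proof -
  note [measurable] = sigD[OF u] sigD[OF v]
  obtain B C where B: "B > 0" "\<And>t. norm (u t) \<le> B" and C: "C > 0" "\<And>t. norm (v t) \<le> C"
    using sig_bound u v by metis
  have "norm (R \<tau>) \<le> B * C" for \<tau>
    by (rule mean_bound[OF sig_shift[OF u] v]) (use B C R in \<open>auto simp: corr_def\<close>)
  moreover have "(\<lambda>\<tau>. avg (\<lambda>t. u (t + \<tau>)) v (real n)) \<in> borel_measurable borel" for n
    unfolding avg_def by measurable
  then have "R \<in> borel_measurable borel"
    by (rule borel_measurable_LIMSEQ_metric)
       (use R in \<open>auto simp: corr_def mean_def intro: filterlim_compose[OF _ filterlim_real_sequentially]\<close>)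
  ultimately show ?thesis unfolding sig_def by blast
qed

lemma corr_reflect:
  assumes "sig u" "corr u u R" shows "R (- h) = cnj (R h)"
  using corr_swap[OF assms(1,1,2)] assms(2) mean_unique[of "\<lambda>t. u (t - h)" u "R (- h)" "cnj (R h)"]
  unfolding corr_def by (auto dest!: spec[of _ "- h"])

text \<open>The cross terms are \<open>R h\<close> and its conjugate, so the power of the increment
  is governed by \<open>Re (R 0 - R h)\<close>: continuity of the correlation at 0 is continuity of
  the signal in mean square.\<close>

lemma corr_increment:
  assumes u: "sig u" and R: "corr u u R"
  shows "mean (\<lambda>t. u (t + \<tau>) - u (t + \<tau> - h)) (\<lambda>t. u (t + \<tau>) - u (t + \<tau> - h))
    (2 * R 0 - (R h + cnj (R h)))"
proof -
  have 0: "mean u u (R 0)" using R by (auto simp: corr_def dest: spec[of _ 0])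
  have "mean (\<lambda>t. u (t + h)) u (R h)" using R by (auto simp: corr_def)
  from mean_shift[OF sig_shift[OF u] u this, of "\<tau> - h"]
  have h: "mean (\<lambda>t. u (t + \<tau>)) (\<lambda>t. u (t + \<tau> - h)) (R h)" by (simp add: algebra_simps)
  have a: "mean (\<lambda>t. u (t + \<tau>)) (\<lambda>t. u (t + \<tau>)) (R 0)" using mean_shift[OF u u 0] .
  have b: "mean (\<lambda>t. u (t + \<tau> - h)) (\<lambda>t. u (t + \<tau> - h)) (R 0)"
    using mean_shift[OF u u 0, of "\<tau> - h"] by (simp add: algebra_simps)
  have s: "sig (\<lambda>t. u (t + \<tau>))" "sig (\<lambda>t. u (t + \<tau> - h))"
    using sig_shift[OF u, of \<tau>] sig_shift[OF u, of "\<tau> - h"] by (simp_all add: algebra_simps)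
  have "mean (\<lambda>t. u (t + \<tau>) + (-1) * u (t + \<tau> - h)) (\<lambda>t. u (t + \<tau>) + (-1) * u (t + \<tau> - h))
    ((R 0 + (-1) * cnj (R h)) + (cnj (-1) * R h + cnj (-1) * ((-1) * R 0)))"
    using s a b h mean_swap[OF h]
    by (intro mean_add_left mean_add_right mean_cmult_right mean_cmult_left sig_add sig_cmult)  then show ?thesis by (simp add: algebra_simps)
qed

lemma corr_increment_nonneg:
  assumes u: "sig u" and R: "corr u u R"
  shows "Re (R h) \<le> Re (R 0)"
  using mean_nonneg(2)[OF corr_increment[OF assms, of 0 h]] by simp

text \<open>\<open>Q \<tau> - Q (\<tau> - h)\<close> is the mean of the increment of
  \<open>u\<close> against \<open>v\<close>. Through \<open>mean_le\<close> the autocorrelation of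
  \<open>u\<close> near 0 controls the cross correlation near any \<open>\<tau>\<close>.\<close>

lemma corr_increment_le:
  assumes u: "sig u" and v: "sig v" and R: "corr u u R" and Q: "corr u v Q" and c: "mean v v c" and "\<delta> > 0"
  shows "norm (Q \<tau> - Q (\<tau> - h)) \<le> Re (R 0 - R h) / \<delta> + \<delta> * Re c / 2"
proof -
  have s: "sig (\<lambda>t. u (t + \<tau>))" "sig (\<lambda>t. u (t + \<tau> - h))"
    using sig_shift[OF u, of \<tau>] sig_shift[OF u, of "\<tau> - h"] by (simp_all add: algebra_simps)
  have q: "mean (\<lambda>t. u (t + \<tau>)) v (Q \<tau>)" "mean (\<lambda>t. u (t + \<tau> - h)) v (Q (\<tau> - h))"
    using Q[unfolded corr_def, rule_format, of \<tau>] Q[unfolded corr_def, rule_format, of "\<tau> - h"]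
    by (simp_all add: algebra_simps)
  have "mean (\<lambda>t. u (t + \<tau>) + (-1) * u (t + \<tau> - h)) v (Q \<tau> + (-1) * Q (\<tau> - h))"
    using s q v by (intro mean_add_left mean_cmult_left sig_cmult)
  then have "norm (Q \<tau> - Q (\<tau> - h)) \<le> Re (2 * R 0 - (R h + cnj (R h))) / (2 * \<delta>) + \<delta> * Re c / 2"
    using s v c \<open>\<delta> > 0\<close> corr_increment[OF u R] by (intro mean_le[of _ v]) (auto intro: sig_diff)
  then show ?thesis by (simp add: diff_divide_distrib)
qed

text \<open>The bound is linear in \<open>F\<close>, so it is enough that the Gaussian averages of
  \<open>F\<close> vanish in the limit. This averaged form of continuity is what the power identity
  yields.\<close>

lemma conv_gauss_limit:
  assumes Q: "sig Q" and F: "F \<in> borel_measurable borel" "\<And>h. \<bar>F h\<bar> \<le> K"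
    and le: "\<And>h \<delta>. \<delta> > 0 \<Longrightarrow> norm (Q \<tau> - Q (\<tau> - h)) \<le> F h / \<delta> + \<delta> * c"
    and "c \<ge> 0" and e: "\<And>n. e n > 0"
    and lim: "(\<lambda>n. LINT h|lborel. normal_density 0 (e n) h * F h) \<longlonglongrightarrow> 0"
  shows "(\<lambda>n. conv (\<lambda>h. of_real (normal_density 0 (e n) h)) Q \<tau>) \<longlonglongrightarrow> Q \<tau>"
proof (rule tendstoI)
  fix r :: real assume r: "r > 0"
  note [measurable] = F(1) sigD[OF Q]
  obtain B where B: "B > 0" "\<And>t. norm (Q t) \<le> B" using sig_bound Q by metis
  \<comment> \<open>Makes \<open>\<delta> * c\<close> smaller than \<open>r / 2\<close>; the
    \<open>+ 1\<close> covers \<open>c = 0\<close>. With \<open>\<delta>\<close> fixed, the average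
    of \<open>F h / \<delta>\<close> eventually drops below \<open>r / 2\<close> as well.\<close>
  define \<delta> where "\<delta> = r / (2 * (c + 1))"
  have \<delta>: "\<delta> > 0" "\<delta> * c < r / 2" using r \<open>c \<ge> 0\<close> by (auto simp: \<delta>_def field_simps)
  have "\<forall>\<^sub>F n in sequentially. (LINT h|lborel. normal_density 0 (e n) h * F h) < \<delta> * (r / 2)"
    using order_tendstoD(2)[OF lim, of "\<delta> * (r / 2)"] \<delta> r by simp
  then show "\<forall>\<^sub>F n in sequentially. dist (conv (\<lambda>h. of_real (normal_density 0 (e n) h)) Q \<tau>) (Q \<tau>) < r"
  proof eventually_elim
    case (elim n)
    let ?N = "\<lambda>h. normal_density 0 (e n) h"
    have N: "integrable lborel ?N" "(LINT h|lborel. ?N h) = 1"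
      using integrable_normal_density[OF e[of n], of 0] integral_normal_density[OF e[of n], of 0] by simp_all
    note Nc = integrable_normal_density_complex[OF e[of n]]
    have NF: "integrable lborel (\<lambda>h. ?N h * F h)"
    proof (rule Bochner_Integration.integrable_bound)
      show "integrable lborel (\<lambda>h. K * ?N h)" using N by simp
      show "AE h in lborel. norm (?N h * F h) \<le> norm (K * ?N h)"
        using F(2) by (auto simp: abs_mult mult.commute[of K] intro!: mult_mono order_trans[OF F(2) abs_ge_self])
    qed simp
    have NQ: "integrable lborel (\<lambda>h. complex_of_real (?N h) * Q (\<tau> - h))"
      by (rule integrable_mult_bounded[OF Nc, where K=B]) (use B in auto)
    have NQ0: "integrable lborel (\<lambda>h. complex_of_real (?N h) * Q \<tau>)" using Nc by simp
    have "Q \<tau> - conv (\<lambda>h. of_real (?N h)) Q \<tau> = (LINT h|lborel. of_real (?N h) * (Q \<tau> - Q (\<tau> - h)))"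
      using NQ NQ0 N(2) by (simp add: conv_def right_diff_distrib Bochner_Integration.integral_diff)
    also have "norm \<dots> \<le> (LINT h|lborel. ?N h * F h / \<delta> + ?N h * (\<delta> * c))"
    proof (rule norm_integral_le)
      show "integrable lborel (\<lambda>h. complex_of_real (?N h) * (Q \<tau> - Q (\<tau> - h)))"
        using NQ NQ0 by (simp add: right_diff_distrib)
      show "norm (complex_of_real (?N h) * (Q \<tau> - Q (\<tau> - h))) \<le> ?N h * F h / \<delta> + ?N h * (\<delta> * c)" for h
        using mult_left_mono[OF le[OF \<delta>(1), of h], of "?N h"] by (simp add: norm_mult distrib_left)
    qed (use NF N in auto)
    also have "\<dots> = (LINT h|lborel. ?N h * F h) / \<delta> + \<delta> * c"
      using NF N by (simp add: Bochner_Integration.integral_add)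
    also have "\<dots> < r / 2 + r / 2"
      using elim \<delta> by (intro add_strict_mono) (simp_all add: pos_divide_less_eq mult.commute)
    also have "\<dots> = r" by simp
    finally show ?case by (simp add: dist_norm norm_minus_commute)
  qed
qed

text \<open>Up to a positive factor, the Gaussian regularization of \<open>ft R \<omega>\<close> is the power of \<open>p\<close> after the filter with
  kernel \<open>exp (- a\<^sup>2 / (2 s\<^sup>2)) * cis (\<omega> a)\<close>.\<close>

lemma ft_autocorrelation_nonneg:
  assumes p: "sig p" and R: "corr p p R" and Ri: "integrable lborel R"
  shows "Re (ft R \<omega>) \<ge> 0"
proof -
  \<comment> \<open>The 4 in the exponent comes from correlating a Gaussian of deviation
    \<open>s\<close> with itself, which doubles the variance.\<close>
  have lim: "(\<lambda>n. ft (\<lambda>\<sigma>. R \<sigma> * of_real (exp (- (inverse (real (Suc n)) * \<sigma>)\<^sup>2 / 4))) \<omega>) \<longlonglongrightarrow> ft R \<omega>"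
    unfolding ft_def
  proof (rule integral_dominated_convergence)
    have [measurable]: "R \<in> borel_measurable borel" using borel_measurable_integrable[OF Ri] by simp
    show "(\<lambda>\<sigma>. R \<sigma> * cis (- (\<omega> * \<sigma>))) \<in> borel_measurable lborel" by measurable
    show "(\<lambda>\<sigma>. R \<sigma> * of_real (exp (- (inverse (real (Suc n)) * \<sigma>)\<^sup>2 / 4)) * cis (- (\<omega> * \<sigma>))) \<in> borel_measurable lborel" for n by measurable
    show "integrable lborel (\<lambda>\<omega>. norm (R \<omega>))" using Ri by simp
    show "AE \<sigma> in lborel. norm (R \<sigma> * of_real (exp (- (inverse (real (Suc n)) * \<sigma>)\<^sup>2 / 4)) * cis (- (\<omega> * \<sigma>))) \<le> norm (R \<sigma>)" for n
      by (auto simp: norm_mult intro!: mult_right_le_one_le)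
    show "AE \<sigma> in lborel. (\<lambda>n. R \<sigma> * of_real (exp (- (inverse (real (Suc n)) * \<sigma>)\<^sup>2 / 4)) * cis (- (\<omega> * \<sigma>))) \<longlonglongrightarrow> R \<sigma> * cis (- (\<omega> * \<sigma>))"
    proof (intro AE_I2)
      fix \<sigma>
      have "(\<lambda>n. R \<sigma> * of_real (exp (- (inverse (real (Suc n)) * \<sigma>)\<^sup>2 / 4)) * cis (- (\<omega> * \<sigma>))) \<longlonglongrightarrow>
        R \<sigma> * of_real (exp (- (0 * \<sigma>)\<^sup>2 / 4)) * cis (- (\<omega> * \<sigma>))"
        by (intro tendsto_intros LIMSEQ_inverse_real_of_nat) auto
      then show "(\<lambda>n. R \<sigma> * of_real (exp (- (inverse (real (Suc n)) * \<sigma>)\<^sup>2 / 4)) * cis (- (\<omega> * \<sigma>))) \<longlonglongrightarrow> R \<sigma> * cis (- (\<omega> * \<sigma>))"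
        by simp
    qed
  qed
  have "Re (ft (\<lambda>\<sigma>. R \<sigma> * of_real (exp (- (inverse (real (Suc n)) * \<sigma>)\<^sup>2 / 4))) \<omega>) \<ge> 0" for n
  proof -
    define s where "s = real (Suc n)"
    have s: "s > 0" by (simp add: s_def)
    define \<gamma> where "\<gamma> a = exp (- a\<^sup>2 / (2 * s\<^sup>2))" for a
    define g where "g a = complex_of_real (\<gamma> a) * cis (\<omega> * a)" for a
    have gi: "integrable lborel g"
      unfolding g_def[abs_def] \<gamma>_def by (rule integrable_cis(1)[OF integrable_gauss(1)[OF s]])
    have gi': "integrable lborel (\<lambda>a. cnj (g a))" using gi by simp
    note [measurable] = borel_measurable_integrable[OF gi] borel_measurable_integrable[OF Ri]
    have gp: "sig (conv g p)" using sig_conv[OF p gi] .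
    \<comment> \<open>Each argument is filtered in turn: \<open>corr_conv\<close> acts on the left
      one, and the swap brings the other one there.\<close>
    have "corr (conv g p) (conv g p) (conv g (\<lambda>\<tau>. cnj (conv g R (- \<tau>))))"
      by (intro corr_conv corr_swap p gp gi R)
    then have "mean (conv g p) (conv g p) (conv g (\<lambda>\<tau>. cnj (conv g R (- \<tau>))) 0)"
      by (auto simp: corr_def dest: spec[of _ 0])
    from mean_nonneg(2)[OF this]
    have "0 \<le> Re (cnj (conv g (\<lambda>\<tau>. cnj (conv g R (- \<tau>))) 0))" by simp
    also have "cnj (conv g (\<lambda>\<tau>. cnj (conv g R (- \<tau>))) 0) = (LINT a|lborel. cnj (g a) * conv g R a)"
      unfolding conv_def[of g "\<lambda>\<tau>. cnj (conv g R (- \<tau>))"]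
      by (subst Bochner_Integration.integral_cnj[symmetric]) simp
    also have "\<dots> = (LINT a|lborel. cnj (g a) * (LINT \<sigma>|lborel. R \<sigma> * g (a - \<sigma>)))"
      by (simp add: conv_commute)
    also have "\<dots> = (LINT \<sigma>|lborel. R \<sigma> * (LINT a|lborel. cnj (g a) * g (a - \<sigma>)))"
      by (rule integral_pair_swap[OF gi' Ri, where K=1]) (auto simp: g_def \<gamma>_def norm_mult)
    also have "\<dots> = (LINT \<sigma>|lborel. of_real (sqrt (pi * s\<^sup>2)) * (R \<sigma> * of_real (exp (- (inverse s * \<sigma>)\<^sup>2 / 4)) * cis (- (\<omega> * \<sigma>))))"
    proof (intro Bochner_Integration.integral_cong refl)
      fix \<sigma>
      have "cnj (g a) * g (a - \<sigma>) =
          cis (- (\<omega> * \<sigma>)) * of_real (exp (- (inverse s * \<sigma>)\<^sup>2 / 4)) *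
          of_real (exp (- (a - \<sigma> / 2)\<^sup>2 / (2 * (s / sqrt 2)\<^sup>2)))" for a
      proof -
        \<comment> \<open>Completing the square around the midpoint \<open>\<sigma> / 2\<close>
          leaves a Gaussian in \<open>a\<close> of deviation \<open>s / sqrt 2\<close>, whose mass
          is \<open>sqrt (pi * s\<^sup>2)\<close>.\<close>
        have "- a\<^sup>2 / (2 * s\<^sup>2) + - (a - \<sigma>)\<^sup>2 / (2 * s\<^sup>2) =
          - (inverse s * \<sigma>)\<^sup>2 / 4 + - (a - \<sigma> / 2)\<^sup>2 / (2 * (s / sqrt 2)\<^sup>2)"
          using s by (simp add: power_divide power_mult_distrib power_inverse field_simps) (simp add: power2_eq_square algebra_simps)
        then have "\<gamma> a * \<gamma> (a - \<sigma>) = exp (- (inverse s * \<sigma>)\<^sup>2 / 4) * exp (- (a - \<sigma> / 2)\<^sup>2 / (2 * (s / sqrt 2)\<^sup>2))"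
          unfolding \<gamma>_def by (simp only: flip: exp_add)
        moreover have "cnj (g a) * g (a - \<sigma>) = cis (- (\<omega> * \<sigma>)) * of_real (\<gamma> a * \<gamma> (a - \<sigma>))"
          by (simp add: g_def cis_cnj cis_mult algebra_simps)
        ultimately show ?thesis by simp
      qed
      then have "(LINT a|lborel. cnj (g a) * g (a - \<sigma>)) =
          cis (- (\<omega> * \<sigma>)) * of_real (exp (- (inverse s * \<sigma>)\<^sup>2 / 4)) *
          (LINT a|lborel. of_real (exp (- (a - \<sigma> / 2)\<^sup>2 / (2 * (s / sqrt 2)\<^sup>2))))"
        by simp
      also have "(LINT a|lborel. complex_of_real (exp (- (a - \<sigma> / 2)\<^sup>2 / (2 * (s / sqrt 2)\<^sup>2)))) =
          of_real (LINT a|lborel. exp (- (a - \<sigma> / 2)\<^sup>2 / (2 * (s / sqrt 2)\<^sup>2)))"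
        by (rule integral_complex_of_real)
      also have "(LINT a|lborel. exp (- (a - \<sigma> / 2)\<^sup>2 / (2 * (s / sqrt 2)\<^sup>2))) =
          (LINT a|lborel. exp (- a\<^sup>2 / (2 * (s / sqrt 2)\<^sup>2)))"
        by (subst lborel_integral_real_affine[where c=1 and t="\<sigma>/2"]) auto
      also have "\<dots> = sqrt (pi * s\<^sup>2)"
        using integrable_gauss(2)[of "s / sqrt 2"] s by (simp add: power_divide)
      finally show "R \<sigma> * (LINT a|lborel. cnj (g a) * g (a - \<sigma>)) =
          of_real (sqrt (pi * s\<^sup>2)) * (R \<sigma> * of_real (exp (- (inverse s * \<sigma>)\<^sup>2 / 4)) * cis (- (\<omega> * \<sigma>)))"
        by (simp add: mult_ac)
    qed
    also have "\<dots> = of_real (sqrt (pi * s\<^sup>2)) * ft (\<lambda>\<sigma>. R \<sigma> * of_real (exp (- (inverse s * \<sigma>)\<^sup>2 / 4))) \<omega>"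
      unfolding ft_def by (rule Bochner_Integration.integral_mult_right_zero)
    finally have "0 \<le> sqrt (pi * s\<^sup>2) * Re (ft (\<lambda>\<sigma>. R \<sigma> * of_real (exp (- (inverse s * \<sigma>)\<^sup>2 / 4))) \<omega>)"
      by simp
    moreover have "sqrt (pi * s\<^sup>2) > 0" using s by simp
    ultimately show ?thesis unfolding s_def[symmetric] by (metis mult_pos_neg not_le)
  qed
  then show ?thesis
    by (intro tendsto_lowerbound[OF tendsto_Re[OF lim]]) auto
qed

lemma corr_add_right:
  assumes "sig u" "sig v" "sig v'" "corr u v R" "corr u v' R'"
  shows "corr u (\<lambda>t. v t + v' t) (\<lambda>\<tau>. R \<tau> + R' \<tau>)"
  using assms unfolding corr_def by (auto intro!: mean_add_right sig_shift)

lemma corr_cmult_right: "corr u v R \<Longrightarrow> corr u (\<lambda>t. a * v t) (\<lambda>\<tau>. cnj a * R \<tau>)"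
  unfolding corr_def by (auto intro!: mean_cmult_right)

text \<open>The spectral matrix of the pair is positive semidefinite, tested through the signal
  \<open>u + c * v\<close> with a phase \<open>c\<close>. The bound is left in the form of an
  arithmetic mean of the diagonal because this is dominated by the trace.\<close>

lemma ft_cross_le:
  assumes u: "sig u" and v: "sig v" and Ru: "corr u u Ru" and Rv: "corr v v Rv" and Q: "corr u v Q"
    and i: "integrable lborel Ru" "integrable lborel Rv" "integrable lborel Q"
  shows "2 * norm (ft Q \<omega>) \<le> Re (ft Ru \<omega>) + Re (ft Rv \<omega>)"
proof (cases "ft Q \<omega> = 0")
  case True
  then show ?thesis using ft_autocorrelation_nonneg[OF u Ru i(1)] ft_autocorrelation_nonneg[OF v Rv i(2)] by simp
next
  case False
  \<comment> \<open>A number of modulus 1 that turns the cross term into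
    \<open>- norm (ft Q \<omega>)\<close>.\<close>
  define c where "c = - sgn (ft Q \<omega>)"
  have c: "cnj c * ft Q \<omega> = - of_real (norm (ft Q \<omega>))" "cnj c * c = 1"
    using False by (auto simp: c_def sgn_div_norm scaleR_conv_of_real complex_norm_square[symmetric] power2_eq_square
        mult.commute[of "cnj _"] field_simps)
  have iQ: "integrable lborel (\<lambda>\<tau>. cnj (Q (- \<tau>)))"
    using lborel_integrable_real_affine[OF i(3), of "-1" 0] by simp
  let ?R = "\<lambda>\<tau>. (Ru \<tau> + c * cnj (Q (- \<tau>))) + (cnj c * Q \<tau> + cnj c * (c * Rv \<tau>))"
  have "corr (\<lambda>t. u t + c * v t) (\<lambda>t. u t + c * v t) ?R"
    by (intro corr_add_right corr_cmult_right corr_add_left corr_cmult_left corr_swap sig_add sig_cmult assms)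
  moreover have "integrable lborel ?R" using i iQ by simp
  ultimately have "Re (ft ?R \<omega>) \<ge> 0"
    by (intro ft_autocorrelation_nonneg[of "\<lambda>t. u t + c * v t"] sig_add sig_cmult u v)
  also have "ft ?R \<omega> = ft Ru \<omega> + c * cnj (ft Q \<omega>) + (cnj c * ft Q \<omega> + (cnj c * c) * ft Rv \<omega>)"
    using i iQ by (simp add: ft_add ft_cmult ft_reflect_cnj mult.assoc)
  also have "c * cnj (ft Q \<omega>) = cnj (cnj c * ft Q \<omega>)" by simp
  finally show ?thesis unfolding c by simp
qed

text \<open>The components of a bounded power signal. Integrability is assumed only for the trace of
  the spectral matrix, and representation of the correlation only for the trace at lag 0; the same
  for all entries and all lags is deduced.\<close>

locale power_family =
  fixes W :: "'i::finite \<Rightarrow> real \<Rightarrow> complex" and R :: "'i \<Rightarrow> 'i \<Rightarrow> real \<Rightarrow> complex"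
  assumes W: "\<And>i. sig (W i)"
    and R: "\<And>i j. corr (W i) (W j) (R i j)"
    and Ri: "\<And>i j. integrable lborel (R i j)"
    and Si: "integrable lborel (\<lambda>\<omega>. \<Sum>i\<in>UNIV. ft (R i i) \<omega>)"
    and power: "ift (\<lambda>\<omega>. \<Sum>i\<in>UNIV. ft (R i i) \<omega>) 0 = (\<Sum>i\<in>UNIV. R i i 0)"
begin

text \<open>\<open>2 * F h\<close> is the power of the increment of the whole family over a lag
  \<open>h\<close>.\<close>

definition "F h = (\<Sum>i\<in>UNIV. Re (R i i 0 - R i i h))"

lemma F_ge: "Re (R i i 0 - R i i h) \<le> F h"
  unfolding F_def by (rule member_le_sum) (use corr_increment_nonneg[OF W R] in auto)

lemma F_measurable: "F \<in> borel_measurable borel"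
proof -
  have [measurable]: "R i j \<in> borel_measurable borel" for i j
    using corr_sig[OF W W R] by (rule sigD)
  show ?thesis unfolding F_def[abs_def] by measurable
qed

lemma F_bounded: "\<exists>K. \<forall>h. \<bar>F h\<bar> \<le> K"
proof -
  have "\<exists>B. \<forall>t. norm (R i i t) \<le> B" for i
    using corr_sig[OF W W R] by (auto simp: sig_def)
  then obtain B where B: "\<And>i t. norm (R i i t) \<le> B i" by metis
  have "\<bar>F h\<bar> \<le> (\<Sum>i\<in>UNIV. 2 * B i)" for h
    unfolding F_def
  proof (rule order_trans[OF sum_abs sum_mono])
    fix i
    have "\<bar>Re (R i i 0 - R i i h)\<bar> \<le> norm (R i i 0) + norm (R i i h)"
      using abs_Re_le_cmod norm_triangle_ineq4 order_trans by blast
    then show "\<bar>Re (R i i 0 - R i i h)\<bar> \<le> 2 * B i" using B[of i 0] B[of i h] by simp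
  qed
  then show ?thesis by blast
qed

text \<open>Averaged continuity in mean square. The Gaussian average around 0 of the summed
  autocorrelation is a damped inverse transform of the summed spectrum. It tends to the full inverse
  transform at 0, which by \<open>power\<close> is the summed autocorrelation at 0 itself.\<close>

lemma F_limit: "(\<lambda>n. LINT h|lborel. normal_density 0 (inverse (real (Suc n))) h * F h) \<longlonglongrightarrow> 0"
proof -
  let ?f = "\<lambda>t. \<Sum>i\<in>UNIV. R i i t"
  let ?S = "\<lambda>\<omega>. \<Sum>i\<in>UNIV. ft (R i i) \<omega>"
  have fi: "integrable lborel ?f" using Ri by simp
  have ftf: "ft ?f = ?S"
    unfolding ft_def[abs_def] using Ri by (simp add: sum_distrib_right Bochner_Integration.integral_sum)
  have "(\<lambda>n. ift (\<lambda>\<omega>. ?S \<omega> * of_real (exp (- (inverse (real (Suc n)) * \<omega>)\<^sup>2 / 2))) 0) \<longlonglongrightarrow> ?f 0"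
    using gauss_regularized_limit[OF Si, of 0] power by simp
  then have "(\<lambda>n. conv (\<lambda>h. of_real (normal_density 0 (inverse (real (Suc n))) h)) ?f 0) \<longlonglongrightarrow> ?f 0"
    using gauss_summability[OF fi, of "inverse (real (Suc n))" 0 for n] ftf by simp
  then have "(\<lambda>n. Re (?f 0) - Re (conv (\<lambda>h. of_real (normal_density 0 (inverse (real (Suc n))) h)) ?f 0)) \<longlonglongrightarrow> Re (?f 0) - Re (?f 0)"
    by (intro tendsto_intros)
  moreover have "Re (?f 0) - Re (conv (\<lambda>h. of_real (normal_density 0 e h)) ?f 0) = (LINT h|lborel. normal_density 0 e h * F h)"
    if e: "e > 0" for e
  proof -
    let ?N = "\<lambda>h. normal_density 0 e h"
    have N: "integrable lborel ?N" "(LINT h|lborel. ?N h) = 1"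
      using integrable_normal_density[OF e, of 0] integral_normal_density[OF e, of 0] by simp_all
    have sf: "sig ?f" by (rule sig_sum) (rule corr_sig[OF W W R])
    have sf': "sig (\<lambda>h. ?f (0 - h))" using sf by (auto simp: sig_def)
    have I: "integrable lborel (\<lambda>h. complex_of_real (?N h) * ?f (0 - h))"
      by (rule sig_mult_integrable[OF sf' integrable_normal_density_complex[OF e]])
    have "Re (conv (\<lambda>h. of_real (?N h)) ?f 0) = (LINT h|lborel. ?N h * Re (?f (0 - h)))"
      unfolding conv_def by (subst integral_Re[symmetric, OF I]) simp
    \<comment> \<open>\<open>conv\<close> reads the correlation at \<open>0 - h\<close>; reflection
      conjugates it, so the real part is that at \<open>h\<close>.\<close>
    also have "\<dots> = (LINT h|lborel. ?N h * Re (?f 0) - ?N h * F h)"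
      by (intro Bochner_Integration.integral_cong refl)
         (simp add: F_def corr_reflect[OF W R] sum_subtractf algebra_simps)
    also have "\<dots> = Re (?f 0) - (LINT h|lborel. ?N h * F h)"
    proof -
      have "integrable lborel (\<lambda>h. ?N h * Re (?f 0) - Re (complex_of_real (?N h) * ?f (0 - h)))"
        using N I by (intro Bochner_Integration.integrable_diff integrable_Re) auto
      also have "(\<lambda>h. ?N h * Re (?f 0) - Re (complex_of_real (?N h) * ?f (0 - h))) = (\<lambda>h. ?N h * F h)"
        by (auto simp: F_def corr_reflect[OF W R] sum_subtractf algebra_simps)
      finally show ?thesis using N by (simp add: Bochner_Integration.integral_diff)
    qed
    finally show ?thesis by simp
  qed
  ultimately show ?thesis by simp
qed

text \<open>Continuity in mean square passes to the cross correlation with any signal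
  \<open>V\<close> that has a power. \<open>V\<close> is kept general since it is a member of the
  family in \<open>cspec_ft\<close> and a foreign signal in \<open>cspec_orthogonal\<close>.\<close>

lemma correlation_gauss_limit:
  assumes "sig V" "mean V V c" "corr (W i) V Q"
  shows "(\<lambda>n. conv (\<lambda>h. of_real (normal_density 0 (inverse (real (Suc n))) h)) Q \<tau>) \<longlonglongrightarrow> Q \<tau>"
proof -
  obtain K where K: "\<And>h. \<bar>F h\<bar> \<le> K" using F_bounded by blast
  show ?thesis
  proof (rule conv_gauss_limit[OF corr_sig[OF W assms(1,3)] F_measurable K])
    fix h \<delta> :: real assume "\<delta> > 0"
    then have "norm (Q \<tau> - Q (\<tau> - h)) \<le> Re (R i i 0 - R i i h) / \<delta> + \<delta> * (Re c / 2)"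
      using corr_increment_le[OF W assms(1) R assms(3,2)] by simp
    also have "\<dots> \<le> F h / \<delta> + \<delta> * (Re c / 2)"
      using F_ge[of i h] \<open>\<delta> > 0\<close> by (simp add: divide_right_mono)
    finally show "norm (Q \<tau> - Q (\<tau> - h)) \<le> F h / \<delta> + \<delta> * (Re c / 2)" .
  qed (use F_limit mean_nonneg(2)[OF assms(2)] in auto)
qed

lemma ft_integrable: "integrable lborel (ft (R i j))"
proof (rule Bochner_Integration.integrable_bound[OF Si])
  show "ft (R i j) \<in> borel_measurable lborel"
    using ft_measurable_bounded(1)[OF Ri] by simp
  show "AE \<omega> in lborel. norm (ft (R i j) \<omega>) \<le> norm (\<Sum>i\<in>UNIV. ft (R i i) \<omega>)"
  proof (intro AE_I2)
    fix \<omega>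
    have le: "Re (ft (R i i) \<omega>) \<le> Re (\<Sum>i\<in>UNIV. ft (R i i) \<omega>)" for i
      unfolding Re_sum by (rule member_le_sum) (use ft_autocorrelation_nonneg[OF W R Ri] in auto)
    have "2 * norm (ft (R i j) \<omega>) \<le> Re (ft (R i i) \<omega>) + Re (ft (R j j) \<omega>)"
      by (rule ft_cross_le[OF W W R R R Ri Ri Ri])
    then have "norm (ft (R i j) \<omega>) \<le> Re (\<Sum>i\<in>UNIV. ft (R i i) \<omega>)" using le[of i] le[of j] by linarith
    then show "norm (ft (R i j) \<omega>) \<le> norm (\<Sum>i\<in>UNIV. ft (R i i) \<omega>)"
      using complex_Re_le_cmod order_trans by blast
  qed
qed

text \<open>The damped inverse transforms tend to \<open>ift (ft (R i j))\<close> by dominated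
  convergence and to \<open>R i j\<close> by averaging, both at every lag, so the two limits agree
  everywhere.\<close>

lemma cspec_ft: "cspec (W i) (W j) (ft (R i j))"
proof -
  have "mean (W j) (W j) (R j j 0)" using R[of j j] by (auto simp: corr_def dest: spec[of _ 0])
  have "ift (ft (R i j)) \<tau> = R i j \<tau>" for \<tau>
    using gauss_regularized_limit[OF ft_integrable[of i j], of \<tau>]
      correlation_gauss_limit[OF W \<open>mean (W j) (W j) (R j j 0)\<close> R]
    by (subst (asm) gauss_summability[OF Ri]) (auto intro: LIMSEQ_unique)
  then have "ift (ft (R i j)) = R i j" by auto
  then show ?thesis using W R Ri ft_integrable by (simp add: cspec_def)
qed

text \<open>A vanishing transform makes the Gaussian averages of \<open>Q\<close> around every point
  vanish, and these tend to \<open>Q\<close> at that point. Hence \<open>Q\<close> is 0 everywhere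
  and not merely almost everywhere.\<close>

lemma cspec_orthogonal:
  assumes "sig V" "mean V V c" "corr (W i) V Q" "integrable lborel Q" "ft Q = (\<lambda>_. 0)"
  shows "cspec (W i) V (\<lambda>_. 0)"
proof -
  have "conv (\<lambda>h. of_real (normal_density 0 (inverse (real (Suc n))) h)) Q \<tau> = 0" for n \<tau>
    using gauss_summability[OF assms(4), of "inverse (real (Suc n))" \<tau>] assms(5) by simp
  then have "Q \<tau> = 0" for \<tau>
    using correlation_gauss_limit[OF assms(1-3), of \<tau>] by (simp add: LIMSEQ_const_iff)
  then have "Q = (\<lambda>_. 0)" by auto
  then show ?thesis using assms W by (simp add: cspec_def)
qed

end

section \<open>Stable matrices\<close>

text \<open>Horner's rule for p(A) v, acting on vectors throughout so that no matrix powers enter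
  the recursion.\<close>

definition poly_apply :: "complex^'n^'n \<Rightarrow> complex poly \<Rightarrow> complex^'n \<Rightarrow> complex^'n"
  where "poly_apply A p v = fold_coeffs (\<lambda>a w. a *s v + A *v w) p 0"

lemma poly_apply_0 [simp]: "poly_apply A 0 v = 0"
  by (simp add: poly_apply_def)

lemma poly_apply_pCons [simp]: "poly_apply A (pCons a p) v = a *s v + A *v poly_apply A p v"
  by (cases "p = 0 \<and> a = 0") (auto simp: poly_apply_def)

lemma poly_apply_add: "poly_apply A (p + q) v = poly_apply A p v + poly_apply A q v"
  by (induction p q rule: poly_induct2) (simp_all add: vec.scale_left_distrib matrix_vector_right_distrib)

lemma poly_apply_smult: "poly_apply A (smult c p) v = c *s poly_apply A p v"
  by (induction p) (simp_all add: vec.scale_right_distrib vec.scale)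

lemma poly_apply_sum: "poly_apply A (\<Sum>k\<in>F. p k) v = (\<Sum>k\<in>F. poly_apply A (p k) v)"
  by (induction F rule: infinite_finite_induct) (simp_all add: poly_apply_add)

lemma poly_apply_monom: "poly_apply A (monom c k) v = c *s (((*v) A) ^^ k) v"
  by (induction k) (simp_all add: monom_0 monom_Suc vec.scale)

lemma poly_apply_diff_arg: "poly_apply A p (v - w) = poly_apply A p v - poly_apply A p w"
  by (induction p) (simp_all add: vec.scale_right_diff_distrib matrix_vector_mult_diff_distrib)

lemma poly_apply_scale_arg: "poly_apply A p (c *s v) = c *s poly_apply A p v"
  by (induction p) (simp_all add: vec.scale_right_distrib vec.scale mult.commute)

lemma poly_apply_commute: "poly_apply A p (A *v v) = A *v poly_apply A p v"
  by (induction p) (simp_all add: matrix_vector_right_distrib vec.scale)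

lemma poly_apply_linear_mult:
  "poly_apply A ([:- l, 1:] * q) v = A *v poly_apply A q v - l *s poly_apply A q v"
proof -
  have "[:- l, 1:] * q = smult (- l) q + pCons 0 q" by simp
  then show ?thesis unfolding poly_apply_add poly_apply_smult by (simp add: poly_apply_add poly_apply_smult del: smult_minus_left mult_pCons_left)
qed

text \<open>The powers of \<open>A\<close> with exponents from 0 to \<open>N\<close> are one more
  than the real dimension \<open>N\<close> of the space of matrices, so they satisfy a nontrivial
  linear relation.\<close>

lemma annihilating_polynomial_exists:
  fixes A :: "complex^'n^'n"
  shows "\<exists>p. p \<noteq> 0 \<and> (\<forall>v. poly_apply A p v = 0)"
proof -
  define M where "M k = ((**) A ^^ k) (mat 1)" for k
  have M: "M k *v v = (((*v) A) ^^ k) v" for k v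
    by (induction k) (simp_all add: M_def matrix_vector_mul_assoc[symmetric])
  define N where "N = DIM(complex^'n^'n)"
  have "\<exists>c. (\<exists>k\<le>N. c k \<noteq> 0) \<and> (\<Sum>k\<le>N. c k *\<^sub>R M k) = (0::complex^'n^'n)"
  \<comment> \<open>\<open>dependent\<close> speaks of a set, which forgets repetitions; two
    coinciding powers therefore supply their own relation.\<close>
  proof (cases "inj_on M {..N}")
    case True
    then have card: "card (M ` {..N}) = Suc N" by (simp add: card_image)
    have "dependent (M ` {..N})"
    proof (rule ccontr)
      assume "\<not> dependent (M ` {..N})"
      then have "card (M ` {..N}) \<le> DIM(complex^'n^'n)" using independent_bound by blast
      with card show False by (simp add: N_def)
    qed
    then obtain u where u: "\<exists>v\<in>M ` {..N}. u v \<noteq> 0" "(\<Sum>v\<in>M ` {..N}. u v *\<^sub>R v) = 0"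
      by (subst (asm) real_vector.dependent_finite) auto
    then show ?thesis
      by (intro exI[of _ "u \<circ> M"]) (auto simp: sum.reindex[OF True])
  next
    case False
    then obtain i j where ij: "i \<le> N" "j \<le> N" "i \<noteq> j" "M i = M j" by (auto simp: inj_on_def)
    have "(\<Sum>k\<le>N. (if k = i then 1 else if k = j then -1 else 0) *\<^sub>R M k) =
      (\<Sum>k\<le>N. (if k = i then M k else 0) + (if k = j then - M k else 0))"
      using ij(3) by (intro sum.cong) auto
    also have "\<dots> = 0" using ij by (simp add: sum.distrib)
    finally show ?thesis using ij by (intro exI[of _ "\<lambda>k. if k = i then 1 else if k = j then -1 else 0"]) auto
  qed
  then obtain c k0 where c: "k0 \<le> N" "c k0 \<noteq> 0" "(\<Sum>k\<le>N. c k *\<^sub>R M k) = 0" by blast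
  define p where "p = (\<Sum>k\<le>N. monom (complex_of_real (c k)) k)"
  have "coeff p k0 = of_real (c k0)"
    using c(1) by (simp add: p_def coeff_sum)
  then have "p \<noteq> 0" using c(2) by auto
  moreover have "poly_apply A p v = 0" for v
  proof -
    have "poly_apply A p v = (\<Sum>k\<le>N. (c k *\<^sub>R M k) *v v)"
      by (simp add: p_def poly_apply_sum poly_apply_monom M[symmetric])
         (simp add: vec_eq_iff matrix_vector_mult_def sum_distrib_left scaleR_conv_of_real[where 'a=complex] mult.assoc)
    also have "\<dots> = (\<Sum>k\<le>N. c k *\<^sub>R M k) *v v"
      by (induction N) (simp_all add: matrix_vector_mult_add_rdistrib)
    finally show ?thesis using c(3) by simp
  qed
  ultimately show ?thesis by blast
qed

text \<open>Take the degree least. If \<open>l\<close> is a root, the cofactor \<open>q\<close> of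
  the linear factor no longer annihilates, and any nonzero value of q(A) is an eigenvector for
  \<open>l\<close>.\<close>

lemma annihilating_polynomial_eigenvalues:
  fixes A :: "complex^'n^'n"
  obtains p where "p \<noteq> 0" "\<And>v. poly_apply A p v = 0"
    "\<And>l. poly p l = 0 \<Longrightarrow> \<exists>v. v \<noteq> 0 \<and> A *v v = l *s v"
proof -
  define P where "P p \<longleftrightarrow> p \<noteq> 0 \<and> (\<forall>v. poly_apply A p v = 0)" for p
  obtain p where p: "P p" and min: "\<And>q. P q \<Longrightarrow> degree p \<le> degree q"
    using annihilating_polynomial_exists[of A] ex_has_least_nat[of P _ degree] unfolding P_def by blast
  show thesis
  proof (rule that[of p])
    fix l assume "poly p l = 0"
    then obtain q where q: "p = [:- l, 1:] * q" by (auto simp: poly_eq_0_iff_dvd)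
    have "q \<noteq> 0" using p q by (auto simp: P_def)
    then have "degree p = Suc (degree q)" unfolding q by (subst degree_mult_eq) auto
    then have "\<not> P q" using min[of q] by auto
    then obtain v where "poly_apply A q v \<noteq> 0" using \<open>q \<noteq> 0\<close> by (auto simp: P_def)
    moreover have "A *v poly_apply A q v = l *s poly_apply A q v"
      using p poly_apply_linear_mult[of A l q v] unfolding q[symmetric] P_def by simp
    ultimately show "\<exists>v. v \<noteq> 0 \<and> A *v v = l *s v" by blast
  qed (use p in \<open>auto simp: P_def\<close>)
qed

section \<open>Exponential decay of solutions\<close>

definition exp_decay :: "(real \<Rightarrow> complex) \<Rightarrow> bool"
  where "exp_decay f \<longleftrightarrow> (\<exists>K a. a > 0 \<and> (\<forall>t\<ge>0. norm (f t) \<le> K * exp (- a * t)))"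

definition ode_sol :: "complex^'n^'n \<Rightarrow> (real \<Rightarrow> complex^'n) \<Rightarrow> bool"
  where "ode_sol A D \<longleftrightarrow>
    (\<forall>t\<ge>0. \<forall>i. ((\<lambda>t. D t $ i) has_vector_derivative (A *v D t) $ i) (at t within {0..}))"

text \<open>The integrating factor removes the homogeneous part: the derivative of \<open>e\<close>
  is the forcing term times an exponential, so the growth of \<open>e\<close> is bounded by
  integration and is slower than the decay that is restored afterwards.\<close>

lemma ode_decay_scalar:
  assumes d: "\<And>t. t \<ge> 0 \<Longrightarrow> (d has_vector_derivative (l * d t + k t)) (at t within {0..})"
    and l: "Re l < 0" and k: "exp_decay k"
  shows "exp_decay d"
proof -
  obtain K a where K: "a > 0" "\<And>t. t \<ge> 0 \<Longrightarrow> norm (k t) \<le> K * exp (- a * t)"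
    using k by (auto simp: exp_decay_def)
  have "K \<ge> 0" using order_trans[OF norm_ge_zero K(2)[of 0]] by simp
  \<comment> \<open>A rate strictly below \<open>- Re l\<close>, so that \<open>m\<close> is
    positive and \<open>K / m\<close> makes sense. Halving also covers the resonant case
    \<open>a = - Re l\<close>, where a solution may carry a factor \<open>t\<close>.\<close>
  define b where "b = min a (- Re l) / 2"
  define m where "m = - Re l - b"
  have b: "b > 0" "b \<le> a" "m > 0" using K l by (auto simp: b_def m_def min_def)
  define e where "e t = exp (of_real t * (- l)) * d t" for t
  have e': "(e has_vector_derivative (exp (of_real t * (- l)) * k t)) (at t within {0..})" if "t \<ge> 0" for t
    unfolding e_def[abs_def]
    by (rule derivative_eq_intros d[OF that] has_vector_derivative_real_field exp_scaleR_has_vector_derivative_right | simp add: algebra_simps has_field_derivative_def)+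
  have "norm (d t) \<le> (norm (d 0) + K / m) * exp (- b * t)" if t: "t \<ge> 0" for t
  proof -
    have "norm (e t - e 0) \<le> K / m * exp (m * t) - K / m * exp (m * 0)"
    proof (cases "t = 0")
      case False
      \<comment> \<open>Mean value inequality: the majorant \<open>K / m * exp (m * x)\<close> is an
        antiderivative of the bound on the derivative of \<open>e\<close>.\<close>
      show ?thesis
      proof (rule differentiable_bound_general[of 0 t e "\<lambda>x. K / m * exp (m * x)"
            "\<lambda>x. exp (of_real x * (- l)) * k x" "\<lambda>x. K * exp (m * x)"])
        show "continuous_on {0..t} e"
          unfolding continuous_on_eq_continuous_within
          using e' has_vector_derivative_continuous continuous_within_subset
          by (metis atLeastAtMost_iff atLeast_iff subsetI)
        fix x assume x: "0 < x" "x < t"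
        have "at x within {0..} = at x" using x by (intro at_within_interior) auto
        then show "(e has_vector_derivative exp (of_real x * (- l)) * k x) (at x)" using e'[of x] x by simp
        show "((\<lambda>x. K / m * exp (m * x)) has_vector_derivative K * exp (m * x)) (at x)"
          using b by (auto intro!: derivative_eq_intros simp flip: has_real_derivative_iff_has_vector_derivative)
        have "norm (exp (of_real x * (- l)) * k x) \<le> exp (- Re l * x) * (K * exp (- a * x))"
          using K(2)[of x] x by (auto simp: norm_mult mult.commute intro!: mult_left_mono)
        also have "\<dots> = K * exp ((- Re l - a) * x)" by (simp add: algebra_simps flip: exp_add)
        also have "\<dots> \<le> K * exp (m * x)"
          using \<open>K \<ge> 0\<close> b x by (auto simp: m_def intro!: mult_left_mono mult_right_mono)
        finally show "norm (exp (of_real x * (- l)) * k x) \<le> K * exp (m * x)" .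
      qed (use False t b in \<open>auto intro!: continuous_intros\<close>)
    qed simp
    then have "norm (e t) \<le> norm (d 0) + K / m * exp (m * t)"
    proof -
      have "norm (e t - e 0) \<le> K / m * exp (m * t)"
        by (rule order_trans[OF \<open>norm (e t - e 0) \<le> _\<close>]) (use \<open>K \<ge> 0\<close> b in simp)
      then show ?thesis
        using order_trans[OF norm_triangle_sub[of "e t" "e 0"] add_left_mono] by (simp add: e_def[of 0])
    qed
    also have "\<dots> \<le> (norm (d 0) + K / m) * exp (m * t)"
      using b t by (auto simp: distrib_right mult_le_cancel_left1)
    finally have *: "norm (e t) \<le> (norm (d 0) + K / m) * exp (m * t)" .
    have "d t = exp (of_real t * l) * e t" by (simp add: e_def flip: exp_add mult.assoc)
    then have "norm (d t) = exp (Re l * t) * norm (e t)" by (simp add: norm_mult mult.commute)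
    also have "\<dots> \<le> exp (Re l * t) * ((norm (d 0) + K / m) * exp (m * t))"
      using * by (intro mult_left_mono) auto
    also have "\<dots> = (norm (d 0) + K / m) * exp (- b * t)"
      by (simp add: m_def algebra_simps flip: exp_add)
    finally show ?thesis .
  qed
  then show ?thesis
    unfolding exp_decay_def by (intro exI[of _ "norm (d 0) + K / m"] exI[of _ b]) (use b in auto)
qed

lemma ode_sol_diff_scale:
  assumes "ode_sol A D"
  shows "ode_sol A (\<lambda>t. A *v D t - l *s D t)"
  unfolding ode_sol_def
proof (intro allI impI)
  fix t :: real and i assume t: "t \<ge> 0"
  have "((\<lambda>t. (\<Sum>j\<in>UNIV. A $ i $ j * D t $ j) - l * D t $ i) has_vector_derivative
    (\<Sum>j\<in>UNIV. A $ i $ j * (A *v D t) $ j) - l * (A *v D t) $ i) (at t within {0..})"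
    using assms t unfolding ode_sol_def
    by (intro has_vector_derivative_diff has_vector_derivative_sum has_vector_derivative_mult_right) auto
  then show "((\<lambda>t. (A *v D t - l *s D t) $ i) has_vector_derivative (A *v (A *v D t - l *s D t)) $ i) (at t within {0..})"
    by (simp add: matrix_vector_mult_diff_distrib vec.scale) (simp add: matrix_vector_mult_def)
qed

text \<open>A linear factor \<open>X - l\<close> of \<open>p\<close> is split off: \<open>A D - l D\<close> is again a solution, annihilated by the cofactor,
  and \<open>D' = l D + (A D - l D)\<close>.\<close>

lemma ode_decay_poly:
  assumes "p \<noteq> 0" "\<And>x. poly p x = 0 \<Longrightarrow> Re x < 0" "ode_sol A D" "\<And>t. t \<ge> 0 \<Longrightarrow> poly_apply A p (D t) = 0"
  shows "exp_decay (\<lambda>t. D t $ i)"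
  using assms
proof (induction "degree p" arbitrary: p D i)
  case 0
  then obtain c where c: "p = [:c:]" by (metis degree_0_id)
  with 0 have "c \<noteq> 0" by auto
  then have "D t $ i = 0" if "t \<ge> 0" for t using "0.prems"(4)[OF that] c by (simp add: vec_eq_iff)
  then show ?case by (simp add: exp_decay_def) (intro exI[of _ 0] exI[of _ 1]; simp)
next
  case (Suc m)
  have "\<not> constant (poly p)" using Suc(2) by (simp add: constant_degree)
  then obtain l where l: "poly p l = 0" using fundamental_theorem_of_algebra by blast
  then obtain q where q: "p = [:- l, 1:] * q" by (auto simp: poly_eq_0_iff_dvd)
  have "q \<noteq> 0" using Suc.prems(1) q by auto
  then have "degree p = Suc (degree q)" unfolding q by (subst degree_mult_eq) auto
  have "exp_decay (\<lambda>t. (A *v D t - l *s D t) $ i)" for i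
  proof (rule Suc.hyps(1))
    show "m = degree q" using \<open>degree p = Suc (degree q)\<close> Suc(2) by simp
    show "ode_sol A (\<lambda>t. A *v D t - l *s D t)" using Suc.prems(3) by (rule ode_sol_diff_scale)
    show "poly_apply A q (A *v D t - l *s D t) = 0" if "t \<ge> 0" for t
      using Suc.prems(4)[OF that] unfolding q poly_apply_linear_mult
      by (simp add: poly_apply_diff_arg poly_apply_commute poly_apply_scale_arg)
    show "Re x < 0" if "poly q x = 0" for x using Suc.prems(2)[of x] that q by simp
  qed (rule \<open>q \<noteq> 0\<close>)
  then have "exp_decay (\<lambda>t. (A *v D t) $ i - l * D t $ i)" by simp
  then show ?case
  proof (rule ode_decay_scalar[where l=l, rotated 2])
    show "Re l < 0" using Suc.prems(2)[OF l] .
    show "((\<lambda>t. D t $ i) has_vector_derivative (l * D t $ i + ((A *v D t) $ i - l * D t $ i))) (at t within {0..})"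
      if "t \<ge> 0" for t
      using Suc.prems(3) that by (simp add: ode_sol_def)
  qed
qed

definition hurwitz :: "complex^'n^'n \<Rightarrow> bool"
  where "hurwitz A \<longleftrightarrow> (\<forall>l v. v \<noteq> 0 \<and> A *v v = l *s v \<longrightarrow> Re l < 0)"

lemma ode_decay:
  assumes "hurwitz A" "ode_sol A D"
  shows "exp_decay (\<lambda>t. D t $ i)"
proof -
  obtain p where "p \<noteq> 0" "\<And>v. poly_apply A p v = 0"
    "\<And>l. poly p l = 0 \<Longrightarrow> \<exists>v. v \<noteq> 0 \<and> A *v v = l *s v"
    using annihilating_polynomial_eigenvalues[of A] by metis
  then show ?thesis using assms by (intro ode_decay_poly[of p A]) (auto simp: hurwitz_def)
qed

text \<open>The matrix exponential of \<open>t A\<close> applied to \<open>b\<close>, written as one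
  scalar power series per component so that termwise differentiation of complex power series
  applies.\<close>

definition flow :: "complex^'n^'n \<Rightarrow> complex^'n \<Rightarrow> real \<Rightarrow> complex^'n"
  where "flow A b t = (\<chi> i. \<Sum>k. ((((*v) A) ^^ k) b $ i / fact k) * of_real t ^ k)"

lemma flow:
  fixes A :: "complex^'n^'n"
  shows "((\<lambda>t. flow A b t $ i) has_vector_derivative (A *v flow A b t) $ i) (at t within S)"
    and "flow A b 0 = b"
proof -
  define c where "c i k = (((*v) A) ^^ k) b $ i / fact k" for i k
  have bl: "bounded_linear ((*v) A)" by simp
  obtain M where M: "M > 0" "\<And>v. norm (A *v v) \<le> norm v * M"
    using bounded_linear.pos_bounded[OF bl] by blast
  have Mk: "norm ((((*v) A) ^^ k) b) \<le> norm b * M ^ k" for k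
  proof (induction k)
    case (Suc k)
    have "norm ((((*v) A) ^^ Suc k) b) \<le> norm ((((*v) A) ^^ k) b) * M" using M(2) by simp
    also have "\<dots> \<le> norm b * M ^ k * M" using Suc M(1) by (intro mult_right_mono) auto
    finally show ?case by (simp add: mult_ac)
  qed simp
  have sm: "summable (\<lambda>k. c i k * z ^ k)" for i and z :: complex
  proof (rule summable_comparison_test')
    show "summable (\<lambda>k. norm b * (inverse (fact k) * (M * norm z) ^ k))"
      by (intro summable_mult summable_exp)
    fix k
    have "norm (c i k * z ^ k) \<le> norm b * M ^ k / fact k * norm z ^ k"
      using order_trans[OF Finite_Cartesian_Product.norm_nth_le Mk[of k]]
      by (auto simp: c_def norm_mult norm_divide norm_power intro!: mult_right_mono divide_right_mono)
    then show "norm (c i k * z ^ k) \<le> norm b * (inverse (fact k) * (M * norm z) ^ k)"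
      by (simp add: field_simps power_mult_distrib)
  qed
  \<comment> \<open>\<open>diffs\<close> shifts the index and multiplies by \<open>k + 1\<close>;
    this cancels against the factorial and leaves one more factor \<open>A\<close>.\<close>
  have dc: "diffs (c i) k = (\<Sum>j\<in>UNIV. A $ i $ j * c j k)" for k
  proof -
    have "diffs (c i) k = (A *v ((((*v) A) ^^ k) b)) $ i / fact k"
      by (simp add: diffs_def c_def del: of_nat_Suc)
    then show ?thesis by (simp add: matrix_vector_mult_def c_def sum_divide_distrib)
  qed
  have "((\<lambda>z. \<Sum>k. c i k * z ^ k) has_field_derivative (\<Sum>k. diffs (c i) k * (of_real t) ^ k)) (at (of_real t))"
    using sm by (rule termdiffs_strong_converges_everywhere)
  also have "(\<Sum>k. diffs (c i) k * (of_real t) ^ k) = (\<Sum>j\<in>UNIV. A $ i $ j * (\<Sum>k. c j k * of_real t ^ k))"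
    using sm[of _ "of_real t"]
    by (simp add: dc sum_distrib_right mult.assoc suminf_sum suminf_mult summable_mult)
  also have "\<dots> = (A *v flow A b t) $ i"
    by (simp add: matrix_vector_mult_def flow_def c_def)
  finally have "((\<lambda>z. \<Sum>k. c i k * z ^ k) has_field_derivative (A *v flow A b t) $ i) (at (of_real t))" .
  then have "((\<lambda>t. \<Sum>k. c i k * of_real t ^ k) has_vector_derivative (A *v flow A b t) $ i) (at t)"
    by (rule has_vector_derivative_real_field)
  then show "((\<lambda>t. flow A b t $ i) has_vector_derivative (A *v flow A b t) $ i) (at t within S)"
    by (simp only: flow_def c_def vec_lambda_beta has_vector_derivative_at_within)
  show "flow A b 0 = b"
  proof (subst vec_eq_iff, intro allI)
    fix i show "flow A b 0 $ i = b $ i"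
      using powser_zero[of "c i"] by (simp add: flow_def c_def)
  qed
qed

lemma ode_sol_flow: "ode_sol A (flow A b)"
  by (simp add: ode_sol_def flow)

lemma continuous_on_flow: "continuous_on S (\<lambda>t. flow A b t $ i)"
  unfolding continuous_on_eq_continuous_within by (intro ballI has_vector_derivative_continuous[OF flow(1)])

definition kern :: "complex^'n^'n \<Rightarrow> complex^'n \<Rightarrow> 'n \<Rightarrow> real \<Rightarrow> complex"
  where "kern A b i t = (if t \<ge> 0 then flow A b t $ i else 0)"

lemma exp_decay_integrable:
  assumes "exp_decay f" and [measurable]: "f \<in> borel_measurable borel" and "\<And>t. t < 0 \<Longrightarrow> f t = 0"
  shows "sig f" "integrable lborel f"
proof -
  obtain K a where K: "a > 0" "\<And>t. t \<ge> 0 \<Longrightarrow> norm (f t) \<le> K * exp (- a * t)"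
    using assms(1) by (auto simp: exp_decay_def)
  have "K \<ge> 0" using order_trans[OF norm_ge_zero K(2)[of 0]] by simp
  have "norm (f t) \<le> K" for t
  proof (cases "t \<ge> 0")
    case True
    have "K * exp (- a * t) \<le> K" using K(1) True \<open>K \<ge> 0\<close> by (auto intro!: mult_left_le)
    with K(2)[OF True] show ?thesis by simp
  qed (use assms(3) \<open>K \<ge> 0\<close> in auto)
  then show "sig f" by (auto simp: sig_def)
  have "(\<lambda>t. exp (- a * t)) integrable_on {0..}"
    using integrable_on_exp_minus_to_infinity[OF K(1), of 0] by simp
  then have "set_integrable lborel {0..} (\<lambda>t. exp (- a * t))"
    using nonnegative_absolutely_integrable_1[of "\<lambda>t. exp (- a * t)" "{0..}"]
    by (simp add: set_integrable_def integrable_completion)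
  then have "integrable lborel (\<lambda>t. K * (indicator {0..} t *\<^sub>R exp (- a * t)))"
    by (intro integrable_mult_right) (simp add: set_integrable_def)
  then show "integrable lborel f"
  proof (rule Bochner_Integration.integrable_bound)
    show "AE t in lborel. norm (f t) \<le> norm (K * (indicator {0..} t *\<^sub>R exp (- a * t)))"
      using K(2) assms(3) \<open>K \<ge> 0\<close> by (auto simp: indicator_def not_le)
  qed simp
qed

lemma kern_measurable [measurable]: "kern A b i \<in> borel_measurable borel"
proof -
  have "(\<lambda>t. flow A b t $ i) \<in> borel_measurable borel"
    by (intro borel_measurable_continuous_onI continuous_on_flow)
  then show ?thesis unfolding kern_def[abs_def] by measurable
qed

lemma kern_sig:
  assumes "hurwitz A" shows "sig (kern A b i)" "integrable lborel (kern A b i)"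
proof -
  have "exp_decay (kern A b i)"
    using ode_decay[OF assms ode_sol_flow, of b i] by (simp add: exp_decay_def kern_def)
  from exp_decay_integrable[OF this kern_measurable] show "sig (kern A b i)" "integrable lborel (kern A b i)"
    by (auto simp: kern_def)
qed

lemma mat_scale: "mat s *v v = s *s (v :: complex^'n)"
proof (subst vec_eq_iff, intro allI)
  fix i
  have "(\<Sum>j\<in>UNIV. (if i = j then s else 0) * v $ j) = (\<Sum>j\<in>UNIV. if j = i then s * v $ i else 0)"
    by (intro sum.cong) auto
  then show "(mat s *v v) $ i = (s *s v) $ i"
    by (simp add: matrix_vector_mult_def mat_def)
qed

lemma hurwitz_resolvent:
  assumes "hurwitz A" "Re s \<ge> 0" shows "invertible (mat s - A)"
  unfolding invertible_left_inverse matrix_left_invertible_ker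
proof (intro allI impI)
  fix v assume "(mat s - A) *v v = 0"
  then have "A *v v = s *s v"
    by (simp add: matrix_vector_mult_diff_rdistrib mat_scale)
  with assms(1) have "v \<noteq> 0 \<Longrightarrow> Re s < 0" unfolding hurwitz_def by blast
  with assms(2) show "v = 0" by linarith
qed

lemma matrix_inv_mult:
  fixes A :: "'a::semiring_1^'n^'n"
  assumes "invertible A" shows "A ** matrix_inv A = mat 1" "matrix_inv A ** A = mat 1"
  using someI_ex[OF assms[unfolded invertible_def]] unfolding matrix_inv_def[symmetric] by simp_all

text \<open>Integrate the derivative of the flow times the Fourier factor over
  \<open>{0..T}\<close>. The boundary term at \<open>T\<close> decays and the one at 0 is
  \<open>b\<close>, which gives a linear equation for the vector \<open>Y\<close> of transforms; the
  resolvent solves it.\<close>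

lemma ft_kern:
  assumes "hurwitz A"
  shows "ft (kern A b i) \<omega> = (matrix_inv (mat (\<i> * of_real \<omega>) - A) *v b) $ i"
proof -
  define Y where "Y = (\<chi> i. ft (kern A b i) \<omega>)"
  have eq: "(A *v Y) $ i - \<i> * of_real \<omega> * Y $ i = - b $ i" for i
  proof -
    let ?F = "\<lambda>t. flow A b t $ i * cis (- (\<omega> * t))"
    let ?f = "\<lambda>t. (A *v flow A b t) $ i * cis (- (\<omega> * t)) - \<i> * of_real \<omega> * ?F t"
    let ?k = "\<lambda>t. (\<Sum>j\<in>UNIV. A $ i $ j * (kern A b j t * cis (- (\<omega> * t)))) - \<i> * of_real \<omega> * (kern A b i t * cis (- (\<omega> * t)))"
    have k: "integrable lborel ?k" using kern_sig[OF assms] by simp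
    have cis': "((\<lambda>t. cis (- (\<omega> * t))) has_vector_derivative (- \<i> * of_real \<omega> * cis (- (\<omega> * t)))) (at t within S)" for t S
    proof -
      have "cis (- (\<omega> * t)) = exp (t *\<^sub>R (- \<i> * of_real \<omega>))" for t
        by (simp add: cis_conv_exp scaleR_conv_of_real mult_ac)
      then show ?thesis
        using exp_scaleR_has_vector_derivative_right[of "- \<i> * of_real \<omega>" t S]
        by (simp only: mult.commute[of "- \<i> * of_real \<omega>"])
    qed
    have F: "(?F has_vector_derivative ?f t) (at t within S)" for t S
      using has_vector_derivative_mult[OF flow(1)[of A b i t S] cis'[of t S]] by (simp add: algebra_simps)
    have cf: "continuous_on S ?f" for S
      by (auto simp: matrix_vector_mult_def intro!: continuous_intros continuous_on_flow)
    have "(LINT t|lborel. indicator {..T} t *\<^sub>R ?k t) = ?F T - b $ i" if T: "T \<ge> 0" for T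
    proof -
      have "(LINT t|lborel. indicator {..T} t *\<^sub>R ?k t) = (LINT t|lborel. indicator {0..T} t *\<^sub>R ?f t)"
        by (intro Bochner_Integration.integral_cong refl)
           (auto simp: indicator_def kern_def matrix_vector_mult_def sum_distrib_right mult.assoc)
      also have "\<dots> = ?F T - ?F 0" by (rule integral_FTC_Icc[OF T F cf])
      finally show ?thesis by (simp add: flow(2))
    qed
    then have "\<forall>\<^sub>F T in at_top. (LINT t|lborel. indicator {..T} t *\<^sub>R ?k t) = ?F T - b $ i"
      by (intro eventually_at_top_linorderI[of 0])
    obtain K a where K: "a > 0" "\<And>t. t \<ge> 0 \<Longrightarrow> norm (flow A b t $ i) \<le> K * exp (- a * t)"
      using ode_decay[OF assms ode_sol_flow, of b i] by (auto simp: exp_decay_def)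
    have "((\<lambda>T. ?F T - b $ i) \<longlongrightarrow> 0 - b $ i) at_top"
    proof (rule tendsto_diff[OF Lim_null_comparison tendsto_const])
      show "\<forall>\<^sub>F T in at_top. norm (?F T) \<le> K * exp (- a * T)"
        by (intro eventually_at_top_linorderI[of 0]) (use K(2) in \<open>simp add: norm_mult\<close>)
      have "filterlim (\<lambda>T. - a * T) at_bot at_top"
        using filterlim_tendsto_neg_mult_at_bot[of "\<lambda>_. - a" "- a" at_top "\<lambda>T. T"] K(1)
        by (simp add: filterlim_ident)
      then have "((\<lambda>T. exp (- a * T)) \<longlongrightarrow> 0) at_top"
        by (rule filterlim_compose[OF exp_at_bot])
      then have "((\<lambda>T. K * exp (- a * T)) \<longlongrightarrow> K * 0) at_top"
        by (rule tendsto_mult_left)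
      then show "((\<lambda>T. K * exp (- a * T)) \<longlongrightarrow> 0) at_top" by simp
    qed
    with \<open>\<forall>\<^sub>F T in at_top. _ = _\<close> have "((\<lambda>T. LINT t|lborel. indicator {..T} t *\<^sub>R ?k t) \<longlongrightarrow> 0 - b $ i) at_top"
      by (rule tendsto_cong[THEN iffD2])
    then have "(LINT t|lborel. ?k t) = 0 - b $ i"
      by (rule tendsto_unique[OF trivial_limit_at_top_linorder tendsto_integral_at_top[OF sets_lborel k]])
    moreover have "(LINT t|lborel. ?k t) = (\<Sum>j\<in>UNIV. A $ i $ j * Y $ j) - \<i> * of_real \<omega> * Y $ i"
      using kern_sig[OF assms]
      by (simp add: Bochner_Integration.integral_diff Bochner_Integration.integral_sum Y_def ft_def)
    ultimately show ?thesis by (simp add: matrix_vector_mult_def)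
  qed
  let ?M = "mat (\<i> * of_real \<omega>) - A"
  have inv: "invertible ?M" using hurwitz_resolvent[OF assms] by simp
  have "?M *v Y = b"
  proof (subst vec_eq_iff, intro allI)
    fix i
    have "(?M *v Y) $ i = - ((A *v Y) $ i - \<i> * of_real \<omega> * Y $ i)"
      by (simp add: matrix_vector_mult_diff_rdistrib mat_scale)
    then show "(?M *v Y) $ i = b $ i" unfolding eq by simp
  qed
  then have "matrix_inv ?M *v b = matrix_inv ?M *v (?M *v Y)" by simp
  also have "\<dots> = Y"
    using matrix_inv_mult[OF inv] by (simp add: matrix_vector_mul_assoc)
  finally show ?thesis by (simp add: Y_def)
qed

section \<open>Response of a linear time-invariant system\<close>

text \<open>Variation of constants in integrated form, since the input is merely measurable. After
  exchanging the two integrals, the inner one is the integral of a derivative of the flow.\<close>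

lemma conv_kern_ode:
  fixes A :: "complex^'n^'n"
  assumes A: "hurwitz A" and u: "sig u" and u0: "\<And>t. t < 0 \<Longrightarrow> u t = 0" and t: "t \<ge> 0"
  shows "((\<lambda>s. (\<Sum>l\<in>UNIV. A $ i $ l * conv (kern A b l) u s) + b $ i * u s) has_integral conv (kern A b i) u t) {0..t}"
proof -
  note [measurable] = sigD[OF u]
  \<comment> \<open>Truncation to \<open>{0..t}\<close> makes the input integrable. By causality it
    leaves the convolution unchanged at times up to \<open>t\<close>.\<close>
  define f where "f a = indicator {0..t} a *\<^sub>R u a" for a
  define g where "g s = complex_of_real (indicator {0..t} s)" for s
  define k where "k s a = (\<Sum>l\<in>UNIV. A $ i $ l * kern A b l (s - a))" for s a
  have f: "integrable lborel f"
    unfolding f_def using sig_prod_integrable[OF u, of "\<lambda>_. 1" 0 t] by (auto simp: sig_def)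
  have g: "integrable lborel g"
    unfolding g_def by (intro integrable_of_real) (simp add: integrable_indicator_iff emeasure_lborel_Icc_eq)
  have [measurable]: "f \<in> borel_measurable borel" unfolding f_def by measurable
  have ks: "sig (\<lambda>x. \<Sum>l\<in>UNIV. A $ i $ l * kern A b l x)"
    by (intro sig_sum sig_cmult kern_sig A)
  obtain K where K: "\<And>x. norm (\<Sum>l\<in>UNIV. A $ i $ l * kern A b l x) \<le> K"
    using ks by (auto simp: sig_def)
  have cf: "conv (kern A b l) u s = (LINT a|lborel. f a * kern A b l (s - a))" if "s \<le> t" for l s
    unfolding conv_commute
    by (intro Bochner_Integration.integral_cong refl) (use that u0 in \<open>auto simp: f_def indicator_def kern_def\<close>)
  have int_fk: "integrable lborel (\<lambda>a. f a * kern A b l (s - a))" for l s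
  proof -
    obtain C where "\<And>x. norm (kern A b l x) \<le> C" using kern_sig(1)[OF A, of b l] unfolding sig_def by blast
    then show ?thesis by (rule integrable_mult_bounded[OF f, rotated]) measurable
  qed
  have "(LINT s|lborel. indicator {0..t} s *\<^sub>R (\<Sum>l\<in>UNIV. A $ i $ l * conv (kern A b l) u s)) =
      (LINT s|lborel. g s * (LINT a|lborel. f a * k s a))"
  proof (intro Bochner_Integration.integral_cong refl)
    fix s
    show "indicator {0..t} s *\<^sub>R (\<Sum>l\<in>UNIV. A $ i $ l * conv (kern A b l) u s) = g s * (LINT a|lborel. f a * k s a)"
    proof (cases "s \<in> {0..t}")
      case True
      then have "(\<Sum>l\<in>UNIV. A $ i $ l * conv (kern A b l) u s) = (\<Sum>l\<in>UNIV. (LINT a|lborel. A $ i $ l * (f a * kern A b l (s - a))))"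
        by (simp add: cf)
      also have "\<dots> = (LINT a|lborel. (\<Sum>l\<in>UNIV. A $ i $ l * (f a * kern A b l (s - a))))"
        by (rule Bochner_Integration.integral_sum[symmetric]) (intro integrable_mult_right int_fk)
      also have "\<dots> = (LINT a|lborel. f a * k s a)"
        by (simp add: k_def sum_distrib_left mult.left_commute)
      finally have "(\<Sum>l\<in>UNIV. A $ i $ l * conv (kern A b l) u s) = (LINT a|lborel. f a * k s a)" .
      moreover have "indicator {0..t} s = (1::real)" "g s = 1" using True by (simp_all add: g_def)
      ultimately show ?thesis by (simp only: scaleR_one mult_1)
    qed (simp add: g_def)
  qed
  also have "\<dots> = (LINT a|lborel. f a * (LINT s|lborel. g s * k s a))"
  proof (rule integral_pair_swap[OF g f])
    show "(\<lambda>(s, a). k s a) \<in> borel_measurable (lborel \<Otimes>\<^sub>M lborel)" unfolding k_def by measurable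
    show "norm (k s a) \<le> K" for s a unfolding k_def by (rule K)
  qed
  \<comment> \<open>The kernel switches on at \<open>s = a\<close>. This lower limit contributes
    \<open>- b $ i\<close>, which the term \<open>b $ i * u s\<close> of the integrand compensates
    at the end.\<close>
  also have "\<dots> = (LINT a|lborel. f a * kern A b i (t - a) - b $ i * f a)"
  proof (intro Bochner_Integration.integral_cong refl)
    fix a
    show "f a * (LINT s|lborel. g s * k s a) = f a * kern A b i (t - a) - b $ i * f a"
    proof (cases "a \<in> {0..t}")
      case True
      have "(LINT s|lborel. g s * k s a) = (LINT s|lborel. indicator {a..t} s *\<^sub>R (A *v flow A b (s - a)) $ i)"
        by (intro Bochner_Integration.integral_cong refl)
           (use True in \<open>auto simp: g_def k_def kern_def indicator_def matrix_vector_mult_def\<close>)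
      also have "\<dots> = flow A b (t - a) $ i - flow A b (a - a) $ i"
      proof (rule integral_FTC_Icc)
        fix x
        have "((\<lambda>s. flow A b s $ i) \<circ> (\<lambda>s. s - a) has_vector_derivative 1 *\<^sub>R (A *v flow A b (x - a)) $ i) (at x within {a..t})"
          by (intro vector_diff_chain_within flow(1)) (auto intro!: derivative_eq_intros)
        then show "((\<lambda>s. flow A b (s - a) $ i) has_vector_derivative (A *v flow A b (x - a)) $ i) (at x within {a..t})"
          by (simp add: o_def)
        show "continuous_on {a..t} (\<lambda>x. (A *v flow A b (x - a)) $ i)"
          unfolding matrix_vector_mult_def vec_lambda_beta
          by (intro continuous_intros continuous_on_compose2[OF continuous_on_flow[of UNIV]]) auto
      qed (use True in simp)
      finally have "(LINT s|lborel. g s * k s a) = flow A b (t - a) $ i - b $ i" by (simp add: flow(2))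
      then show ?thesis using True by (simp only: kern_def) (simp add: right_diff_distrib mult.commute)
    qed (simp add: f_def)
  qed
  also have "\<dots> = conv (kern A b i) u t - (LINT a|lborel. b $ i * f a)"
    unfolding cf[OF order_refl] by (intro Bochner_Integration.integral_diff int_fk integrable_mult_right f)
  finally have 1: "(LINT s|lborel. indicator {0..t} s *\<^sub>R (\<Sum>l\<in>UNIV. A $ i $ l * conv (kern A b l) u s)) =
    conv (kern A b i) u t - (LINT a|lborel. b $ i * f a)" .
  have sc: "sig (\<lambda>s. \<Sum>l\<in>UNIV. A $ i $ l * conv (kern A b l) u s)"
    by (intro sig_sum sig_cmult sig_conv kern_sig A u)
  have i1: "integrable lborel (\<lambda>s. indicator {0..t} s *\<^sub>R (\<Sum>l\<in>UNIV. A $ i $ l * conv (kern A b l) u s))"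
    using sig_prod_integrable[OF sc, of "\<lambda>_. 1" 0 t] by (auto simp: sig_def)
  have si: "set_integrable lborel {0..t} (\<lambda>s. (\<Sum>l\<in>UNIV. A $ i $ l * conv (kern A b l) u s) + b $ i * u s)"
  proof -
    have "integrable lborel (\<lambda>s. indicator {0..t} s *\<^sub>R (\<Sum>l\<in>UNIV. A $ i $ l * conv (kern A b l) u s) + b $ i * f s)"
      using i1 f by simp
    then show ?thesis unfolding set_integrable_def f_def by (simp add: scaleR_add_right)
  qed
  have "(LINT s:{0..t}|lborel. (\<Sum>l\<in>UNIV. A $ i $ l * conv (kern A b l) u s) + b $ i * u s) =
    (LINT s|lborel. indicator {0..t} s *\<^sub>R (\<Sum>l\<in>UNIV. A $ i $ l * conv (kern A b l) u s) + b $ i * f s)"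
    unfolding set_lebesgue_integral_def f_def by (simp add: scaleR_add_right)
  also have "\<dots> = conv (kern A b i) u t"
    using i1 f by (simp add: Bochner_Integration.integral_add 1)
  finally show ?thesis
    using set_borel_integral_eq_integral[OF si] by (simp add: has_integral_iff)
qed

text \<open>Regularity is gained in two rounds: an indefinite integral is continuous, hence so is
  the integrand, and then the fundamental theorem of calculus differentiates.\<close>

lemma ode_solI:
  fixes E :: "real \<Rightarrow> complex^'n"
  assumes E: "\<And>t i. t \<ge> 0 \<Longrightarrow> ((\<lambda>s. (A *v E s) $ i) has_integral (E t $ i - E 0 $ i)) {0..t}"
  shows "ode_sol A E"
proof -
  \<comment> \<open>A compact interval reaching beyond \<open>t\<close> is a neighbourhood of
    \<open>t\<close> in the half line, and there the indefinite integral can be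
    differentiated.\<close>
  have at: "at t within {0..} = at t within {0..t + 1}" if "t \<ge> 0" for t :: real
    using that by (intro at_within_nhd[of t "{..<t + 1}"]) auto
  have rep: "E t $ i = E 0 $ i + integral {0..t} (\<lambda>s. (A *v E s) $ i)" if "t \<ge> 0" for t i
    using integral_unique[OF E[OF that, of i]] by simp
  have cont: "continuous_on {0..T} (\<lambda>t. E t $ i)" if "T \<ge> 0" for T i
  proof -
    have "continuous_on {0..T} (\<lambda>t. E 0 $ i + integral {0..t} (\<lambda>s. (A *v E s) $ i))"
      using has_integral_integrable[OF E[OF that]]
      by (intro continuous_intros indefinite_integral_continuous_1)
    then show ?thesis by (rule continuous_on_eq) (rule rep[symmetric], simp)
  qed
  have "((\<lambda>t. E t $ i) has_vector_derivative (A *v E t) $ i) (at t within {0..})" if t: "t \<ge> 0" for t i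
    unfolding at[OF t]
  proof (rule has_vector_derivative_transform)
    have "continuous_on {0..t + 1} (\<lambda>s. (A *v E s) $ i)"
      unfolding matrix_vector_mult_def vec_lambda_beta using t by (intro continuous_intros cont) auto
    then have "((\<lambda>u. integral {0..u} (\<lambda>s. (A *v E s) $ i)) has_vector_derivative (A *v E t) $ i) (at t within {0..t + 1})"
      using t by (intro integral_has_vector_derivative) auto
    from has_vector_derivative_add[OF has_vector_derivative_const this]
    show "((\<lambda>u. E 0 $ i + integral {0..u} (\<lambda>s. (A *v E s) $ i)) has_vector_derivative (A *v E t) $ i) (at t within {0..t + 1})"
      by simp
    show "t \<in> {0..t + 1}" using t by simp
    show "E u $ i = E 0 $ i + integral {0..u} (\<lambda>s. (A *v E s) $ i)" if "u \<in> {0..t + 1}" for u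
      by (rule rep) (use that in simp)
  qed
  then show ?thesis by (simp add: ode_sol_def)
qed

definition filtered :: "('j::finite \<Rightarrow> real \<Rightarrow> complex) \<Rightarrow> (real \<Rightarrow> complex) \<Rightarrow> ('j \<Rightarrow> real \<Rightarrow> complex) \<Rightarrow> bool"
  where "filtered U z H \<longleftrightarrow> (\<exists>D g d. (\<forall>j. integrable lborel (g j)) \<and> sig d \<and> integrable lborel d \<and>
    (\<forall>t. z t = (\<Sum>j\<in>UNIV. D j * U j t + conv (g j) (U j) t) + d t) \<and> (\<forall>j \<omega>. H j \<omega> = D j + ft (g j) \<omega>))"

lemma filtered_cspec:
  fixes U :: "'j::finite \<Rightarrow> real \<Rightarrow> complex"
  assumes "filtered U z H" "\<And>j. cspec (U j) v (S j)"
  shows "cspec z v (\<lambda>\<omega>. \<Sum>j\<in>UNIV. H j \<omega> * S j \<omega>)"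
proof -
  obtain D g d where g: "\<And>j. integrable lborel (g j)" "sig d" "integrable lborel d"
    and z: "\<And>t. z t = (\<Sum>j\<in>UNIV. D j * U j t + conv (g j) (U j) t) + d t" and H: "\<And>j \<omega>. H j \<omega> = D j + ft (g j) \<omega>"
    using assms(1) unfolding filtered_def by blast
  have v: "sig v" using assms(2) by (simp add: cspec_def)
  have "cspec (\<lambda>t. (\<Sum>j\<in>UNIV. D j * U j t + conv (g j) (U j) t) + d t) v
    (\<lambda>\<omega>. (\<Sum>j\<in>UNIV. D j * S j \<omega> + ft (g j) \<omega> * S j \<omega>) + 0)"
    by (rule cspec_add_left[OF cspec_sum_left[OF cspec_add_left[OF cspec_cmult_left cspec_conv_left]] cspec_transient])
       (use assms(2) g v in auto)
  moreover have "z = (\<lambda>t. (\<Sum>j\<in>UNIV. D j * U j t + conv (g j) (U j) t) + d t)" using z by auto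
  ultimately show ?thesis by (simp add: H distrib_right)
qed

text \<open>Filter on the left, exchange the arguments, filter on the left again. The conjugation in
  the exchange is what puts \<open>cnj\<close> on the second frequency response.\<close>

lemma filtered_cspec2:
  fixes U :: "'j::finite \<Rightarrow> real \<Rightarrow> complex" and V :: "'l::finite \<Rightarrow> real \<Rightarrow> complex"
  assumes "filtered U z H" "filtered V y G" "\<And>j l. cspec (U j) (V l) (S j l)"
  shows "cspec z y (\<lambda>\<omega>. \<Sum>j\<in>UNIV. \<Sum>l\<in>UNIV. H j \<omega> * S j l \<omega> * cnj (G l \<omega>))"
proof -
  have "cspec y (U j) (\<lambda>\<omega>. \<Sum>l\<in>UNIV. G l \<omega> * cnj (S j l \<omega>))" for j
    by (rule filtered_cspec[OF assms(2)]) (rule cspec_swap[OF assms(3)])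
  from filtered_cspec[OF assms(1) cspec_swap[OF this]]
  show ?thesis by (simp add: sum_distrib_left mult_ac)
qed

lemma conv_sum_kernel:
  assumes "\<And>k. k \<in> F \<Longrightarrow> integrable lborel (g k)" "sig u"
  shows "conv (\<lambda>a. \<Sum>k\<in>F. c k * g k a) u t = (\<Sum>k\<in>F. c k * conv (g k) u t)"
proof -
  have "sig (\<lambda>a. u (t - a))" using assms(2) by (auto simp: sig_def)
  then have "integrable lborel (\<lambda>a. c k * (g k a * u (t - a)))" if "k \<in> F" for k
    using sig_mult_integrable assms(1)[OF that] by (intro integrable_mult_right) blast
  then show ?thesis
    unfolding conv_def by (simp add: sum_distrib_right mult.assoc Bochner_Integration.integral_sum)
qed

lemma ft_sum_kernel:
  assumes "\<And>k. k \<in> F \<Longrightarrow> integrable lborel (g k)"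
  shows "ft (\<lambda>a. \<Sum>k\<in>F. c k * g k a) \<omega> = (\<Sum>k\<in>F. c k * ft (g k) \<omega>)"
  using assms unfolding ft_def by (simp add: sum_distrib_right mult.assoc Bochner_Integration.integral_sum)

text \<open>The convolution \<open>Z\<close> is a particular solution, so \<open>X - Z\<close>
  solves the homogeneous equation and decays. This isolates the effect of an arbitrary initial state
  as the transient.\<close>

lemma lti_filtered:
  fixes A :: "complex^'n^'n" and B :: "complex^'m^'n" and U :: "'m \<Rightarrow> real \<Rightarrow> complex"
    and C :: "complex^'n^'p" and D :: "complex^'m^'p"
  assumes A: "hurwitz A" and U: "\<And>j. sig (U j)" and U0: "\<And>j t. t < 0 \<Longrightarrow> U j t = 0"
    and X0: "\<And>t. t < 0 \<Longrightarrow> X t = 0"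
    and X: "\<And>t i. t \<ge> 0 \<Longrightarrow> ((\<lambda>s. (A *v X s) $ i + (\<Sum>j\<in>UNIV. B $ i $ j * U j s)) has_integral (X t $ i - X 0 $ i)) {0..t}"
    and z: "\<And>t. z t = (C *v X t) $ i + (\<Sum>j\<in>UNIV. D $ i $ j * U j t)"
  shows "filtered U z (\<lambda>j \<omega>. (C ** matrix_inv (mat (\<i> * of_real \<omega>) - A) ** B + D) $ i $ j)"
proof -
  define G where "G l j = kern A (column j B) l" for l j
  define Z where "Z t = (\<chi> l. \<Sum>j\<in>UNIV. conv (G l j) (U j) t)" for t
  have G: "integrable lborel (G l j)" for l j unfolding G_def by (rule kern_sig[OF A])
  have Zi: "((\<lambda>s. (A *v Z s) $ l + (\<Sum>j\<in>UNIV. B $ l $ j * U j s)) has_integral Z t $ l) {0..t}" if t: "t \<ge> 0" for t l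
  proof -
    have "((\<lambda>s. \<Sum>j\<in>UNIV. (\<Sum>m\<in>UNIV. A $ l $ m * conv (G m j) (U j) s) + column j B $ l * U j s)
      has_integral (\<Sum>j\<in>UNIV. conv (G l j) (U j) t)) {0..t}"
      unfolding G_def by (intro has_integral_sum conv_kern_ode A U U0 t) auto
    moreover have "(\<Sum>j\<in>UNIV. (\<Sum>m\<in>UNIV. A $ l $ m * conv (G m j) (U j) s) + column j B $ l * U j s) =
      (A *v Z s) $ l + (\<Sum>j\<in>UNIV. B $ l $ j * U j s)" for s
      by (simp add: sum.distrib matrix_vector_mult_def Z_def column_def sum_distrib_left)
         (rule sum.swap)
    ultimately show ?thesis by (simp add: Z_def)
  qed
  \<comment> \<open>An integral over \<open>{0..0}\<close>: the particular solution starts at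
    rest.\<close>
  have "Z 0 $ l = 0" for l using Zi[of 0 l] by (simp add: has_integral_refl has_integral_unique)
  have sol: "ode_sol A (\<lambda>t. X t - Z t)"
  proof (rule ode_solI)
    fix t :: real and l assume t: "t \<ge> 0"
    from has_integral_diff[OF X[OF t, of l] Zi[OF t, of l]]
    show "((\<lambda>s. (A *v (X s - Z s)) $ l) has_integral (X t - Z t) $ l - (X 0 - Z 0) $ l) {0..t}"
      by (simp add: matrix_vector_mult_diff_distrib \<open>\<And>l. Z 0 $ l = 0\<close> algebra_simps)
  qed
  \<comment> \<open>Continuity of \<open>X - Z\<close> is known on \<open>{0..}\<close>; the
    explicit 0 elsewhere makes a measurable function on the line. It agrees with
    \<open>X - Z\<close>, as both terms vanish for negative times.\<close>
  define E where "E l t = (if t \<ge> 0 then (X t - Z t) $ l else 0)" for l t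
  have cont: "continuous_on {0..} (\<lambda>t. (X t - Z t) $ l)" for l
    unfolding continuous_on_eq_continuous_within
    using sol by (intro ballI) (auto simp: ode_sol_def intro!: has_vector_derivative_continuous)
  have Em: "E l \<in> borel_measurable borel" for l
    unfolding E_def[abs_def]
    using borel_measurable_continuous_on_if[of "{0::real..}" "\<lambda>t. (X t - Z t) $ l" "\<lambda>_. 0"] cont by simp
  have "exp_decay (E l)" for l
    using ode_decay[OF A sol, of l] by (simp add: exp_decay_def E_def)
  then have E: "sig (E l)" "integrable lborel (E l)" for l
    using exp_decay_integrable[OF _ Em] by (auto simp: E_def)
  have conv0: "conv (G l j) (U j) t = 0" if "t < 0" for l j t
  proof -
    have "(\<lambda>a. G l j a * U j (t - a)) = (\<lambda>a. 0)"
      using that U0 by (auto simp: G_def kern_def fun_eq_iff)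
    then show ?thesis by (simp add: conv_def)
  qed
  have XE: "X t $ l = (\<Sum>j\<in>UNIV. conv (G l j) (U j) t) + E l t" for t l
    using X0 conv0 by (cases "t \<ge> 0") (auto simp: E_def Z_def not_le)
  have CX: "(C *v X t) $ i = (\<Sum>j\<in>UNIV. conv (\<lambda>a. \<Sum>l\<in>UNIV. C $ i $ l * G l j a) (U j) t) + (\<Sum>l\<in>UNIV. C $ i $ l * E l t)" for t
  proof -
    have "(C *v X t) $ i = (\<Sum>l\<in>UNIV. \<Sum>j\<in>UNIV. C $ i $ l * conv (G l j) (U j) t) + (\<Sum>l\<in>UNIV. C $ i $ l * E l t)"
      by (simp add: matrix_vector_mult_def XE distrib_left sum.distrib sum_distrib_left)
    also have "(\<Sum>l\<in>UNIV. \<Sum>j\<in>UNIV. C $ i $ l * conv (G l j) (U j) t) = (\<Sum>j\<in>UNIV. \<Sum>l\<in>UNIV. C $ i $ l * conv (G l j) (U j) t)"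
      by (rule sum.swap)
    finally show ?thesis by (simp add: conv_sum_kernel G U)
  qed
  show ?thesis
    unfolding filtered_def
  proof (intro exI conjI allI)
    show "integrable lborel (\<lambda>a. \<Sum>l\<in>UNIV. C $ i $ l * G l j a)" for j using G by simp
    show "sig (\<lambda>t. \<Sum>l\<in>UNIV. C $ i $ l * E l t)" by (intro sig_sum sig_cmult E)
    show "integrable lborel (\<lambda>t. \<Sum>l\<in>UNIV. C $ i $ l * E l t)" using E by simp
    show "z t = (\<Sum>j\<in>UNIV. D $ i $ j * U j t + conv (\<lambda>a. \<Sum>l\<in>UNIV. C $ i $ l * G l j a) (U j) t) +
      (\<Sum>l\<in>UNIV. C $ i $ l * E l t)" for t
      by (simp add: z CX sum.distrib)
    fix j \<omega>
    have "(C ** matrix_inv (mat (\<i> * of_real \<omega>) - A) ** B) $ i $ j =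
      (C *v (matrix_inv (mat (\<i> * of_real \<omega>) - A) *v column j B)) $ i"
      by (simp add: matrix_vector_mult_def matrix_matrix_mult_def column_def sum_distrib_left sum_distrib_right mult.assoc)
         (rule sum.swap)
    also have "\<dots> = (\<Sum>l\<in>UNIV. C $ i $ l * ft (G l j) \<omega>)"
      by (simp add: matrix_vector_mult_def[of C] G_def ft_kern[OF A])
    also have "\<dots> = ft (\<lambda>a. \<Sum>l\<in>UNIV. C $ i $ l * G l j a) \<omega>"
      by (rule ft_sum_kernel[symmetric]) (rule G)
    finally show "(C ** matrix_inv (mat (\<i> * of_real \<omega>) - A) ** B + D) $ i $ j =
      D $ i $ j + ft (\<lambda>a. \<Sum>l\<in>UNIV. C $ i $ l * G l j a) \<omega>" by simp
  qed
qed

section \<open>Bounded power signals\<close>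

lemma borel_measurable_vec:
  fixes f :: "'a \<Rightarrow> ('b::euclidean_space)^'n"
  assumes "\<And>i. (\<lambda>x. f x $ i) \<in> borel_measurable M"
  shows "f \<in> borel_measurable M"
proof (subst borel_measurable_euclidean_space, intro ballI)
  fix b :: "'b^'n" assume "b \<in> Basis"
  then obtain i u where b: "b = axis i u" by (auto simp: Basis_vec_def)
  have [measurable]: "(\<lambda>x. f x $ i) \<in> borel_measurable M" by fact
  show "(\<lambda>x. f x \<bullet> b) \<in> borel_measurable M"
    unfolding b inner_axis by measurable
qed

lemma integrable_vec:
  fixes f :: "'a \<Rightarrow> ('b::euclidean_space)^'n"
  assumes "\<And>i. integrable M (\<lambda>x. f x $ i)"
  shows "integrable M f"
proof (rule Bochner_Integration.integrable_bound)
  show "integrable M (\<lambda>x. \<Sum>i\<in>UNIV. norm (f x $ i))" using assms by simp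
  show "f \<in> borel_measurable M" by (rule borel_measurable_vec) (rule borel_measurable_integrable[OF assms])
  have "norm (f x) \<le> (\<Sum>i\<in>UNIV. norm (f x $ i))" for x
    unfolding norm_vec_def by (rule L2_set_le_sum) simp
  then show "AE x in M. norm (f x) \<le> norm (\<Sum>i\<in>UNIV. norm (f x $ i))"
    by (simp add: sum_nonneg)
qed

lemma integrable_vec_nth:
  fixes f :: "'a \<Rightarrow> ('b::euclidean_space)^'n"
  shows "integrable M f \<Longrightarrow> integrable M (\<lambda>x. f x $ i)"
  by (rule integrable_bounded_linear[OF bounded_linear_vec_nth])

lemma integral_vec_nth:
  fixes f :: "'a \<Rightarrow> ('b::euclidean_space)^'n"
  assumes "integrable M f"
  shows "(LINT x|M. f x) $ i = (LINT x|M. f x $ i)"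
  by (rule integral_bounded_linear[OF bounded_linear_vec_nth assms, symmetric])

definition vec_signal :: "(real \<Rightarrow> real^'n) \<Rightarrow> bool"
  where "vec_signal u \<longleftrightarrow> u \<in> borel_measurable borel \<and> (\<forall>t<0. u t = 0) \<and> bounded (u ` {0..})"

abbreviation csig :: "(real \<Rightarrow> real^'n) \<Rightarrow> 'n \<Rightarrow> real \<Rightarrow> complex"
  where "csig u i t \<equiv> complex_of_real (u t $ i)"

lemma vec_signal_sig:
  assumes "vec_signal u" shows "sig (csig u i)"
proof -
  have [measurable]: "u \<in> borel_measurable borel" using assms by (simp add: vec_signal_def)
  obtain B where B: "\<And>t. t \<ge> 0 \<Longrightarrow> norm (u t) \<le> B"
    using assms by (auto simp: vec_signal_def bounded_iff)
  have "norm (csig u i t) \<le> max B 0" for t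
  proof (cases "t \<ge> 0")
    case True
    then show ?thesis using order_trans[OF component_le_norm_cart B[OF True], of i] by simp
  qed (use assms in \<open>simp add: vec_signal_def\<close>)
  moreover have "(\<lambda>t. u t $ i) \<in> borel_measurable borel"
    by (rule measurable_compose[OF _ borel_measurable_continuous_onI]) (auto intro!: continuous_intros)
  then have "csig u i \<in> borel_measurable borel" by simp
  ultimately show ?thesis unfolding sig_def by blast
qed

lemma vec_signalI:
  assumes "\<And>t. t < 0 \<Longrightarrow> u t = 0" "\<And>i. sig (csig u i)"
  shows "vec_signal u"
proof -
  have "(\<lambda>t. Re (csig u i t)) \<in> borel_measurable borel" for i
    using sigD[OF assms(2)] by measurable
  then have "u \<in> borel_measurable borel"
    by (intro borel_measurable_vec) simp
  moreover have "\<exists>B. \<forall>i t. norm (csig u i t) \<le> B i"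
    using assms(2) unfolding sig_def by metis
  then obtain B where B: "\<And>i t. norm (csig u i t) \<le> B i" by blast
  have "norm (u t) \<le> (\<Sum>i\<in>UNIV. B i)" for t
    using B by (intro order_trans[OF norm_le_l1_cart sum_mono]) simp
  then have "bounded (u ` {0..})" unfolding bounded_iff by blast
  ultimately show ?thesis using assms(1) by (simp add: vec_signal_def)
qed

text \<open>The bridge from the gauge integral of matrices in the definition of the correlation to
  Lebesgue integrals of complex scalars.\<close>

lemma avg_product_comp:
  assumes u: "vec_signal u" and v: "vec_signal v"
  shows "avg (\<lambda>t. csig u i (t + \<tau>)) (csig v j) T = complex_of_real (avg_product u v \<tau> T $ i $ j)"
proof -
  let ?f = "\<lambda>t. \<chi> i j. u (t + \<tau>) $ i * v t $ j"
  have c: "integrable lborel (\<lambda>t. indicator {0..T} t *\<^sub>R (u (t + \<tau>) $ i * v t $ j))" for i j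
    using integrable_Re[OF sig_prod_integrable[OF sig_shift[OF vec_signal_sig[OF u, of i], of \<tau>] vec_signal_sig[OF v, of j], of 0 T]]
    by simp
  have i: "integrable lborel (\<lambda>t. indicator {0..T} t *\<^sub>R ?f t)"
    by (intro integrable_vec) (use c in simp)
  then have "integral {0..T} ?f = (LINT t|lborel. indicator {0..T} t *\<^sub>R ?f t)"
    using set_borel_integral_eq_integral(2)[of "{0..T}" ?f] by (simp add: set_integrable_def set_lebesgue_integral_def)
  then have "integral {0..T} ?f $ i $ j = (LINT t|lborel. indicator {0..T} t *\<^sub>R (u (t + \<tau>) $ i * v t $ j))"
    using integral_vec_nth[OF i] integral_vec_nth[OF integrable_vec_nth[OF i]] by simp
  then have "complex_of_real (integral {0..T} ?f $ i $ j) =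
    (LINT t|lborel. complex_of_real (indicator {0..T} t *\<^sub>R (u (t + \<tau>) $ i * v t $ j)))"
    by (simp del: of_real_mult)
  then show ?thesis by (simp add: avg_def avg_product_def scaleR_conv_of_real[where 'a=complex])
qed

lemma avg_power_comp:
  assumes u: "vec_signal u"
  shows "complex_of_real (avg_power u T) = (\<Sum>i\<in>UNIV. avg (csig u i) (csig u i) T)"
proof -
  have c: "integrable lborel (\<lambda>t. indicator {0..T} t *\<^sub>R (u t $ i * u t $ i))" for i
    using integrable_Re[OF sig_prod_integrable[OF vec_signal_sig[OF u, of i] vec_signal_sig[OF u, of i], of 0 T]] by simp
  have n: "(norm (u t))\<^sup>2 = (\<Sum>i\<in>UNIV. u t $ i * u t $ i)" for t
    by (simp add: power2_norm_eq_inner inner_vec_def)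
  have i: "integrable lborel (\<lambda>t. indicator {0..T} t *\<^sub>R (norm (u t))\<^sup>2)"
    unfolding n scaleR_sum_right by (rule Bochner_Integration.integrable_sum) (rule c)
  have "integral {0..T} (\<lambda>t. (norm (u t))\<^sup>2) = (LINT t|lborel. indicator {0..T} t *\<^sub>R (norm (u t))\<^sup>2)"
    using set_borel_integral_eq_integral(2)[of "{0..T}" "\<lambda>t. (norm (u t))\<^sup>2"] i
    by (simp add: set_integrable_def set_lebesgue_integral_def)
  also have "\<dots> = (\<Sum>i\<in>UNIV. LINT t|lborel. indicator {0..T} t *\<^sub>R (u t $ i * u t $ i))"
    unfolding n scaleR_sum_right by (rule Bochner_Integration.integral_sum) (rule c)
  finally have "complex_of_real (integral {0..T} (\<lambda>t. (norm (u t))\<^sup>2)) =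
      (\<Sum>i\<in>UNIV. complex_of_real (LINT t|lborel. indicator {0..T} t *\<^sub>R (u t $ i * u t $ i)))"
    by (simp only: of_real_sum)
  also have "\<dots> = (\<Sum>i\<in>UNIV. LINT t|lborel. indicator {0..T} t *\<^sub>R (csig u i t * cnj (csig u i t)))"
    by (intro sum.cong refl, subst integral_complex_of_real[symmetric])
       (simp add: scaleR_conv_of_real)
  finally show ?thesis by (simp add: avg_power_def avg_def sum_divide_distrib)
qed

lemma spectral_integrand_comp:
  "spectral_integrand u v \<omega> \<tau> $ i $ j = complex_of_real (correlation u v \<tau> $ i $ j) * cis (- (\<omega> * \<tau>))"
  by (simp add: spectral_integrand_def cis_conv_exp mult.assoc)

lemma spectral_density_existsD:
  assumes u: "vec_signal u" and v: "vec_signal v" and S: "spectral_density_exists u v"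
  defines "R i j \<tau> \<equiv> complex_of_real (correlation u v \<tau> $ i $ j)"
  shows "corr (csig u i) (csig v j) (R i j)" "integrable lborel (R i j)"
    "ft (R i j) = (\<lambda>\<omega>. spectral_density u v \<omega> $ i $ j)"
proof -
  have "(avg_product u v \<tau> \<longlongrightarrow> correlation u v \<tau>) at_top" for \<tau>
    using S tendsto_Lim[OF trivial_limit_at_top_linorder]
    unfolding spectral_density_exists_def correlation_exists_def correlation_def by metis
  then have "((\<lambda>T. complex_of_real (avg_product u v \<tau> T $ i $ j)) \<longlongrightarrow> R i j \<tau>) at_top" for \<tau>
    unfolding R_def by (intro tendsto_of_real tendsto_vec_nth)
  then show "corr (csig u i) (csig v j) (R i j)"
    using avg_product_comp[OF u v] unfolding corr_def mean_def by presburger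
  have int: "integrable lborel (spectral_integrand u v \<omega>)" for \<omega>
    using S by (simp add: spectral_density_exists_def)
  from integrable_vec_nth[OF integrable_vec_nth[OF this]]
  have int': "integrable lborel (\<lambda>\<tau>. R i j \<tau> * cis (- (\<omega> * \<tau>)))" for \<omega>
    by (simp add: spectral_integrand_comp R_def)
  \<comment> \<open>At frequency 0 the Fourier factor is 1 and the integrand is the correlation
    itself.\<close>
  from this[of 0] show "integrable lborel (R i j)" by simp
  show "ft (R i j) = (\<lambda>\<omega>. spectral_density u v \<omega> $ i $ j)"
    unfolding spectral_density_def ft_def
    using integral_vec_nth[OF int] integral_vec_nth[OF integrable_vec_nth[OF int]]
    by (simp add: spectral_integrand_comp R_def fun_eq_iff)
qed

lemma mean_power:
  assumes u: "vec_signal u" and R: "\<And>i. mean (csig u i) (csig u i) (r i)"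
  shows "((\<lambda>T. avg_power u T) \<longlongrightarrow> (\<Sum>i\<in>UNIV. Re (r i))) at_top"
    "complex_of_real ((power_norm u)\<^sup>2) = (\<Sum>i\<in>UNIV. r i)"
proof -
  have "((\<lambda>T. \<Sum>i\<in>UNIV. avg (csig u i) (csig u i) T) \<longlongrightarrow> (\<Sum>i\<in>UNIV. r i)) at_top"
    using R unfolding mean_def by (intro tendsto_sum)
  from tendsto_Re[OF this] show *: "((\<lambda>T. avg_power u T) \<longlongrightarrow> (\<Sum>i\<in>UNIV. Re (r i))) at_top"
    by (simp flip: avg_power_comp[OF u])
  then have "Lim at_top (avg_power u) = (\<Sum>i\<in>UNIV. Re (r i))" by (intro tendsto_Lim) auto
  moreover have "(\<Sum>i\<in>UNIV. Re (r i)) \<ge> 0" using mean_nonneg(2)[OF R] by (intro sum_nonneg) auto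
  ultimately have "(power_norm u)\<^sup>2 = (\<Sum>i\<in>UNIV. Re (r i))" by (simp add: power_norm_def)
  moreover have "complex_of_real (Re (r i)) = r i" for i using mean_nonneg(1)[OF R] by (simp add: complex_eq_iff)
  ultimately show "complex_of_real ((power_norm u)\<^sup>2) = (\<Sum>i\<in>UNIV. r i)" by simp
qed

lemma bounded_power_vec_signal: "bounded_power u \<Longrightarrow> vec_signal u"
  by (simp add: bounded_power_def vec_signal_def)

lemma bounded_power_family:
  assumes u: "bounded_power u"
  shows "power_family (csig u) (\<lambda>i j \<tau>. complex_of_real (correlation u u \<tau> $ i $ j))"
proof
  note s = bounded_power_vec_signal[OF u]
  have S: "spectral_density_exists u u" using u by (simp add: bounded_power_def)
  note R = spectral_density_existsD[OF s s S]
  let ?R = "\<lambda>i j \<tau>. complex_of_real (correlation u u \<tau> $ i $ j)"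
  show "sig (csig u i)" for i by (rule vec_signal_sig[OF s])
  show "corr (csig u i) (csig u j) (?R i j)" "integrable lborel (?R i j)" for i j using R by auto
  have tr: "(\<Sum>i\<in>UNIV. ft (?R i i) \<omega>) = trace (spectral_density u u \<omega>)" for \<omega>
    by (simp add: R(3) trace_def)
  have hb: "has_bochner_integral lborel (\<lambda>\<omega>. 1 / (2 * of_real pi) * trace (spectral_density u u \<omega>))
      (complex_of_real ((power_norm u)\<^sup>2))"
    using u by (simp add: bounded_power_def)
  have "integrable lborel (\<lambda>\<omega>. (2 * of_real pi) * (1 / (2 * of_real pi) * trace (spectral_density u u \<omega>)))"
    by (rule integrable_mult_right) (use hb in \<open>simp add: has_bochner_integral_iff\<close>)
  then show "integrable lborel (\<lambda>\<omega>. \<Sum>i\<in>UNIV. ft (?R i i) \<omega>)" by (simp add: tr)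
  have "mean (csig u i) (csig u i) (?R i i 0)" for i
    using R(1)[of i i] unfolding corr_def by (auto dest: spec[of _ 0])
  from mean_power(2)[OF s this]
  have "complex_of_real ((power_norm u)\<^sup>2) = (\<Sum>i\<in>UNIV. ?R i i 0)" .
  moreover have "(LINT \<omega>|lborel. trace (spectral_density u u \<omega>)) / (2 * of_real pi) = complex_of_real ((power_norm u)\<^sup>2)"
    using has_bochner_integral_integral_eq[OF hb] by simp
  ultimately show "ift (\<lambda>\<omega>. \<Sum>i\<in>UNIV. ft (?R i i) \<omega>) 0 = (\<Sum>i\<in>UNIV. ?R i i 0)"
    by (simp add: ift_def tr)
qed

lemma bounded_power_cspec:
  assumes u: "bounded_power u"
  shows "cspec (csig u i) (csig u j) (\<lambda>\<omega>. spectral_density u u \<omega> $ i $ j)"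
proof -
  interpret power_family "csig u" "\<lambda>i j \<tau>. complex_of_real (correlation u u \<tau> $ i $ j)"
    by (rule bounded_power_family[OF u])
  have "spectral_density_exists u u" using u by (simp add: bounded_power_def)
  note R = spectral_density_existsD[OF bounded_power_vec_signal[OF u] bounded_power_vec_signal[OF u] this]
  show ?thesis using cspec_ft[of i j] by (simp add: R(3))
qed

lemma orthogonal_cspec:
  assumes u: "bounded_power u" and v: "bounded_power v" and o: "orthogonal_signals u v"
  shows "cspec (csig u i) (csig v j) (\<lambda>\<omega>. 0)"
proof -
  interpret power_family "csig u" "\<lambda>i j \<tau>. complex_of_real (correlation u u \<tau> $ i $ j)"
    by (rule bounded_power_family[OF u])
  note s = bounded_power_vec_signal[OF u] bounded_power_vec_signal[OF v]
  have "spectral_density_exists u v" using o by (simp add: orthogonal_signals_def)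
  note R = spectral_density_existsD[OF s this]
  have "corr (csig v j) (csig v j) (ift (\<lambda>\<omega>. spectral_density v v \<omega> $ j $ j))"
    using bounded_power_cspec[OF v] by (simp add: cspec_def)
  then have "mean (csig v j) (csig v j) (ift (\<lambda>\<omega>. spectral_density v v \<omega> $ j $ j) 0)"
    unfolding corr_def by (auto dest: spec[of _ 0])
  then show ?thesis
  proof (rule cspec_orthogonal[OF vec_signal_sig[OF s(2)] _ R(1,2)])
    show "ft (\<lambda>\<tau>. complex_of_real (correlation u v \<tau> $ i $ j)) = (\<lambda>_. 0)"
      using o by (simp add: R(3) orthogonal_signals_def)
  qed
qed

text \<open>All ingredients are contained in \<open>cspec\<close>: \<open>ift\<close> of an entry is
  the correlation, \<open>ft\<close> leads back to the entry, so \<open>M\<close> is the spectral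
  density, and the value of \<open>ift\<close> at 0 on the diagonal is the power.\<close>

lemma bounded_powerI:
  fixes z :: "real \<Rightarrow> real^'n"
  assumes z0: "\<And>t. t < 0 \<Longrightarrow> z t = 0"
    and M: "\<And>i j. cspec (csig z i) (csig z j) (\<lambda>\<omega>. M \<omega> $ i $ j)"
  shows "bounded_power z"
    "has_bochner_integral lborel (\<lambda>\<omega>. 1 / (2 * of_real pi) * trace (M \<omega>)) (complex_of_real ((power_norm z)\<^sup>2))"
proof -
  have s: "vec_signal z" using M by (intro vec_signalI z0) (auto simp: cspec_def)
  define R where "R i j = ift (\<lambda>\<omega>. M \<omega> $ i $ j)" for i j
  have C: "corr (csig z i) (csig z j) (R i j)" and Ri: "integrable lborel (R i j)"
    and ftR: "ft (R i j) = (\<lambda>\<omega>. M \<omega> $ i $ j)" and Mi: "integrable lborel (\<lambda>\<omega>. M \<omega> $ i $ j)" for i j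
    using M[of i j] by (auto simp: cspec_def R_def)
  have "((\<lambda>T. complex_of_real (avg_product z z \<tau> T $ i $ j)) \<longlongrightarrow> R i j \<tau>) at_top" for i j \<tau>
    unfolding avg_product_comp[OF s s, symmetric] using C[of i j] by (simp add: corr_def mean_def)
  then have lim: "((\<lambda>T. avg_product z z \<tau> T $ i $ j) \<longlongrightarrow> Re (R i j \<tau>)) at_top"
    and im: "((\<lambda>T::real. 0) \<longlongrightarrow> Im (R i j \<tau>)) at_top" for i j \<tau>
    using tendsto_Re tendsto_Im by fastforce+
  \<comment> \<open>The averages of real signals are real, so the imaginary part of the limit is a
    limit of zeros.\<close>
  have real: "complex_of_real (Re (R i j \<tau>)) = R i j \<tau>" for i j \<tau>
    using im[of i j \<tau>] by (simp add: complex_eq_iff tendsto_const_iff)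
  have limm: "(avg_product z z \<tau> \<longlongrightarrow> (\<chi> i j. Re (R i j \<tau>))) at_top" for \<tau>
    using lim by (intro vec_tendstoI) simp
  then have corrR: "correlation z z \<tau> $ i $ j = Re (R i j \<tau>)" for \<tau> i j
    unfolding correlation_def by (subst tendsto_Lim) auto
  have integrand: "spectral_integrand z z \<omega> \<tau> $ i $ j = R i j \<tau> * cis (- (\<omega> * \<tau>))" for \<omega> \<tau> i j
    by (simp add: spectral_integrand_comp corrR real)
  have int: "integrable lborel (spectral_integrand z z \<omega>)" for \<omega>
    by (intro integrable_vec) (simp add: integrand Ri)
  have S: "spectral_density z z \<omega> = M \<omega>" for \<omega>
  proof (subst vec_eq_iff, intro allI, subst vec_eq_iff, intro allI)
    fix i j
    have "spectral_density z z \<omega> $ i $ j = ft (R i j) \<omega>"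
      unfolding spectral_density_def ft_def
      using integral_vec_nth[OF int] integral_vec_nth[OF integrable_vec_nth[OF int]]
      by (simp add: integrand)
    then show "spectral_density z z \<omega> $ i $ j = M \<omega> $ i $ j" by (simp add: ftR)
  qed
  have "mean (csig z i) (csig z i) (R i i 0)" for i
    using C[of i i] unfolding corr_def by (auto dest: spec[of _ 0])
  note P = mean_power[OF s this]
  show hb: "has_bochner_integral lborel (\<lambda>\<omega>. 1 / (2 * of_real pi) * trace (M \<omega>)) (complex_of_real ((power_norm z)\<^sup>2))"
    unfolding P(2) has_bochner_integral_iff
  proof
    have t: "integrable lborel (\<lambda>\<omega>. trace (M \<omega>))" unfolding trace_def using Mi by simp
    show "integrable lborel (\<lambda>\<omega>. 1 / (2 * of_real pi) * trace (M \<omega>))" using t by simp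
    have "(LINT \<omega>|lborel. trace (M \<omega>)) = (\<Sum>i\<in>UNIV. LINT \<omega>|lborel. M \<omega> $ i $ i)"
      unfolding trace_def by (rule Bochner_Integration.integral_sum) (rule Mi)
    then show "(LINT \<omega>|lborel. 1 / (2 * of_real pi) * trace (M \<omega>)) = (\<Sum>i\<in>UNIV. R i i 0)"
      by (simp add: R_def ift_def sum_divide_distrib)
  qed
  have "spectral_density_exists z z"
    using int limm unfolding spectral_density_exists_def correlation_exists_def by blast
  then show "bounded_power z"
    using s P(1) hb unfolding bounded_power_def vec_signal_def S by auto
qed

lemma hurwitz_cmat: "hurwitz (cmat A) \<longleftrightarrow> stable_matrix A"
  by (simp add: hurwitz_def stable_matrix_def)

lemma state_space_filtered:
  fixes A :: "real^'n^'n" and B :: "real^'m^'n" and C :: "real^'n^'p" and D :: "real^'m^'p"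
  assumes A: "stable_matrix A" and w: "vec_signal w"
    and x: "state_eq x (\<lambda>t. A *v x t + B *v w t)" and z: "\<And>t. z t = C *v x t + D *v w t"
  shows "filtered (csig w) (csig z i) (\<lambda>j \<omega>. transfer_matrix A B C D (\<i> * of_real \<omega>) $ i $ j)"
  unfolding transfer_matrix_def
proof (rule lti_filtered[where X="\<lambda>t. \<chi> i. csig x i t"])
  show "hurwitz (cmat A)" using A by (simp add: hurwitz_cmat)
  show "sig (csig w j)" for j by (rule vec_signal_sig[OF w])
  show "csig w j t = 0" if "t < 0" for j t using w that by (simp add: vec_signal_def)
  show "(\<chi> i. csig x i t) = 0" if "t < 0" for t using x that by (simp add: state_eq_def vec_eq_iff)
  have cm: "complex_of_real ((M *v v) $ l) = (cmat M *v (\<chi> i. complex_of_real (v $ i))) $ l" for M :: "real^'a^'b" and v l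
    by (simp add: matrix_vector_mult_def cmat_def)
  show "csig z i t = (cmat C *v (\<chi> i. csig x i t)) $ i + (\<Sum>j\<in>UNIV. cmat D $ i $ j * csig w j t)" for t
    by (simp add: z cm) (simp add: matrix_vector_mult_def cmat_def)
  fix t :: real and l assume "t \<ge> 0"
  then have "((\<lambda>t. A *v x t + B *v w t) has_integral (x t - x 0)) {0..t}" using x by (simp add: state_eq_def)
  moreover have "bounded_linear (\<lambda>v :: real^'n. complex_of_real (v $ l))"
    by (rule bounded_linear_compose[OF bounded_linear_of_real bounded_linear_vec_nth])
  ultimately have "((\<lambda>v. complex_of_real (v $ l)) \<circ> (\<lambda>t. A *v x t + B *v w t) has_integral complex_of_real ((x t - x 0) $ l)) {0..t}"
    by (rule has_integral_linear)
  then show "((\<lambda>s. (cmat A *v (\<chi> i. csig x i s)) $ l + (\<Sum>j\<in>UNIV. cmat B $ l $ j * csig w j s))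
      has_integral (\<chi> i. csig x i t) $ l - (\<chi> i. csig x i 0) $ l) {0..t}"
    by (simp add: o_def cm) (simp add: matrix_vector_mult_def cmat_def)
qed

lemma triple_product_nth:
  "(\<Sum>j\<in>UNIV. \<Sum>l\<in>UNIV. T $ i $ j * S $ j $ l * cnj (T' $ k $ l)) = (T ** S ** conj_transpose T') $ i $ k"
  by (simp add: matrix_matrix_mult_def conj_transpose_def sum_distrib_right) (rule sum.swap)

lemma filtered_spectrum:
  assumes "\<And>i. filtered (csig w) (csig z i) (\<lambda>j \<omega>. T \<omega> $ i $ j)"
    and "\<And>i j. cspec (csig w i) (csig w j) (\<lambda>\<omega>. S \<omega> $ i $ j)"
  shows "cspec (csig z i) (csig z k) (\<lambda>\<omega>. (T \<omega> ** S \<omega> ** conj_transpose (T \<omega>)) $ i $ k)"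
  using filtered_cspec2[OF assms(1) assms(1) assms(2)] by (simp add: triple_product_nth)

section \<open>Block matrices and the decomposition of the closed loop\<close>

definition upper :: "'e^('a::finite + 'b::finite) \<Rightarrow> 'e^'a" where "upper v = (\<chi> i. v $ Inl i)"
definition lower :: "'e^('a::finite + 'b::finite) \<Rightarrow> 'e^'b" where "lower v = (\<chi> i. v $ Inr i)"
definition stack :: "'e^'a \<Rightarrow> 'e^'b \<Rightarrow> 'e^('a + 'b)"
  where "stack u v = (\<chi> i. case i of Inl a \<Rightarrow> u $ a | Inr b \<Rightarrow> v $ b)"

lemma upper_lower_stack [simp]: "upper (stack u v) = u" "lower (stack u v) = v"
  by (simp_all add: upper_def lower_def stack_def vec_eq_iff)

lemma stack_upper_lower [simp]: "stack (upper v) (lower v) = v"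
  by (simp add: upper_def lower_def stack_def vec_eq_iff split: sum.split)

lemma stack_eq_iff [simp]: "stack u v = stack u' v' \<longleftrightarrow> u = u' \<and> v = v'"
proof
  assume "stack u v = stack u' v'"
  then have "upper (stack u v) = upper (stack u' v')" "lower (stack u v) = lower (stack u' v')"
    by (rule arg_cong)+
  then show "u = u' \<and> v = v'" by simp
qed simp

lemma stack_add: "stack u v + stack u' v' = stack (u + u') (v + v')"
  by (simp add: stack_def vec_eq_iff split: sum.split)

lemma stack_diff: "stack u v - stack u' v' = stack (u - u') (v - v')"
  by (simp add: stack_def vec_eq_iff split: sum.split)

lemma sum_UNIV_Plus:
  "(\<Sum>j\<in>(UNIV :: ('a::finite + 'b::finite) set). f j) = (\<Sum>a\<in>UNIV. f (Inl a)) + (\<Sum>b\<in>UNIV. f (Inr b))"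
  unfolding UNIV_Plus_UNIV[symmetric] by (subst sum.Plus) simp_all

lemma hcat_mult_vector: "(M ||| N) *v v = M *v upper v + N *v lower v"
  by (simp add: vec_eq_iff matrix_vector_mult_def hcat_def upper_def lower_def sum_UNIV_Plus)

lemma vcat_mult_vector: "(M /// N) *v v = stack (M *v v) (N *v v)"
  by (simp add: vec_eq_iff matrix_vector_mult_def vcat_def stack_def split: sum.split)

lemma neg_mult_vector: "(- M) *v v = - (M *v (v :: 'e::ring_1^'n))"
  by (simp add: vec_eq_iff matrix_vector_mult_def sum_negf)

lemma mult_neg_vector: "M *v (- v) = - (M *v (v :: 'e::ring_1^'n))"
  by (simp add: vec_eq_iff matrix_vector_mult_def sum_negf)

text \<open>An identity of block matrices is tested on an arbitrary vector. These rules push the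
  vector through all blocks until only sums of products with its parts remain, which the simplifier
  compares.\<close>

lemmas block_simps = hcat_mult_vector vcat_mult_vector neg_mult_vector mult_neg_vector stack_add stack_diff
  matrix_vector_mul_assoc[symmetric] matrix_vector_mult_add_rdistrib matrix_vector_mult_diff_rdistrib
  matrix_vector_right_distrib matrix_vector_mult_diff_distrib

lemma matrix_mult_hcat: "M ** (N ||| N') = (M ** N ||| M ** N')"
  by (simp add: vec_eq_iff matrix_matrix_mult_def hcat_def split: sum.split)

lemma hcat_add: "(M ||| N) + (M' ||| N') = (M + M' ||| N + N')"
  by (simp add: vec_eq_iff hcat_def split: sum.split)

lemma cmat_mult: "cmat (M ** N) = cmat M ** cmat N"
  by (simp add: vec_eq_iff cmat_def matrix_matrix_mult_def)

lemma cmat_add: "cmat (M + N) = cmat M + cmat N"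
  by (simp add: vec_eq_iff cmat_def)

lemma cmat_zero [simp]: "cmat 0 = 0"
  by (simp add: vec_eq_iff cmat_def)

lemma cmat_one: "cmat (mat 1) = mat 1"
  by (simp add: vec_eq_iff cmat_def mat_def)

lemma cmat_hcat: "cmat (M ||| N) = (cmat M ||| cmat N)"
  by (simp add: vec_eq_iff cmat_def hcat_def split: sum.split)

lemma mat_commute: "mat s ** P = P ** mat (s :: complex)"
  by (simp add: matrix_eq matrix_vector_mul_assoc[symmetric] mat_scale vec.scale)

lemma matrix_mult_add_rdistrib: "(M + M') ** N = M ** N + M' ** (N :: 'e::semiring_1^'n^'m)"
  by (simp add: vec_eq_iff matrix_matrix_mult_def distrib_right sum.distrib)

lemma matrix_mult_diff_distrib: "M ** (N - N') = M ** N - M ** (N' :: 'e::ring_1^'n^'m)"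
  by (simp add: vec_eq_iff matrix_matrix_mult_def right_diff_distrib sum_subtractf)

lemma matrix_mult_diff_rdistrib: "(M - M') ** N = M ** N - M' ** (N :: 'e::ring_1^'n^'m)"
  by (simp add: vec_eq_iff matrix_matrix_mult_def left_diff_distrib sum_subtractf)

text \<open>\<open>P\<close> intertwines \<open>mat s - A\<close> with \<open>mat s - A'\<close>.
  The right inverse \<open>R\<close> makes \<open>P\<close> surjective, so that invertibility passes
  from the large matrix to the small one.\<close>

lemma resolvent_intertwine:
  fixes A :: "complex^'n^'n" and A' :: "complex^'m^'m"
  assumes P: "P ** A = A' ** P" and R: "P ** R = mat 1" and inv: "invertible (mat s - A)"
  shows "P ** matrix_inv (mat s - A) = matrix_inv (mat s - A') ** P"
proof -
  let ?N = "matrix_inv (mat s - A)" and ?N' = "matrix_inv (mat s - A')"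
  have PA: "P ** (mat s - A) = (mat s - A') ** P"
    by (simp add: matrix_mult_diff_distrib matrix_mult_diff_rdistrib P mat_commute)
  have PN: "(mat s - A') ** (P ** ?N) = P"
    unfolding matrix_mul_assoc PA[symmetric]
    by (simp add: matrix_mul_assoc[symmetric] matrix_inv_mult(1)[OF inv])
  then have "(mat s - A') ** (P ** ?N ** R) = mat 1"
    by (simp add: matrix_mul_assoc R)
  then have inv': "invertible (mat s - A')" unfolding invertible_right_inverse by blast
  have "?N' ** ((mat s - A') ** (P ** ?N)) = P ** ?N"
    by (simp add: matrix_mul_assoc matrix_inv_mult(2)[OF inv'])
  then show ?thesis unfolding PN by simp
qed

text \<open>The output sees the state only through \<open>P1\<close> and \<open>P2\<close>, each of
  which commutes past the resolvent and then meets an input matrix with one zero block. Other modes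
  of \<open>A\<close> cancel.\<close>

lemma transfer_matrix_split:
  fixes A :: "real^'n^'n" and A1 :: "real^'k^'k" and A2 :: "real^'l^'l"
  assumes "P1 ** A = A1 ** P1" "P1 ** R1 = mat 1" "P1 ** B = (B1 ||| 0)"
    and "P2 ** A = A2 ** P2" "P2 ** R2 = mat 1" "P2 ** B = (0 ||| B2)"
    and "C = C1 ** P1 + C2 ** P2" "D = (D1 ||| D2)" and inv: "invertible (mat s - cmat A)"
  shows "transfer_matrix A B C D s = (transfer_matrix A1 B1 C1 D1 s ||| transfer_matrix A2 B2 C2 D2 s)"
proof -
  let ?N = "matrix_inv (mat s - cmat A)"
  have 1: "cmat P1 ** ?N = matrix_inv (mat s - cmat A1) ** cmat P1"
    by (rule resolvent_intertwine[OF _ _ inv, where R="cmat R1"]) (simp_all add: assms cmat_one flip: cmat_mult)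
  have 2: "cmat P2 ** ?N = matrix_inv (mat s - cmat A2) ** cmat P2"
    by (rule resolvent_intertwine[OF _ _ inv, where R="cmat R2"]) (simp_all add: assms cmat_one flip: cmat_mult)
  have b: "cmat P1 ** cmat B = (cmat B1 ||| 0)" "cmat P2 ** cmat B = (0 ||| cmat B2)"
    by (simp_all add: assms cmat_hcat flip: cmat_mult)
  have "cmat C ** ?N ** cmat B = cmat C1 ** (cmat P1 ** ?N) ** cmat B + cmat C2 ** (cmat P2 ** ?N) ** cmat B"
    by (simp add: assms(7) cmat_add cmat_mult matrix_mult_add_rdistrib matrix_mul_assoc)
  also have "\<dots> = cmat C1 ** matrix_inv (mat s - cmat A1) ** (cmat P1 ** cmat B) +
      cmat C2 ** matrix_inv (mat s - cmat A2) ** (cmat P2 ** cmat B)"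
    unfolding 1 2 by (simp add: matrix_mul_assoc)
  finally show ?thesis
    unfolding transfer_matrix_def b by (simp add: assms(8) cmat_hcat matrix_mult_hcat hcat_add)
qed

section \<open>State equations under linear maps\<close>

lemma state_eq_linear:
  fixes P :: "real^'n^'m"
  assumes "state_eq x v" shows "state_eq (\<lambda>t. P *v x t) (\<lambda>t. P *v v t)"
  unfolding state_eq_def
proof (intro conjI allI impI)
  fix t :: real assume "t \<ge> 0"
  then have "(v has_integral (x t - x 0)) {0..t}" using assms by (simp add: state_eq_def)
  from has_integral_linear[OF this matrix_vector_mul_bounded_linear[of P]]
  show "((\<lambda>t. P *v v t) has_integral (P *v x t - P *v x 0)) {0..t}"
    by (simp add: o_def matrix_vector_mult_diff_distrib)
qed (use assms in \<open>simp add: state_eq_def\<close>)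

lemma state_eq_add:
  assumes "state_eq x v" "state_eq x' v'" shows "state_eq (\<lambda>t. x t + x' t) (\<lambda>t. v t + v' t)"
  unfolding state_eq_def
proof (intro conjI allI impI)
  fix t :: real assume "t \<ge> 0"
  then have "((\<lambda>t. v t + v' t) has_integral ((x t - x 0) + (x' t - x' 0))) {0..t}"
    using assms by (intro has_integral_add) (auto simp: state_eq_def)
  then show "((\<lambda>t. v t + v' t) has_integral (x t + x' t - (x 0 + x' 0))) {0..t}"
    by (simp add: algebra_simps)
qed (use assms in \<open>simp add: state_eq_def\<close>)

lemma state_eq_stack:
  assumes "state_eq x v" "state_eq x' v'"
  shows "state_eq (\<lambda>t. stack (x t) (x' t)) (\<lambda>t. stack (v t) (v' t))"
  using state_eq_add[OF state_eq_linear[OF assms(1), of "mat 1 /// 0"] state_eq_linear[OF assms(2), of "0 /// mat 1"]]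
  by (simp add: vcat_mult_vector stack_add)

lemma cspec_add_right:
  assumes "cspec u v S" "cspec u v' S'"
  shows "cspec u (\<lambda>t. v t + v' t) (\<lambda>\<omega>. S \<omega> + S' \<omega>)"
  using cspec_swap[OF cspec_add_left[OF cspec_swap[OF assms(1)] cspec_swap[OF assms(2)]]] by simp

text \<open>The equations of the closed-loop realization without signals or stability, so that the
  decomposition becomes pure block algebra.\<close>

locale tracking_loop =
  fixes A :: "real^'n^'n" and B1 :: "real^'w^'n" and B2 :: "real^'u^'n"
    and C1 :: "real^'y^'z" and C2 :: "real^'n^'y"
    and D12 :: "real^'u^'z" and D21 :: "real^'w^'y"
    and Ac :: "real^'c^'c" and Bc :: "real^'y^'c" and Cc :: "real^'c^'u" and Dc :: "real^'y^'u"
    and Ak :: "real^'k^'k" and Bk :: "real^'y^'k" and Ck :: "real^'k^'u" and Dk :: "real^'y^'u"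
    and L :: "real^'y^'n" and Lc :: "real^'u^'c"
    and Aq :: "real^('c + 'n + 'k)^('c + 'n + 'k)" and Bq :: "real^'y^('c + 'n + 'k)"
    and Cq :: "real^('c + 'n + 'k)^'u" and Dq :: "real^'y^'u"
    and Uc :: "real^('n + 'c + 'n + ('c + 'n + 'k))^'u" and Ud :: "real^('w + 'y)^'u"
    and Ec Fc :: "real^('n + 'c + 'n + ('c + 'n + 'k))^'y" and Ed Fd :: "real^('w + 'y)^'y"
    and Acl :: "real^('n + 'c + 'n + ('c + 'n + 'k))^('n + 'c + 'n + ('c + 'n + 'k))"
    and Bcl :: "real^('w + 'y)^('n + 'c + 'n + ('c + 'n + 'k))"
    and Ccl :: "real^('n + 'c + 'n + ('c + 'n + 'k))^'z" and Dcl :: "real^('w + 'y)^'z"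
  assumes Aq: "Aq = (Ac + Lc ** Cc ||| (Bc + Lc ** Dq) ** C2 ||| - (Lc ** Ck) ///
               0             ||| A + B2 ** Dk ** C2    ||| B2 ** Ck ///
               0             ||| Bk ** C2              ||| Ak)"
    and Bq: "Bq = (- Bc - Lc ** Dq /// L - B2 ** Dk /// - Bk)"
    and Cq: "Cq = (- Cc ||| - (Dq ** C2) ||| Ck)"
    and Dq: "Dq = Dc - Dk"
    and Ec: "Ec = (C2 ||| 0 ||| 0 ||| 0)" and Ed: "Ed = (D21 ||| - mat 1)"
    and Fc: "Fc = (- C2 ||| 0 ||| C2 ||| 0)" and Fd: "Fd = (- D21 ||| 0)"
    and Uc: "Uc = Dc ** Ec + Dq ** Fc + (0 ||| Cc ||| 0 ||| Cq)" and Ud: "Ud = Dc ** Ed + Dq ** Fd"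
    and Acl: "Acl = ((A ||| 0 ||| 0 ||| 0) + B2 ** Uc ///
                (0 ||| Ac + Lc ** Cc ||| 0 ||| 0) - Lc ** Uc + (Bc + Lc ** Dc) ** Ec ///
                (0 ||| 0 ||| A ||| 0) + B2 ** Uc + L ** Fc ///
                (0 ||| 0 ||| 0 ||| Aq) + Bq ** Fc)"
    and Bcl: "Bcl = ((B1 ||| 0) + B2 ** Ud ///
                (Bc + Lc ** Dc) ** Ed - Lc ** Ud ///
                B2 ** Ud + L ** Fd ///
                Bq ** Fd)"
    and Ccl: "Ccl = (C1 ** C2 ||| 0 ||| 0 ||| 0) + D12 ** Uc"
    and Dcl: "Dcl = (0 ||| - C1) + D12 ** Ud"
begin

definition "AK = (A + B2 ** Dk ** C2 ||| B2 ** Ck /// Bk ** C2 ||| Ak)"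
definition "BK = (B1 + B2 ** Dk ** D21 /// Bk ** D21)"
definition "CK = ((C1 + D12 ** Dk) ** C2 ||| D12 ** Ck)"
definition "DK = D12 ** Dk ** D21"
definition "AC = (A + B2 ** Dc ** C2 ||| B2 ** Cc /// Bc ** C2 ||| Ac)"
definition "BC = (- (B2 ** Dc) /// - Bc)"
definition "CC = ((C1 + D12 ** Dc) ** C2 ||| D12 ** Cc)"
definition "DC = - (C1 + D12 ** Dc)"

text \<open>With the estimation error e = xh - x, the blocks are q2 - e and q3. The injection L f
  enters both q2 and e and cancels in the difference, while C2 q2 - f = C2 (q2 - e) + D21 w is the
  measurement in the loop of \<open>K\<close>.\<close>

definition PK :: "real^('n + 'c + 'n + ('c + 'n + 'k))^('n + 'k)"
  where "PK = (mat 1 ||| 0 ||| - mat 1 ||| (0 ||| mat 1 ||| 0) /// 0 ||| 0 ||| 0 ||| (0 ||| 0 ||| mat 1))"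
text \<open>Let yK = C2 q2 - f and uK = Ck q3 + Dk yK be the measurement and the control of the loop
  in \<open>PK\<close>. Since y - yK = C2 (xh - q2), the rest u - uK is the control of
  \<open>C\<close> in the state (xh - q2, xc - q1); \<open>w\<close> and all terms with
  \<open>Lc\<close> drop out.\<close>

definition PC :: "real^('n + 'c + 'n + ('c + 'n + 'k))^('n + 'c)"
  where "PC = (0 ||| 0 ||| mat 1 ||| (0 ||| - mat 1 ||| 0) /// 0 ||| mat 1 ||| 0 ||| (- mat 1 ||| 0 ||| 0))"
text \<open>\<open>RK\<close> and \<open>RC\<close> are sections of the two coordinate maps,
  obtained by setting all other states to 0. They certify surjectivity for
  \<open>resolvent_intertwine\<close>.\<close>

definition RK :: "real^('n + 'k)^('n + 'c + 'n + ('c + 'n + 'k))"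
  where "RK = ((mat 1 ||| 0) /// 0 /// 0 /// 0 /// 0 /// (0 ||| mat 1))"
definition RC :: "real^('n + 'c)^('n + 'c + 'n + ('c + 'n + 'k))"
  where "RC = (0 /// (0 ||| mat 1) /// (mat 1 ||| 0) /// 0)"

lemmas loop = Aq Bq Cq Dq Ec Ed Fc Fd Uc Ud Acl Bcl Ccl Dcl

lemma PK_Acl: "PK ** Acl = AK ** PK"
  unfolding matrix_eq PK_def AK_def loop by (simp add: block_simps)

lemma PC_Acl: "PC ** Acl = AC ** PC"
  unfolding matrix_eq PC_def AC_def loop by (simp add: block_simps)

lemma PK_Bcl: "PK ** Bcl = (BK ||| 0)"
  unfolding matrix_eq PK_def BK_def loop by (simp add: block_simps)

lemma PC_Bcl: "PC ** Bcl = (0 ||| BC)"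
  unfolding matrix_eq PC_def BC_def loop by (simp add: block_simps)

lemma Ccl_split: "Ccl = CK ** PK + CC ** PC"
  unfolding matrix_eq PC_def PK_def CK_def CC_def loop by (simp add: block_simps)

lemma Dcl_split: "Dcl = (DK ||| DC)"
  unfolding matrix_eq DK_def DC_def loop by (simp add: block_simps)

lemma PK_RK: "PK ** RK = mat 1"
  unfolding matrix_eq PK_def RK_def by (simp add: block_simps)

lemma PC_RC: "PC ** RC = mat 1"
  unfolding matrix_eq PC_def RC_def by (simp add: block_simps)

text \<open>The full state has further coordinates, such as xh - x and q1, that do not reach
  \<open>z\<close> but do enter the resolvent of \<open>Acl\<close>; hence the condition on
  \<open>s\<close>.\<close>

lemma closed_loop_transfer_matrix:
  "invertible (mat s - cmat Acl) \<Longrightarrow>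
    transfer_matrix Acl Bcl Ccl Dcl s = (transfer_matrix AK BK CK DK s ||| transfer_matrix AC BC CC DC s)"
  by (rule transfer_matrix_split[OF PK_Acl PK_RK PK_Bcl PC_Acl PC_RC PC_Bcl Ccl_split Dcl_split])

end

lemma state_space_spectrum:
  fixes A :: "real^'n^'n" and B :: "real^'m^'n" and C :: "real^'n^'p" and D :: "real^'m^'p"
  defines "T \<equiv> \<lambda>\<omega>. transfer_matrix A B C D (\<i> * of_real \<omega>)"
  assumes A: "stable_matrix A" and w: "bounded_power w"
    and x: "state_eq x (\<lambda>t. A *v x t + B *v w t)" and z: "\<And>t. z t = C *v x t + D *v w t"
  shows "cspec (csig z i) (csig z k) (\<lambda>\<omega>. (T \<omega> ** spectral_density w w \<omega> ** conj_transpose (T \<omega>)) $ i $ k)"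
    "t < 0 \<Longrightarrow> z t = 0"
proof -
  note s = bounded_power_vec_signal[OF w]
  show "cspec (csig z i) (csig z k) (\<lambda>\<omega>. (T \<omega> ** spectral_density w w \<omega> ** conj_transpose (T \<omega>)) $ i $ k)"
    unfolding T_def by (rule filtered_spectrum[OF state_space_filtered[OF A s x z] bounded_power_cspec[OF w]])
  show "z t = 0" if "t < 0"
    using that x s by (simp add: z state_eq_def vec_signal_def)
qed

text \<open>Initial states are free in all three loops, because they only add transients without
  power. The spectral formulas use \<open>has_bochner_integral\<close> since the bare integral of a
  non-integrable function is 0 by convention.\<close>

theorem theorem1:
  fixes A :: "real^'n^'n" and B1 :: "real^'w^'n" and B2 :: "real^'u^'n"
    and C1 :: "real^'y^'z" and C2 :: "real^'n^'y"
    and D12 :: "real^'u^'z" and D21 :: "real^'w^'y"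
    and Ac :: "real^'c^'c" and Bc :: "real^'y^'c" and Cc :: "real^'c^'u" and Dc :: "real^'y^'u"
    and Ak :: "real^'k^'k" and Bk :: "real^'y^'k" and Ck :: "real^'k^'u" and Dk :: "real^'y^'u"
    and L :: "real^'y^'n" and Lc :: "real^'u^'c"
    and Aq :: "real^('c + 'n + 'k)^('c + 'n + 'k)" and Bq :: "real^'y^('c + 'n + 'k)"
    and Cq :: "real^('c + 'n + 'k)^'u" and Dq :: "real^'y^'u"
    and Tz1w :: "complex \<Rightarrow> complex^'w^'z" and Tz2r :: "complex \<Rightarrow> complex^'y^'z"
    and w :: "real \<Rightarrow> real^'w" and r :: "real \<Rightarrow> real^'y"
    and x xh :: "real \<Rightarrow> real^'n" and xc :: "real \<Rightarrow> real^'c"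
    and xq :: "real \<Rightarrow> real^('c + 'n + 'k)"
    and u uc uq :: "real \<Rightarrow> real^'u" and y f :: "real \<Rightarrow> real^'y" and z :: "real \<Rightarrow> real^'z"
    and x1 :: "real \<Rightarrow> real^'n" and xk1 :: "real \<Rightarrow> real^'k" and u1 :: "real \<Rightarrow> real^'u"
    and y1 :: "real \<Rightarrow> real^'y" and z1 :: "real \<Rightarrow> real^'z"
    and x2 :: "real \<Rightarrow> real^'n" and xc2 :: "real \<Rightarrow> real^'c" and u2 :: "real \<Rightarrow> real^'u"
    and y2 :: "real \<Rightarrow> real^'y" and z2 :: "real \<Rightarrow> real^'z"
    \<comment> \<open>realization of the closed loop: state \<open>(x, xc, xh, xq)\<close>, input \<open>(w, r)\<close>, output \<open>z\<close>;
        \<open>(Uc, Ud)\<close>, \<open>(Ec, Ed)\<close>, \<open>(Fc, Fd)\<close> are the output maps for \<open>u\<close>, \<open>y - r\<close> and \<open>f\<close>\<close>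
    and Uc :: "real^('n + 'c + 'n + ('c + 'n + 'k))^'u" and Ud :: "real^('w + 'y)^'u"
    and Ec Fc :: "real^('n + 'c + 'n + ('c + 'n + 'k))^'y" and Ed Fd :: "real^('w + 'y)^'y"
    and Acl :: "real^('n + 'c + 'n + ('c + 'n + 'k))^('n + 'c + 'n + ('c + 'n + 'k))"
    and Bcl :: "real^('w + 'y)^('n + 'c + 'n + ('c + 'n + 'k))"
    and Ccl :: "real^('n + 'c + 'n + ('c + 'n + 'k))^'z" and Dcl :: "real^('w + 'y)^'z"
  assumes "stabilizable A B2" and "detectable C2 A"
    and "stable_matrix (A + B2 ** Dc ** C2 ||| B2 ** Cc ///
                        Bc ** C2           ||| Ac)"
    and "stable_matrix (A + B2 ** Dk ** C2 ||| B2 ** Ck ///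
                        Bk ** C2           ||| Ak)"
    and "stable_matrix (A + L ** C2)" and "stable_matrix (Ac + Lc ** Cc)"
    \<comment> \<open>the parameter \<open>Q\<close>\<close>
    and "Aq = (Ac + Lc ** Cc ||| (Bc + Lc ** Dq) ** C2 ||| - (Lc ** Ck) ///
               0             ||| A + B2 ** Dk ** C2    ||| B2 ** Ck ///
               0             ||| Bk ** C2              ||| Ak)"
    and "Bq = (- Bc - Lc ** Dq /// L - B2 ** Dk /// - Bk)"
    and "Cq = (- Cc ||| - (Dq ** C2) ||| Ck)"
    and "Dq = Dc - Dk"
    \<comment> \<open>the signals\<close>
    and "bounded_power w" and "bounded_power r" and "orthogonal_signals w r"
    \<comment> \<open>the plant in closed loop with the tracking controller\<close>
    and "state_eq x (\<lambda>t. A *v x t + B1 *v w t + B2 *v u t)"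
    and "\<And>t. z t = C1 *v (C2 *v x t - r t) + D12 *v u t"
    and "\<And>t. y t = C2 *v x t + D21 *v w t"
    and "state_eq xc (\<lambda>t. (Ac + Lc ** Cc) *v xc t - Lc *v u t + (Bc + Lc ** Dc) *v (y t - r t))"
    and "\<And>t. uc t = Cc *v xc t + Dc *v (y t - r t)"
    and "state_eq xh (\<lambda>t. A *v xh t + B2 *v u t + L *v f t)"
    and "\<And>t. f t = C2 *v xh t - y t"
    and "state_eq xq (\<lambda>t. Aq *v xq t + Bq *v f t)"
    and "\<And>t. uq t = Cq *v xq t + Dq *v f t"
    and "\<And>t. u t = uc t + uq t"
    \<comment> \<open>the plant with \<open>r = 0\<close>, controlled by \<open>K\<close>\<close>
    and "state_eq x1 (\<lambda>t. A *v x1 t + B1 *v w t + B2 *v u1 t)"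
    and "\<And>t. z1 t = C1 *v (C2 *v x1 t) + D12 *v u1 t"
    and "\<And>t. y1 t = C2 *v x1 t + D21 *v w t"
    and "state_eq xk1 (\<lambda>t. Ak *v xk1 t + Bk *v y1 t)"
    and "\<And>t. u1 t = Ck *v xk1 t + Dk *v y1 t"
    \<comment> \<open>the plant with \<open>w = 0\<close>, controlled by \<open>C\<close>\<close>
    and "state_eq x2 (\<lambda>t. A *v x2 t + B2 *v u2 t)"
    and "\<And>t. z2 t = C1 *v (C2 *v x2 t - r t) + D12 *v u2 t"
    and "\<And>t. y2 t = C2 *v x2 t"
    and "state_eq xc2 (\<lambda>t. Ac *v xc2 t + Bc *v (y2 t - r t))"
    and "\<And>t. u2 t = Cc *v xc2 t + Dc *v (y2 t - r t)"
    \<comment> \<open>the feedthrough \<open>D12 Dk D21\<close> of \<open>Tz1w\<close> is is \<open>0\<close> in particular if \<open>Dk = 0\<close>\<close>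
    and "\<And>s. Tz1w s = transfer_matrix
               (A + B2 ** Dk ** C2 ||| B2 ** Ck ///
                Bk ** C2           ||| Ak)
               (B1 + B2 ** Dk ** D21 ///
                Bk ** D21)
               ((C1 + D12 ** Dk) ** C2 ||| D12 ** Ck)
               (D12 ** Dk ** D21) s"
    and "\<And>s. Tz2r s = transfer_matrix
               (A + B2 ** Dc ** C2 ||| B2 ** Cc ///
                Bc ** C2           ||| Ac)
               (- (B2 ** Dc) ///
                - Bc)
               ((C1 + D12 ** Dc) ** C2 ||| D12 ** Cc)
               (- (C1 + D12 ** Dc)) s"
    and "Ec = (C2 ||| 0 ||| 0 ||| 0)" and "Ed = (D21 ||| - mat 1)"
    and "Fc = (- C2 ||| 0 ||| C2 ||| 0)" and "Fd = (- D21 ||| 0)"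
    and "Uc = Dc ** Ec + Dq ** Fc + (0 ||| Cc ||| 0 ||| Cq)" and "Ud = Dc ** Ed + Dq ** Fd"
    and "Acl = ((A ||| 0 ||| 0 ||| 0) + B2 ** Uc ///
                (0 ||| Ac + Lc ** Cc ||| 0 ||| 0) - Lc ** Uc + (Bc + Lc ** Dc) ** Ec ///
                (0 ||| 0 ||| A ||| 0) + B2 ** Uc + L ** Fc ///
                (0 ||| 0 ||| 0 ||| Aq) + Bq ** Fc)"
    and "Bcl = ((B1 ||| 0) + B2 ** Ud ///
                (Bc + Lc ** Dc) ** Ed - Lc ** Ud ///
                B2 ** Ud + L ** Fd ///
                Bq ** Fd)"
    and "Ccl = (C1 ** C2 ||| 0 ||| 0 ||| 0) + D12 ** Uc"
    and "Dcl = (0 ||| - C1) + D12 ** Ud"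
  shows "bounded_power z \<and> bounded_power z1 \<and> bounded_power z2 \<and>
    (power_norm z)\<^sup>2 = (power_norm z1)\<^sup>2 + (power_norm z2)\<^sup>2 \<and>
    has_bochner_integral lborel
      (\<lambda>\<omega>. 1 / (2 * of_real pi) * trace (Tz1w (\<i> * of_real \<omega>) ** spectral_density w w \<omega> **
                 conj_transpose (Tz1w (\<i> * of_real \<omega>))))
      (complex_of_real ((power_norm z1)\<^sup>2)) \<and>
    has_bochner_integral lborel
      (\<lambda>\<omega>. 1 / (2 * of_real pi) * trace (Tz2r (\<i> * of_real \<omega>) ** spectral_density r r \<omega> **
                 conj_transpose (Tz2r (\<i> * of_real \<omega>))))
      (complex_of_real ((power_norm z2)\<^sup>2)) \<and>
    (\<forall>s. invertible (mat s - cmat Acl) \<longrightarrow>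
      transfer_matrix Acl Bcl Ccl Dcl s = (Tz1w s ||| Tz2r s))"
proof -
  interpret tracking_loop A B1 B2 C1 C2 D12 D21 Ac Bc Cc Dc Ak Bk Ck Dk L Lc Aq Bq Cq Dq Uc Ud Ec Fc Ed Fd Acl Bcl Ccl Dcl
    by unfold_locales (fact assms)+
  have T1: "Tz1w s = transfer_matrix AK BK CK DK s" for s
    unfolding AK_def BK_def CK_def DK_def by (fact assms)
  have T2: "Tz2r s = transfer_matrix AC BC CC DC s" for s
    unfolding AC_def BC_def CC_def DC_def by (fact assms)
  have AK: "stable_matrix AK" and AC: "stable_matrix AC"
    unfolding AK_def AC_def by (fact assms)+
  have w: "bounded_power w" and r: "bounded_power r" and wr: "orthogonal_signals w r" by (fact assms)+
  define X where "X t = stack (x t) (stack (xc t) (stack (xh t) (xq t)))" for t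
  define W where "W t = stack (w t) (r t)" for t
  \<comment> \<open>There is no algebraic loop: \<open>y\<close> and \<open>f\<close> do not involve
    \<open>u\<close>, so \<open>u\<close> is explicit in the state and the inputs.\<close>
  have u: "u t = Uc *v X t + Ud *v W t" for t
    by (simp add: assms(16,18,20,22,23) X_def W_def loop block_simps)
  have z: "z t = Ccl *v X t + Dcl *v W t" for t
    unfolding Ccl Dcl by (simp add: assms(15) u block_simps) (simp add: X_def W_def block_simps)
  have "state_eq X (\<lambda>t. stack (A *v x t + B1 *v w t + B2 *v u t)
    (stack ((Ac + Lc ** Cc) *v xc t - Lc *v u t + (Bc + Lc ** Dc) *v (y t - r t))
    (stack (A *v xh t + B2 *v u t + L *v f t) (Aq *v xq t + Bq *v f t))))"
    unfolding X_def by (intro state_eq_stack assms)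
  also have "(\<lambda>t. stack (A *v x t + B1 *v w t + B2 *v u t)
    (stack ((Ac + Lc ** Cc) *v xc t - Lc *v u t + (Bc + Lc ** Dc) *v (y t - r t))
    (stack (A *v xh t + B2 *v u t + L *v f t) (Aq *v xq t + Bq *v f t)))) = (\<lambda>t. Acl *v X t + Bcl *v W t)"
    unfolding Acl Bcl fun_eq_iff
    by (simp add: u assms(16,20) block_simps) (simp add: X_def W_def Ec Ed Fc Fd block_simps)
  finally have X: "state_eq X (\<lambda>t. Acl *v X t + Bcl *v W t)" .
  \<comment> \<open>The outputs of the two loops found inside the closed loop. They share the
    equations of \<open>z1\<close> and \<open>z2\<close> but possibly not the initial states; the
    spectra agree because these depend only on the transfer matrix and the input.\<close>
  define \<zeta>1 where "\<zeta>1 t = CK *v (PK *v X t) + DK *v w t" for t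
  define \<zeta>2 where "\<zeta>2 t = CC *v (PC *v X t) + DC *v r t" for t
  have z_split: "z t = \<zeta>1 t + \<zeta>2 t" for t
    unfolding z \<zeta>1_def \<zeta>2_def Ccl_split Dcl_split by (simp add: block_simps W_def)
  have XK: "state_eq (\<lambda>t. PK *v X t) (\<lambda>t. AK *v (PK *v X t) + BK *v w t)"
    using state_eq_linear[OF X, of PK]
    by (simp add: matrix_vector_right_distrib matrix_vector_mul_assoc PK_Acl PK_Bcl)
       (simp add: hcat_mult_vector W_def)
  have XC: "state_eq (\<lambda>t. PC *v X t) (\<lambda>t. AC *v (PC *v X t) + BC *v r t)"
    using state_eq_linear[OF X, of PC]
    by (simp add: matrix_vector_right_distrib matrix_vector_mul_assoc PC_Acl PC_Bcl)
       (simp add: hcat_mult_vector W_def)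
  have "state_eq (\<lambda>t. stack (x1 t) (xk1 t)) (\<lambda>t. stack (A *v x1 t + B1 *v w t + B2 *v u1 t) (Ak *v xk1 t + Bk *v y1 t))"
    by (intro state_eq_stack assms)
  then have X1: "state_eq (\<lambda>t. stack (x1 t) (xk1 t)) (\<lambda>t. AK *v stack (x1 t) (xk1 t) + BK *v w t)"
    by (simp add: assms(26,28) AK_def BK_def block_simps add_ac)
  have z1: "z1 t = CK *v stack (x1 t) (xk1 t) + DK *v w t" for t
    by (simp add: assms(25,26,28) CK_def DK_def block_simps add_ac)
  have "state_eq (\<lambda>t. stack (x2 t) (xc2 t)) (\<lambda>t. stack (A *v x2 t + B2 *v u2 t) (Ac *v xc2 t + Bc *v (y2 t - r t)))"
    by (intro state_eq_stack assms)
  then have X2: "state_eq (\<lambda>t. stack (x2 t) (xc2 t)) (\<lambda>t. AC *v stack (x2 t) (xc2 t) + BC *v r t)"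
    by (simp add: assms(31,33) AC_def BC_def block_simps algebra_simps)
  have z2: "z2 t = CC *v stack (x2 t) (xc2 t) + DC *v r t" for t
    by (simp add: assms(30,31,33) CC_def DC_def block_simps algebra_simps)
  let ?T1 = "\<lambda>\<omega>. Tz1w (\<i> * of_real \<omega>)" and ?T2 = "\<lambda>\<omega>. Tz2r (\<i> * of_real \<omega>)"
  let ?M1 = "\<lambda>\<omega>. ?T1 \<omega> ** spectral_density w w \<omega> ** conj_transpose (?T1 \<omega>)"
  let ?M2 = "\<lambda>\<omega>. ?T2 \<omega> ** spectral_density r r \<omega> ** conj_transpose (?T2 \<omega>)"
  note S1 = state_space_spectrum[OF AK w X1 z1, folded T1] and S2 = state_space_spectrum[OF AC r X2 z2, folded T2]
  note P1 = bounded_powerI[of z1 ?M1, OF S1(2,1)] and P2 = bounded_powerI[of z2 ?M2, OF S2(2,1)]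
  note Z1 = state_space_spectrum[OF AK w XK \<zeta>1_def, folded T1] and Z2 = state_space_spectrum[OF AC r XC \<zeta>2_def, folded T2]
  note s = bounded_power_vec_signal[OF w] bounded_power_vec_signal[OF r]
  have cross: "cspec (csig \<zeta>1 i) (csig \<zeta>2 k) (\<lambda>_. 0)" for i k
    using filtered_cspec2[OF state_space_filtered[OF AK s(1) XK \<zeta>1_def] state_space_filtered[OF AC s(2) XC \<zeta>2_def]
        orthogonal_cspec[OF w r wr], of i k] by simp
  have "cspec (csig z i) (csig z k) (\<lambda>\<omega>. (?M1 \<omega> + ?M2 \<omega>) $ i $ k)" for i k
  proof -
    \<comment> \<open>Four spectra by bilinearity; the mixed ones vanish, one directly and the other
      as \<open>cnj 0\<close> after exchange of the arguments.\<close>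
    have "cspec (\<lambda>t. csig \<zeta>1 i t + csig \<zeta>2 i t) (\<lambda>t. csig \<zeta>1 k t + csig \<zeta>2 k t)
      (\<lambda>\<omega>. (?M1 \<omega> $ i $ k + 0) + (cnj 0 + ?M2 \<omega> $ i $ k))"
      by (intro cspec_add_left cspec_add_right Z1(1) Z2(1) cross cspec_swap[OF cross])
    then show ?thesis by (simp add: z_split)
  qed
  moreover have "z t = 0" if "t < 0" for t using Z1(2)[OF that] Z2(2)[OF that] by (simp add: z_split)
  ultimately have Pz: "bounded_power z"
    "has_bochner_integral lborel (\<lambda>\<omega>. 1 / (2 * of_real pi) * trace (?M1 \<omega> + ?M2 \<omega>)) (complex_of_real ((power_norm z)\<^sup>2))"
    using bounded_powerI[of z "\<lambda>\<omega>. ?M1 \<omega> + ?M2 \<omega>"] by blast+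
  \<comment> \<open>The same integrand is evaluated a second time, as a sum of the two separate
    power formulas; uniqueness of the integral then gives the sum of the powers.\<close>
  have "has_bochner_integral lborel (\<lambda>\<omega>. 1 / (2 * of_real pi) * trace (?M1 \<omega> + ?M2 \<omega>))
      (complex_of_real ((power_norm z1)\<^sup>2) + complex_of_real ((power_norm z2)\<^sup>2))"
    using has_bochner_integral_add[OF P1(2) P2(2)] by (simp add: trace_add add_divide_distrib)
  from has_bochner_integral_eq[OF Pz(2) this]
  have "complex_of_real ((power_norm z)\<^sup>2) = complex_of_real ((power_norm z1)\<^sup>2 + (power_norm z2)\<^sup>2)" by simp
  then have "(power_norm z)\<^sup>2 = (power_norm z1)\<^sup>2 + (power_norm z2)\<^sup>2" by (simp only: of_real_eq_iff)
  then show ?thesis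
    using P1 P2 Pz(1) closed_loop_transfer_matrix by (simp add: T1 T2)
qed

end
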